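(* Let $n\in\{2,3\}$, $\lambda_0\in\mathbb R$, $\Gamma_2>0$, $\beta>0$, $\Gamma_0<0$, $\alpha<0$, and let $V\in\mathbb R^n$ with $|V|=\sqrt{-\alpha/\beta}$ (ordered polar state $v=V$). Consider the system for the perturbation $u=v-V$: $$u_t+\lambda_0((u+V)\cdot\nabla)u+(2\beta VV^T+\beta|u|^2)u-\Gamma_0\Delta u+\Gamma_2\Delta^2u+\nabla q=-\beta|u|^2V-2\beta(u\cdot V)u,\quad\operatorname{div}u=0,\quad u(0)=u_0,$$ equivalently $u_t+A_0u+H(u)=0$ in $\mathrm{FM}_{0,\sigma}(\mathbb R^n)$. Then the zero solution (i.e. the ordered polar state) is nonlinearly unstable in $X_\gamma:=\mathrm{FM}^{4\gamma}(\mathbb R^n)\cap\mathrm{FM}_{0,\sigma}(\mathbb R^n)$ for every $\gamma\in[1/4,1)$.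
   Context: $\mathrm M(\mathbb R^n)$: finite vector valued Radon measures with total variation norm; $\mathrm M_0=\{\mu:\mu(\{0\})=0\}$; $\mu\lfloor\psi$ is the measure with density $\psi$ w.r.t. $\mu$. $\mathrm{FM}=\{\hat\mu:\mu\in\mathrm M\}$ with $\|u\|_{\mathrm{FM}}=\|\mathcal F^{-1}u\|_{\mathrm M}$, $\mathrm{FM}_0=\{\hat\mu:\mu\in\mathrm M_0\}$; for $s\ge0$, $\mathrm{FM}^s=\{u\in\mathrm{FM}:\hat u\lfloor|\xi|^s\in\mathrm M\}$ normed by $\|u\|_{\mathrm{FM}}+\|\hat u\lfloor|\xi|^s\|_{\mathrm M}$. Helmholtz projection $Pu=\mathcal F^{-1}(\hat u\lfloor(I-\xi\xi^T/|\xi|^2))$; $\mathrm{FM}_{0,\sigma}=\{u\in\mathrm{FM}_0(\mathbb R^n,\mathbb C^n):\operatorname{div}u=0\}$. $A_0u=\lambda_0(V\cdot\nabla)u+2\beta P(VV^Tu)-\Gamma_0\Delta u+\Gamma_2\Delta^2u$ on $D(A_0)=\mathrm{FM}_{0,\sigma}\cap\mathrm{FM}^4$, and $H(u)=\beta P(|u|^2u)+\lambda_0P((u\cdot\nabla)u)-PN(u)$ with $N(u)=-\beta|u|^2V-2\beta(u\cdot V)u$. "Unstable in $X_\gamma$" means Lyapunov instability: there is $\varepsilon>0$ such that for every $\delta>0$ there exists $u_0\in X_\gamma$ with $\|u_0\|_{X_\gamma}<\delta$ whose solution $u$ satisfies $\|u(t)\|_{X_\gamma}\ge\varepsilon$ for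 some $t$ in its maximal existence interval (or does not exist globally). *)

theory Defs
  imports "HOL-Analysis.Analysis"
begin

text \<open>Vector fields on R^n with values in C^n are functions of type
  real^'n => complex^'n.  An element of FM is the Fourier transform of a finite
  C^n-valued Radon measure mu on R^n.  Such a measure is represented as
  mu = nu with density f, where nu is a finite (nonnegative) Borel measure and
  f is nu-integrable; its total variation is the integral of |f| w.r.t. nu.\<close>

type_synonym ('n) field = "real^('n::finite) \<Rightarrow> complex^'n"

definition fourier_meas :: "(real^('n::finite)) measure \<Rightarrow> (real^'n \<Rightarrow> complex^'n) \<Rightarrow> ('n::finite) field" where
  "fourier_meas \<nu> f = (\<lambda>x. integral\<^sup>L \<nu> (\<lambda>\<xi>. cis (- (x \<bullet> \<xi>)) *s f \<xi>))"

definition fm_rep :: "(real^('n::finite)) measure \<Rightarrow> (real^'n \<Rightarrow> complex^'n) \<Rightarrow> ('n::finite) field \<Rightarrow> bool" where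
  "fm_rep \<nu> f u \<longleftrightarrow> sets \<nu> = sets borel \<and> finite_measure \<nu> \<and> integrable \<nu> f
      \<and> u = fourier_meas \<nu> f"

definition weight :: "real \<Rightarrow> real^'n \<Rightarrow> real" where
  "weight s \<xi> = norm \<xi> powr s"

text \<open>The space FM^s \<inter> FM_{0,sigma}: mu has no atom at 0, xi . mu = 0 (div u = 0),
  and |xi|^s mu is a finite measure.  For s = 0 the last condition is vacuous,
  so fm_X 0 is FM_{0,sigma}; fm_X 4 is D(A_0); fm_X (4 gamma) is X_gamma.\<close>
definition fm_X :: "real \<Rightarrow> ('n::finite) field \<Rightarrow> bool" where
  "fm_X s u \<longleftrightarrow> (\<exists>\<nu> f. fm_rep \<nu> f u
      \<and> (AE \<xi> in \<nu>. \<xi> = 0 \<longrightarrow> f \<xi> = 0)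
      \<and> (AE \<xi> in \<nu>. (\<Sum>i\<in>UNIV. complex_of_real (\<xi> $ i) * f \<xi> $ i) = 0)
      \<and> integrable \<nu> (\<lambda>\<xi>. weight s \<xi> *\<^sub>R f \<xi>))"

text \<open>Norms (the infimum over representations equals the value at the unique
  representing measure, by injectivity of the Fourier transform on measures).\<close>
definition fm_norm :: "('n::finite) field \<Rightarrow> real" where
  "fm_norm u = Inf {(\<integral>\<xi>. norm (f \<xi>) \<partial>\<nu>) | \<nu> f. fm_rep \<nu> f u}"

definition fmpow_norm :: "real \<Rightarrow> ('n::finite) field \<Rightarrow> real" where
  "fmpow_norm s u = Inf {(\<integral>\<xi>. norm (f \<xi>) \<partial>\<nu>) + (\<integral>\<xi>. weight s \<xi> * norm (f \<xi>) \<partial>\<nu>)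
                         | \<nu> f. fm_rep \<nu> f u \<and> integrable \<nu> (\<lambda>\<xi>. weight s \<xi> *\<^sub>R f \<xi>)}"

text \<open>Helmholtz projection on FM: multiply the Fourier measure by
  I - xi xi^T/|xi|^2 (the atom at xi = 0 is removed, so P maps into FM_{0,sigma}).\<close>
definition helmholtz :: "('n::finite) field \<Rightarrow> ('n::finite) field" where
  "helmholtz w = (let p = (SOME p. fm_rep (fst p) (snd p) w); \<nu> = fst p; f = snd p in
     fourier_meas \<nu> (\<lambda>\<xi>. if \<xi> = 0 then 0 else
        f \<xi> - ((\<Sum>i\<in>UNIV. complex_of_real (\<xi> $ i) * f \<xi> $ i) / complex_of_real ((norm \<xi>)\<^sup>2))
               *s (\<chi> i. complex_of_real (\<xi> $ i))))"

definition pderiv_j :: "'n \<Rightarrow> ('n::finite) field \<Rightarrow> ('n::finite) field" where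
  "pderiv_j j u = (\<lambda>x. vector_derivative (\<lambda>s. u (x + s *\<^sub>R axis j 1)) (at 0))"

definition lapl :: "('n::finite) field \<Rightarrow> ('n::finite) field" where
  "lapl u = (\<lambda>x. \<Sum>j\<in>UNIV. pderiv_j j (pderiv_j j u) x)"

definition conv :: "('n::finite) field \<Rightarrow> ('n::finite) field \<Rightarrow> ('n::finite) field" where
  "conv a u = (\<lambda>x. \<Sum>j\<in>UNIV. (a x $ j) *s pderiv_j j u x)"

definition cvec :: "real^'n \<Rightarrow> complex^'n" where
  "cvec V = (\<chi> i. complex_of_real (V $ i))"

definition dotV :: "real^'n \<Rightarrow> complex^'n \<Rightarrow> complex" where
  "dotV V z = (\<Sum>i\<in>UNIV. complex_of_real (V $ i) * z $ i)"

definition A0 :: "real \<Rightarrow> real \<Rightarrow> real \<Rightarrow> real \<Rightarrow> real^'n \<Rightarrow> ('n::finite) field \<Rightarrow> ('n::finite) field" where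
  "A0 lam0 beta G0 G2 V u = (\<lambda>x.
      lam0 *\<^sub>R conv (\<lambda>_. cvec V) u x
    + (2 * beta) *\<^sub>R helmholtz (\<lambda>y. dotV V (u y) *s cvec V) x
    - G0 *\<^sub>R lapl u x
    + G2 *\<^sub>R lapl (lapl u) x)"

definition Nl :: "real \<Rightarrow> real^'n \<Rightarrow> ('n::finite) field \<Rightarrow> ('n::finite) field" where
  "Nl beta V u = (\<lambda>x. - (beta * (norm (u x))\<^sup>2) *\<^sub>R cvec V
                     - complex_of_real (2 * beta) * dotV V (u x) *s u x)"

definition Hn :: "real \<Rightarrow> real \<Rightarrow> real^'n \<Rightarrow> ('n::finite) field \<Rightarrow> ('n::finite) field" where
  "Hn lam0 beta V u = (\<lambda>x.
      beta *\<^sub>R helmholtz (\<lambda>y. (norm (u y))\<^sup>2 *\<^sub>R u y) x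
    + lam0 *\<^sub>R helmholtz (conv u u) x
    - helmholtz (Nl beta V u) x)"

definition fm_deriv :: "(real \<Rightarrow> ('n::finite) field) \<Rightarrow> ('n::finite) field \<Rightarrow> real \<Rightarrow> bool" where
  "fm_deriv u w t \<longleftrightarrow>
     ((\<lambda>h. fm_norm (\<lambda>x. (u (t + h) x - u t x) /\<^sub>R h - w x)) \<longlongrightarrow> 0) (at 0)"

definition global_solution ::
  "real \<Rightarrow> real \<Rightarrow> real \<Rightarrow> real \<Rightarrow> real^'n \<Rightarrow> real \<Rightarrow> (real \<Rightarrow> ('n::finite) field) \<Rightarrow> bool" where
  "global_solution lam0 beta G0 G2 V \<gamma> u \<longleftrightarrow>
     (\<forall>t\<ge>0. fm_X (4 * \<gamma>) (u t))
   \<and> (\<forall>t\<ge>0. ((\<lambda>s. fmpow_norm (4 * \<gamma>) (\<lambda>x. u s x - u t x)) \<longlongrightarrow> 0) (at t within {0..}))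
   \<and> (\<exists>u'. \<forall>t>0. fm_X 4 (u t) \<and> fm_X 0 (u' t) \<and> fm_deriv u (u' t) t
        \<and> ((\<lambda>s. fm_norm (\<lambda>x. u' s x - u' t x)) \<longlongrightarrow> 0) (at t)
        \<and> (\<forall>x. u' t x + A0 lam0 beta G0 G2 V (u t) x + Hn lam0 beta V (u t) x = 0))"

end

theory Submission
  imports Defs
begin

text \<open>Let \<open>a\<close> be a real unit vector orthogonal to \<open>V\<close> and to \<open>\<xi>0\<close>, with
  \<open>\<mu> = - (G0 * norm \<xi>0 ^ 2 + G2 * norm \<xi>0 ^ 4) > 0\<close>. On a single Fourier mode
  \<open>c exp (- i x \<bullet> \<xi>0) a\<close> all nonlinear terms except the cubic one are killed by the Helmholtz projection,
  and the equation becomes \<open>c' = \<sigma> c - beta |c|^2 c\<close> with \<open>Re \<sigma> = \<mu>\<close>, whose solutions leave the ball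
  \<open>beta |c|^2 \<le> \<mu> / 2\<close> however small \<open>c 0 \<noteq> 0\<close> is. So it suffices that a small global solution starting
  from such a mode keeps this form.

  This uniqueness statement is proved for the atoms of the Fourier measures only, which are Bohr
  means of the field and hence do not depend on the representation. The part \<open>w\<close> of the solution off
  the mode enters every nonlinear term as a factor, and the atoms of a product \<open>v w\<close> sum up to at most
  the total variation of \<open>v\<close> times the atomic mass of \<open>w\<close>; together with the smoothing of the
  fourth-order linear part this forces the atoms of \<open>w\<close> to vanish.\<close>

section \<open>Measures represented by densities\<close>

text \<open>A complex plane wave has constant modulus, whereas a real cosine would feed higher
  harmonics. Hence \<open>beta |u|^2 V\<close> sits at frequency 0, which the projection removes;
  the convective term vanishes because \<open>a\<close> is orthogonal to \<xi>0, and
  \<open>V \<bullet> u\<close> because \<open>a\<close> is orthogonal to \<open>V\<close>. Taking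
  \<xi>0 parallel to \<open>V\<close> merges both conditions into one that two dimensions can
  satisfy. The rate \<mu> is maximal at \<open>norm \<xi>0 ^ 2 = - G0 / (2 * G2)\<close>, with value
  \<open>G0^2 / (4 * G2)\<close>. The obstacle is that the solution is arbitrary and known only
  through some representing measure at each time. Its amplitude \<open>c\<close> is read off as the
  component along \<open>a\<close> of the atom at \<xi>0, and what is left of the atoms forms the
  remainder \<open>W\<close>. The evolution becomes one scalar equation for each pair of frequency
  and component, estimated uniformly over finite sets of pairs. The convective term loses one
  derivative, so \<open>W\<close> is measured with weight \<open>1 + norm \<xi>\<close>: the bound
  \<open>4 * \<gamma> \<ge> 1\<close> makes this weighted mass finite, and smoothing at the
  integrable rate \<open>\<tau> powr (- 1/4)\<close> wins the derivative back.\<close>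

lemma norm_vector_smult: "norm (c *s (z :: complex^'n)) = cmod c * norm z"
  by (simp add: norm_vec_def L2_set_right_distrib norm_mult)

lemma bounded_linear_smult: "bounded_linear (\<lambda>z :: complex^'n. c *s z)"
  by (rule bounded_linear_intro[where K = "cmod c"])
     (auto simp: vec_eq_iff norm_vector_smult algebra_simps)

lemma bounded_linear_smult_left: "bounded_linear (\<lambda>c. c *s (z :: complex^'n))"
  by (rule bounded_linear_intro[where K = "norm z"])
     (auto simp: vec_eq_iff norm_vector_smult algebra_simps)

lemma borel_measurable_smult [measurable]:
  fixes f :: "'a \<Rightarrow> complex^'n"
  assumes [measurable]: "c \<in> borel_measurable M" "f \<in> borel_measurable M"
  shows "(\<lambda>x. c x *s f x) \<in> borel_measurable M"
proof (rule borel_measurable_continuous_Pair[OF assms])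
  have eq: "fst x *s snd x = (\<chi> i. fst x * snd x $ i)" for x :: "complex \<times> (complex^'n)"
    by (simp add: vec_eq_iff)
  show "continuous_on UNIV (\<lambda>x::complex \<times> (complex^'n). fst x *s snd x)"
    unfolding eq by (intro continuous_intros)
qed

lemma borel_measurable_cis [measurable]:
  "f \<in> borel_measurable M \<Longrightarrow> (\<lambda>x. cis (f x)) \<in> borel_measurable M"
  by (rule measurable_compose[of f M borel cis borel])
     (auto intro!: borel_measurable_continuous_onI continuous_intros)

lemma borel_measurable_vec_nth' [measurable]:
  fixes f :: "'a \<Rightarrow> 'b::real_normed_vector^'n"
  shows "f \<in> borel_measurable M \<Longrightarrow> (\<lambda>x. f x $ i) \<in> borel_measurable M"
  by (rule measurable_compose[of f M borel "\<lambda>z. z $ i" borel])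
     (auto intro!: borel_measurable_continuous_onI continuous_intros)

lemma integrable_cis_smult:
  fixes g :: "'a \<Rightarrow> complex^'n"
  assumes "integrable M g" "\<theta> \<in> borel_measurable M"
  shows "integrable M (\<lambda>\<omega>. cis (\<theta> \<omega>) *s g \<omega>)"
  using assms(1) by (rule Bochner_Integration.integrable_bound) (use assms in \<open>auto simp: norm_vector_smult\<close>)

lemma integrable_vecI:
  fixes f :: "'a \<Rightarrow> complex^'n"
  assumes "\<And>i. integrable M (\<lambda>x. f x $ i)"
  shows "integrable M f"
proof -
  have "f = (\<lambda>x. \<Sum>i\<in>UNIV. (f x $ i) *s axis i 1)"
    by (auto simp: vec_eq_iff axis_def if_distrib cong: if_cong)
  moreover have "integrable M (\<lambda>x. \<Sum>i\<in>UNIV. (f x $ i) *s axis i 1)"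
    by (intro Bochner_Integration.integrable_sum integrable_bounded_linear[OF bounded_linear_smult_left] assms)
  ultimately show ?thesis by simp
qed

lemma integrable_vec_nth:
  fixes f :: "'a \<Rightarrow> complex^'n"
  shows "integrable M f \<Longrightarrow> integrable M (\<lambda>x. f x $ i)"
  by (rule integrable_bounded_linear[OF bounded_linear_vec_nth])

lemma integral_vec_nth:
  fixes f :: "'a \<Rightarrow> complex^'n"
  shows "integrable M f \<Longrightarrow> integral\<^sup>L M f $ i = integral\<^sup>L M (\<lambda>x. f x $ i)"
  by (rule integral_bounded_linear[OF bounded_linear_vec_nth, symmetric])

text \<open>The image under \<open>T\<close> of the measure with density \<open>r\<close> is
  absolutely continuous with respect to the image of \<open>M\<close>, and \<open>q\<close> is its
  Radon-Nikodym derivative. This \<open>q\<close> can be taken nonnegative, so integrability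
  transfers in both directions.\<close>

lemma push_density:
  fixes r :: "'a \<Rightarrow> real" and T :: "'a \<Rightarrow> 'b::second_countable_topology"
  assumes M: "finite_measure M" and T [measurable]: "T \<in> borel_measurable M"
    and r: "integrable M r" and r0: "\<And>\<omega>. 0 \<le> r \<omega>"
  shows "\<exists>q \<in> borel_measurable borel. (\<forall>\<phi> :: 'b \<Rightarrow> complex. \<phi> \<in> borel_measurable borel \<longrightarrow>
      (integrable (distr M borel T) (\<lambda>\<xi>. q \<xi> *\<^sub>R \<phi> \<xi>) \<longleftrightarrow> integrable M (\<lambda>\<omega>. r \<omega> *\<^sub>R \<phi> (T \<omega>))) \<and>
      (\<integral>\<xi>. q \<xi> *\<^sub>R \<phi> \<xi> \<partial>distr M borel T) = (\<integral>\<omega>. r \<omega> *\<^sub>R \<phi> (T \<omega>) \<partial>M))"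
proof -
  interpret M: finite_measure M by fact
  have [measurable]: "r \<in> borel_measurable M" using r by auto
  define \<nu> where "\<nu> = distr M borel T"
  define N where "N = distr (density M r) borel T"
  interpret \<nu>: finite_measure \<nu> unfolding \<nu>_def by (rule M.finite_measure_distr) simp
  have fd: "finite_measure (density M r)"
    by (rule finite_measureI) (use r r0 in \<open>auto simp: emeasure_density integrable_iff_bounded less_top\<close>)
  then have fN: "finite_measure N" unfolding N_def
    by (rule finite_measure.finite_measure_distr) simp
  have ac: "absolutely_continuous \<nu> N"
    unfolding absolutely_continuous_def
  proof
    fix A assume "A \<in> null_sets \<nu>"
    then have A: "A \<in> sets borel" "emeasure M (T -` A \<inter> space M) = 0"
      by (auto simp: null_sets_def \<nu>_def emeasure_distr)
    have "T -` A \<inter> space M \<in> null_sets M" using A by auto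
    then have "AE x in M. x \<notin> T -` A \<inter> space M" by (rule AE_not_in)
    then have "emeasure (density M r) (T -` A \<inter> space M) = 0"
      using A(1) by (subst emeasure_density) (auto simp: nn_integral_0_iff_AE)
    then show "A \<in> null_sets N"
      using A(1) by (auto simp: null_sets_def N_def emeasure_distr)
  qed
  have sN: "sets N = sets \<nu>" by (simp add: N_def \<nu>_def)
  \<comment> \<open>Finiteness of \<open>N\<close> makes the derivative finite almost everywhere, so
    a real-valued version exists.\<close>
  obtain q where q: "q \<in> borel_measurable \<nu>" "AE x in \<nu>. RN_deriv \<nu> N x = ennreal (q x)"
     "\<And>x. 0 \<le> q x"
    using \<nu>.real_RN_deriv[OF fN ac sN] by metis
  have "N = density \<nu> (RN_deriv \<nu> N)" using \<nu>.density_RN_deriv[OF ac sN] by simp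
  also have "\<dots> = density \<nu> q"
    by (rule density_cong) (use q in auto)
  finally have Nq: "N = density \<nu> q" .
  have mq: "q \<in> borel_measurable borel" using q(1) by (simp add: \<nu>_def)
  show ?thesis
  proof (intro bexI[OF _ mq] allI impI)
    fix \<phi> :: "'b \<Rightarrow> complex" assume p [measurable]: "\<phi> \<in> borel_measurable borel"
    have p': "\<phi> \<in> borel_measurable \<nu>" by (simp add: \<nu>_def)
    have "integrable \<nu> (\<lambda>\<xi>. q \<xi> *\<^sub>R \<phi> \<xi>) \<longleftrightarrow> integrable N \<phi>"
      unfolding Nq by (rule integrable_density[symmetric]) (use q p' in auto)
    also have "\<dots> \<longleftrightarrow> integrable (density M r) (\<lambda>\<omega>. \<phi> (T \<omega>))"
      unfolding N_def by (rule integrable_distr_eq) auto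
    also have "\<dots> \<longleftrightarrow> integrable M (\<lambda>\<omega>. r \<omega> *\<^sub>R \<phi> (T \<omega>))"
      by (rule integrable_density) (use r0 in auto)
    finally have 1: "integrable \<nu> (\<lambda>\<xi>. q \<xi> *\<^sub>R \<phi> \<xi>) \<longleftrightarrow> integrable M (\<lambda>\<omega>. r \<omega> *\<^sub>R \<phi> (T \<omega>))" .
    have "(\<integral>\<xi>. q \<xi> *\<^sub>R \<phi> \<xi> \<partial>\<nu>) = integral\<^sup>L N \<phi>"
      unfolding Nq by (rule integral_density[symmetric]) (use q p' in auto)
    also have "\<dots> = (\<integral>\<omega>. \<phi> (T \<omega>) \<partial>density M r)"
      unfolding N_def by (rule integral_distr) auto
    also have "\<dots> = (\<integral>\<omega>. r \<omega> *\<^sub>R \<phi> (T \<omega>) \<partial>M)"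
      by (rule integral_density) (use r0 in auto)
    finally show "(integrable (distr M borel T) (\<lambda>\<xi>. q \<xi> *\<^sub>R \<phi> \<xi>) \<longleftrightarrow> integrable M (\<lambda>\<omega>. r \<omega> *\<^sub>R \<phi> (T \<omega>))) \<and>
      (\<integral>\<xi>. q \<xi> *\<^sub>R \<phi> \<xi> \<partial>distr M borel T) = (\<integral>\<omega>. r \<omega> *\<^sub>R \<phi> (T \<omega>) \<partial>M)"
      using 1 by (simp add: \<nu>_def)
  qed
qed

text \<open>Splitting into positive and negative parts leaves only one direction of integrability:
  on a fibre of \<open>T\<close> the two parts may cancel.\<close>

lemma push_density_real:
  fixes r :: "'a \<Rightarrow> real" and T :: "'a \<Rightarrow> 'b::second_countable_topology"
  assumes M: "finite_measure M" and T [measurable]: "T \<in> borel_measurable M"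
    and r: "integrable M r"
  shows "\<exists>q \<in> borel_measurable borel. \<forall>\<phi> :: 'b \<Rightarrow> complex. \<phi> \<in> borel_measurable borel \<longrightarrow>
      integrable M (\<lambda>\<omega>. r \<omega> *\<^sub>R \<phi> (T \<omega>)) \<longrightarrow>
      integrable (distr M borel T) (\<lambda>\<xi>. q \<xi> *\<^sub>R \<phi> \<xi>) \<and>
      (\<integral>\<xi>. q \<xi> *\<^sub>R \<phi> \<xi> \<partial>distr M borel T) = (\<integral>\<omega>. r \<omega> *\<^sub>R \<phi> (T \<omega>) \<partial>M)"
proof -
  define rp rn where "rp = (\<lambda>\<omega>. max (r \<omega>) 0)" and "rn = (\<lambda>\<omega>. max (- r \<omega>) 0)"
  have [measurable]: "r \<in> borel_measurable M" using r by auto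
  have i: "integrable M rp" "integrable M rn" unfolding rp_def rn_def using r by auto
  have nn: "0 \<le> rp \<omega>" "0 \<le> rn \<omega>" for \<omega> by (auto simp: rp_def rn_def)
  obtain p where p: "p \<in> borel_measurable borel" "\<And>\<phi> :: 'b \<Rightarrow> complex. \<phi> \<in> borel_measurable borel \<Longrightarrow>
      (integrable (distr M borel T) (\<lambda>\<xi>. p \<xi> *\<^sub>R \<phi> \<xi>) \<longleftrightarrow> integrable M (\<lambda>\<omega>. rp \<omega> *\<^sub>R \<phi> (T \<omega>))) \<and>
      (\<integral>\<xi>. p \<xi> *\<^sub>R \<phi> \<xi> \<partial>distr M borel T) = (\<integral>\<omega>. rp \<omega> *\<^sub>R \<phi> (T \<omega>) \<partial>M)"
    using push_density[OF M T i(1) nn(1)] by auto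
  obtain n where n: "n \<in> borel_measurable borel" "\<And>\<phi> :: 'b \<Rightarrow> complex. \<phi> \<in> borel_measurable borel \<Longrightarrow>
      (integrable (distr M borel T) (\<lambda>\<xi>. n \<xi> *\<^sub>R \<phi> \<xi>) \<longleftrightarrow> integrable M (\<lambda>\<omega>. rn \<omega> *\<^sub>R \<phi> (T \<omega>))) \<and>
      (\<integral>\<xi>. n \<xi> *\<^sub>R \<phi> \<xi> \<partial>distr M borel T) = (\<integral>\<omega>. rn \<omega> *\<^sub>R \<phi> (T \<omega>) \<partial>M)"
    using push_density[OF M T i(2) nn(2)] by auto
  have d: "r \<omega> *\<^sub>R z = rp \<omega> *\<^sub>R z - rn \<omega> *\<^sub>R z" for \<omega> and z :: complex
    by (simp add: rp_def rn_def max_def flip: scaleR_left_diff_distrib)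
  show ?thesis
  proof (rule bexI[of _ "\<lambda>\<xi>. p \<xi> - n \<xi>"], intro allI impI)
    fix \<phi> :: "'b \<Rightarrow> complex" assume [measurable]: "\<phi> \<in> borel_measurable borel"
      and I: "integrable M (\<lambda>\<omega>. r \<omega> *\<^sub>R \<phi> (T \<omega>))"
    have 1: "integrable M (\<lambda>\<omega>. rp \<omega> *\<^sub>R \<phi> (T \<omega>))" "integrable M (\<lambda>\<omega>. rn \<omega> *\<^sub>R \<phi> (T \<omega>))"
      by (rule Bochner_Integration.integrable_bound[OF I];
          auto simp: rp_def rn_def abs_mult intro!: mult_right_mono)+
    show "integrable (distr M borel T) (\<lambda>\<xi>. (p \<xi> - n \<xi>) *\<^sub>R \<phi> \<xi>) \<and>
      (\<integral>\<xi>. (p \<xi> - n \<xi>) *\<^sub>R \<phi> \<xi> \<partial>distr M borel T) = (\<integral>\<omega>. r \<omega> *\<^sub>R \<phi> (T \<omega>) \<partial>M)"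
      using p(2)[of \<phi>] n(2)[of \<phi>] 1 by (simp add: d scaleR_left_diff_distrib)
  qed (use p(1) n(1) in simp)
qed

lemma push_density_complex:
  fixes r :: "'a \<Rightarrow> complex" and T :: "'a \<Rightarrow> 'b::second_countable_topology"
  assumes M: "finite_measure M" and T [measurable]: "T \<in> borel_measurable M"
    and r: "integrable M r"
  shows "\<exists>q \<in> borel_measurable borel. \<forall>\<phi> :: 'b \<Rightarrow> complex. \<phi> \<in> borel_measurable borel \<longrightarrow>
      integrable M (\<lambda>\<omega>. \<phi> (T \<omega>) * r \<omega>) \<longrightarrow>
      integrable (distr M borel T) (\<lambda>\<xi>. \<phi> \<xi> * q \<xi>) \<and>
      (\<integral>\<xi>. \<phi> \<xi> * q \<xi> \<partial>distr M borel T) = (\<integral>\<omega>. \<phi> (T \<omega>) * r \<omega> \<partial>M)"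
proof -
  have [measurable]: "r \<in> borel_measurable M" using r by auto
  have i: "integrable M (\<lambda>\<omega>. Re (r \<omega>))" "integrable M (\<lambda>\<omega>. Im (r \<omega>))"
    using r by auto
  obtain p where p: "p \<in> borel_measurable borel" "\<And>\<phi> :: 'b \<Rightarrow> complex. \<phi> \<in> borel_measurable borel \<Longrightarrow>
      integrable M (\<lambda>\<omega>. Re (r \<omega>) *\<^sub>R \<phi> (T \<omega>)) \<Longrightarrow>
      integrable (distr M borel T) (\<lambda>\<xi>. p \<xi> *\<^sub>R \<phi> \<xi>) \<and>
      (\<integral>\<xi>. p \<xi> *\<^sub>R \<phi> \<xi> \<partial>distr M borel T) = (\<integral>\<omega>. Re (r \<omega>) *\<^sub>R \<phi> (T \<omega>) \<partial>M)"
    using push_density_real[OF M T i(1)] by auto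
  obtain n where n: "n \<in> borel_measurable borel" "\<And>\<phi> :: 'b \<Rightarrow> complex. \<phi> \<in> borel_measurable borel \<Longrightarrow>
      integrable M (\<lambda>\<omega>. Im (r \<omega>) *\<^sub>R \<phi> (T \<omega>)) \<Longrightarrow>
      integrable (distr M borel T) (\<lambda>\<xi>. n \<xi> *\<^sub>R \<phi> \<xi>) \<and>
      (\<integral>\<xi>. n \<xi> *\<^sub>R \<phi> \<xi> \<partial>distr M borel T) = (\<integral>\<omega>. Im (r \<omega>) *\<^sub>R \<phi> (T \<omega>) \<partial>M)"
    using push_density_real[OF M T i(2)] by auto
  have d: "z * Complex a b = a *\<^sub>R z + \<i> * (b *\<^sub>R z)" for a b z
    by (auto simp: complex_eq_iff algebra_simps)
  show ?thesis
  proof (rule bexI[of _ "\<lambda>\<xi>. Complex (p \<xi>) (n \<xi>)"], intro allI impI)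
    fix \<phi> :: "'b \<Rightarrow> complex" assume [measurable]: "\<phi> \<in> borel_measurable borel"
      and I: "integrable M (\<lambda>\<omega>. \<phi> (T \<omega>) * r \<omega>)"
    have 1: "integrable M (\<lambda>\<omega>. Re (r \<omega>) *\<^sub>R \<phi> (T \<omega>))"
      by (rule Bochner_Integration.integrable_bound[OF I])
         (auto simp: norm_mult mult.commute[of "cmod (\<phi> _)"] abs_Re_le_cmod intro!: mult_right_mono)
    have 2: "integrable M (\<lambda>\<omega>. Im (r \<omega>) *\<^sub>R \<phi> (T \<omega>))"
      by (rule Bochner_Integration.integrable_bound[OF I])
         (auto simp: norm_mult mult.commute[of "cmod (\<phi> _)"] abs_Im_le_cmod intro!: mult_right_mono)
    have r': "\<phi> (T \<omega>) * r \<omega> = Re (r \<omega>) *\<^sub>R \<phi> (T \<omega>) + \<i> * (Im (r \<omega>) *\<^sub>R \<phi> (T \<omega>))" for \<omega>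
      using d[of "\<phi> (T \<omega>)" "Re (r \<omega>)" "Im (r \<omega>)"] by simp
    have p': "integrable (distr M borel T) (\<lambda>\<xi>. p \<xi> *\<^sub>R \<phi> \<xi>)"
      "(\<integral>\<xi>. p \<xi> *\<^sub>R \<phi> \<xi> \<partial>distr M borel T) = (\<integral>\<omega>. Re (r \<omega>) *\<^sub>R \<phi> (T \<omega>) \<partial>M)"
      using p(2)[OF _ 1] by auto
    have n': "integrable (distr M borel T) (\<lambda>\<xi>. n \<xi> *\<^sub>R \<phi> \<xi>)"
      "(\<integral>\<xi>. n \<xi> *\<^sub>R \<phi> \<xi> \<partial>distr M borel T) = (\<integral>\<omega>. Im (r \<omega>) *\<^sub>R \<phi> (T \<omega>) \<partial>M)"
      using n(2)[OF _ 2] by auto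
    show "integrable (distr M borel T) (\<lambda>\<xi>. \<phi> \<xi> * Complex (p \<xi>) (n \<xi>)) \<and>
      (\<integral>\<xi>. \<phi> \<xi> * Complex (p \<xi>) (n \<xi>) \<partial>distr M borel T) = (\<integral>\<omega>. \<phi> (T \<omega>) * r \<omega> \<partial>M)"
      unfolding d r'
      by (intro conjI Bochner_Integration.integrable_add integrable_mult_right p' n',
          subst (1 2) Bochner_Integration.integral_add)
         (use p' n' 1 2 in \<open>auto simp: integrable_mult_right simp del: mult_scaleR_right\<close>)
  next
    show "(\<lambda>\<xi>. Complex (p \<xi>) (n \<xi>)) \<in> borel_measurable borel"
      unfolding Complex_eq using p(1) n(1) by measurable
  qed
qed

lemma weight_nonneg [simp]: "0 \<le> weight s \<xi>"
  by (simp add: weight_def)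

lemma borel_measurable_weight [measurable]: "weight s \<in> borel_measurable borel"
  unfolding weight_def by measurable

text \<open>Any Fourier integral over an abstract finite measure space, with frequency map
  \<open>T\<close> and amplitude \<open>g\<close>, is a field in FM. The density \<open>f\<close>
  plays the role of the conditional expectation of \<open>g\<close> given \<open>T\<close>; one
  \<open>f\<close> serves all test functions at once, so it also inherits every weighted
  moment.\<close>

lemma fm_push:
  fixes T :: "'a \<Rightarrow> real^'n" and g :: "'a \<Rightarrow> complex^'n"
  assumes M: "finite_measure M" and T [measurable]: "T \<in> borel_measurable M"
    and g: "integrable M g"
  obtains f where "fm_rep (distr M borel T) f (\<lambda>x. \<integral>\<omega>. cis (- (x \<bullet> T \<omega>)) *s g \<omega> \<partial>M)"
    "\<And>s. integrable M (\<lambda>\<omega>. weight s (T \<omega>) *\<^sub>R g \<omega>) \<Longrightarrow>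
      integrable (distr M borel T) (\<lambda>\<xi>. weight s \<xi> *\<^sub>R f \<xi>)"
proof -
  have [measurable]: "g \<in> borel_measurable M" using g by auto
  let ?\<nu> = "distr M borel T"
  let ?P = "\<lambda>i q. q \<in> borel_measurable borel \<and> (\<forall>\<phi> :: real^'n \<Rightarrow> complex. \<phi> \<in> borel_measurable borel \<longrightarrow>
      integrable M (\<lambda>\<omega>. \<phi> (T \<omega>) * g \<omega> $ i) \<longrightarrow>
      integrable ?\<nu> (\<lambda>\<xi>. \<phi> \<xi> * q \<xi>) \<and>
      (\<integral>\<xi>. \<phi> \<xi> * q \<xi> \<partial>?\<nu>) = (\<integral>\<omega>. \<phi> (T \<omega>) * g \<omega> $ i \<partial>M))"
  have "\<exists>q. ?P i q" for i
    using push_density_complex[OF M T integrable_vec_nth[OF g, of i]] unfolding Bex_def .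
  then have "\<exists>q. \<forall>i. ?P i (q i)" by (intro choice allI)
  then obtain q where q0: "\<forall>i. ?P i (q i)" by (rule exE)
  then have q: "\<And>i \<phi>. \<phi> \<in> borel_measurable borel \<Longrightarrow> integrable M (\<lambda>\<omega>. \<phi> (T \<omega>) * g \<omega> $ i) \<Longrightarrow>
      integrable ?\<nu> (\<lambda>\<xi>. \<phi> \<xi> * q i \<xi>) \<and>
      (\<integral>\<xi>. \<phi> \<xi> * q i \<xi> \<partial>?\<nu>) = (\<integral>\<omega>. \<phi> (T \<omega>) * g \<omega> $ i \<partial>M)"
    by blast
  define f where "f \<xi> = (\<chi> i. q i \<xi>)" for \<xi>
  have fi: "integrable ?\<nu> f"
  proof (rule integrable_vecI)
    fix i
    show "integrable ?\<nu> (\<lambda>x. f x $ i)"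
      using q[of "\<lambda>_. 1" i] integrable_vec_nth[OF g, of i] by (simp add: f_def)
  qed
  have "fourier_meas ?\<nu> f = (\<lambda>x. \<integral>\<omega>. cis (- (x \<bullet> T \<omega>)) *s g \<omega> \<partial>M)"
  proof
    fix x
    have a: "integrable M (\<lambda>\<omega>. cis (- (x \<bullet> T \<omega>)) *s g \<omega>)"
      by (rule integrable_cis_smult[OF g]) measurable
    have b: "integrable ?\<nu> (\<lambda>\<xi>. cis (- (x \<bullet> \<xi>)) *s f \<xi>)"
      by (rule integrable_cis_smult[OF fi]) measurable
    have "(\<integral>\<xi>. cis (- (x \<bullet> \<xi>)) *s f \<xi> \<partial>?\<nu>) $ i = (\<integral>\<omega>. cis (- (x \<bullet> T \<omega>)) *s g \<omega> \<partial>M) $ i" for i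
    proof -
      have "integrable M (\<lambda>\<omega>. cis (- (x \<bullet> T \<omega>)) * g \<omega> $ i)"
        using integrable_vec_nth[OF a, of i] by simp
      from q[OF _ this] show ?thesis
        unfolding integral_vec_nth[OF a] integral_vec_nth[OF b] by (simp add: f_def)
    qed
    then show "fourier_meas ?\<nu> f x = (\<integral>\<omega>. cis (- (x \<bullet> T \<omega>)) *s g \<omega> \<partial>M)"
      by (simp add: fourier_meas_def vec_eq_iff)
  qed
  moreover have "finite_measure ?\<nu>" by (rule finite_measure.finite_measure_distr[OF M T])
  ultimately have "fm_rep ?\<nu> f (\<lambda>x. \<integral>\<omega>. cis (- (x \<bullet> T \<omega>)) *s g \<omega> \<partial>M)"
    using fi by (simp add: fm_rep_def)
  moreover have "integrable ?\<nu> (\<lambda>\<xi>. weight s \<xi> *\<^sub>R f \<xi>)"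
    if w: "integrable M (\<lambda>\<omega>. weight s (T \<omega>) *\<^sub>R g \<omega>)" for s
  proof (rule integrable_vecI)
    fix i
    have "integrable M (\<lambda>\<omega>. of_real (weight s (T \<omega>)) * g \<omega> $ i)"
      using integrable_vec_nth[OF w, of i] unfolding vector_scaleR_component scaleR_conv_of_real[where 'a = complex] .
    from q[OF _ this] show "integrable ?\<nu> (\<lambda>\<xi>. (weight s \<xi> *\<^sub>R f \<xi>) $ i)"
      unfolding vector_scaleR_component scaleR_conv_of_real[where 'a = complex] by (simp add: f_def)
  qed
  ultimately show thesis by (rule that)
qed

section \<open>Sums and products of Fourier transforms of measures\<close>

lemma integrable_bool_pair:
  fixes F :: "bool \<Rightarrow> 'a \<Rightarrow> 'b::{banach, second_countable_topology}"
  assumes "sigma_finite_measure N" and F: "\<And>b. integrable N (F b)"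
  shows "integrable (count_space UNIV \<Otimes>\<^sub>M N) (\<lambda>p. F (fst p) (snd p))"
    and "(\<integral>p. F (fst p) (snd p) \<partial>(count_space UNIV \<Otimes>\<^sub>M N)) = integral\<^sup>L N (F True) + integral\<^sup>L N (F False)"
proof -
  interpret N: sigma_finite_measure N by fact
  interpret C: sigma_finite_measure "count_space (UNIV :: bool set)"
    by (rule sigma_finite_measure_count_space_finite) simp
  interpret P: pair_sigma_finite "count_space (UNIV :: bool set)" N ..
  have m: "(\<lambda>p. F (fst p) (snd p)) \<in> borel_measurable (count_space UNIV \<Otimes>\<^sub>M N)"
    by (rule measurable_pair_measure_countable1) (use F in auto)
  show I: "integrable (count_space UNIV \<Otimes>\<^sub>M N) (\<lambda>p. F (fst p) (snd p))"
    by (rule P.Fubini_integrable[OF m]) (use F in \<open>auto intro: integrable_count_space\<close>)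
  show "(\<integral>p. F (fst p) (snd p) \<partial>(count_space UNIV \<Otimes>\<^sub>M N)) = integral\<^sup>L N (F True) + integral\<^sup>L N (F False)"
    unfolding P.integral_fst'[OF I, symmetric]
    by (subst lebesgue_integral_count_space_finite) (auto simp: UNIV_bool)
qed

text \<open>With the phases included in \<open>a\<close> and \<open>g\<close>, this factorises the
  transform of a convolution; with \<open>a = 1\<close> it integrates out one coordinate.\<close>

lemma integrable_pair_smult:
  fixes g :: "'b \<Rightarrow> complex^'n"
  assumes M1: "sigma_finite_measure M1" and M2: "sigma_finite_measure M2"
    and a: "integrable M1 a" and g: "integrable M2 g"
  shows "integrable (M1 \<Otimes>\<^sub>M M2) (\<lambda>p. a (fst p) *s g (snd p))"
    and "(\<integral>p. a (fst p) *s g (snd p) \<partial>(M1 \<Otimes>\<^sub>M M2)) = integral\<^sup>L M1 a *s integral\<^sup>L M2 g"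
proof -
  interpret M1: sigma_finite_measure M1 by fact
  interpret M2: sigma_finite_measure M2 by fact
  interpret P: pair_sigma_finite M1 M2 ..
  have [measurable]: "a \<in> borel_measurable M1" "g \<in> borel_measurable M2" using a g by auto
  have m: "(\<lambda>p. a (fst p) *s g (snd p)) \<in> borel_measurable (M1 \<Otimes>\<^sub>M M2)" by measurable
  show I: "integrable (M1 \<Otimes>\<^sub>M M2) (\<lambda>p. a (fst p) *s g (snd p))"
    by (rule P.Fubini_integrable[OF m])
       (use a g in \<open>auto simp: norm_vector_smult intro: integrable_bounded_linear[OF bounded_linear_smult]\<close>)
  show "(\<integral>p. a (fst p) *s g (snd p) \<partial>(M1 \<Otimes>\<^sub>M M2)) = integral\<^sup>L M1 a *s integral\<^sup>L M2 g"
    using P.integral_fst'[OF I] a g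
    by (simp add: integral_bounded_linear[OF bounded_linear_smult] integral_bounded_linear[OF bounded_linear_smult_left])
qed

lemma integrable_pair_fst_smult:
  fixes g :: "'b \<Rightarrow> complex^'n"
  assumes M1: "sigma_finite_measure M1" and M2: "sigma_finite_measure M2"
    and a: "integrable M2 a" and g: "integrable M1 g"
  shows "integrable (M1 \<Otimes>\<^sub>M M2) (\<lambda>p. a (snd p) *s g (fst p))"
    and "(\<integral>p. a (snd p) *s g (fst p) \<partial>(M1 \<Otimes>\<^sub>M M2)) = integral\<^sup>L M2 a *s integral\<^sup>L M1 g"
proof -
  interpret M1: sigma_finite_measure M1 by fact
  interpret M2: sigma_finite_measure M2 by fact
  interpret P: pair_sigma_finite M1 M2 ..
  have [measurable]: "a \<in> borel_measurable M2" "g \<in> borel_measurable M1" using a g by auto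
  have m: "(\<lambda>p. a (snd p) *s g (fst p)) \<in> borel_measurable (M1 \<Otimes>\<^sub>M M2)" by measurable
  show I: "integrable (M1 \<Otimes>\<^sub>M M2) (\<lambda>p. a (snd p) *s g (fst p))"
    by (rule P.Fubini_integrable[OF m])
       (use a g in \<open>auto simp: norm_vector_smult intro: integrable_bounded_linear[OF bounded_linear_smult_left]\<close>)
  show "(\<integral>p. a (snd p) *s g (fst p) \<partial>(M1 \<Otimes>\<^sub>M M2)) = integral\<^sup>L M2 a *s integral\<^sup>L M1 g"
    using P.integral_fst'[OF I] a g
    by (simp add: integral_bounded_linear[OF bounded_linear_smult] integral_bounded_linear[OF bounded_linear_smult_left])
qed

text \<open>The regularity shared by solutions, constants, derivatives and products; unlike
  \<open>fm_X\<close> it admits an atom at the origin and nonzero divergence.\<close>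

definition weighted_fm :: "real \<Rightarrow> ('n::finite) field \<Rightarrow> bool" where
  "weighted_fm s v \<longleftrightarrow> (\<exists>\<nu> f. fm_rep \<nu> f v \<and> integrable \<nu> (\<lambda>\<xi>. weight s \<xi> *\<^sub>R f \<xi>))"

lemma fm_repD:
  assumes "fm_rep \<nu> f v"
  shows "sets \<nu> = sets borel" "finite_measure \<nu>" "integrable \<nu> f"
    "v x = (\<integral>\<xi>. cis (- (x \<bullet> \<xi>)) *s f \<xi> \<partial>\<nu>)" "sigma_finite_measure \<nu>"
  using assms by (auto simp: fm_rep_def fourier_meas_def intro: finite_measure.axioms)

text \<open>\<open>weight 0\<close> is 1 off the origin and \<open>0 powr 0 = 0\<close> at it, so it
  never exceeds 1 and every representation qualifies.\<close>

lemma weighted_fm_0I: assumes "fm_rep \<nu> f v" shows "weighted_fm 0 v"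
proof -
  note r = fm_repD[OF assms]
  have [measurable_cong]: "sets \<nu> = sets borel" by (rule r)
  have "integrable \<nu> (\<lambda>\<xi>. weight 0 \<xi> *\<^sub>R f \<xi>)"
    using r(3) by (rule Bochner_Integration.integrable_bound)
      (use r(3) in \<open>auto simp: weight_def powr_def\<close>)
  with assms show ?thesis unfolding weighted_fm_def by blast
qed

lemma fm_rep_linear:
  assumes r: "fm_rep \<nu> f v" and L: "bounded_linear L" and c: "\<And>c z. L (c *s z) = c *s L z"
  shows "fm_rep \<nu> (\<lambda>\<xi>. L (f \<xi>)) (\<lambda>x. L (v x))"
proof -
  note r' = fm_repD[OF r]
  have [measurable_cong]: "sets \<nu> = sets borel" by (rule r'(1))
  have "L (v x) = (\<integral>\<xi>. cis (- (x \<bullet> \<xi>)) *s L (f \<xi>) \<partial>\<nu>)" for x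
    unfolding r'(4)
    by (subst integral_bounded_linear[OF L, symmetric]) (auto simp: c intro!: integrable_cis_smult r'(3))
  with r show ?thesis
    by (auto simp: fm_rep_def fourier_meas_def fun_eq_iff intro: integrable_bounded_linear[OF L])
qed

lemma weighted_fm_scaleR: assumes "weighted_fm s v" shows "weighted_fm s (\<lambda>x. c *\<^sub>R v x)"
proof -
  obtain \<nu> f where r: "fm_rep \<nu> f v" "integrable \<nu> (\<lambda>\<xi>. weight s \<xi> *\<^sub>R f \<xi>)"
    using assms by (auto simp: weighted_fm_def)
  have "fm_rep \<nu> (\<lambda>\<xi>. c *\<^sub>R f \<xi>) (\<lambda>x. c *\<^sub>R v x)"
    by (rule fm_rep_linear[OF r(1) bounded_linear_scaleR_right]) (auto simp: vec_eq_iff)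
  moreover have "integrable \<nu> (\<lambda>\<xi>. weight s \<xi> *\<^sub>R c *\<^sub>R f \<xi>)"
    using integrable_scaleR_right[OF r(2), of c] by (simp add: mult.commute)
  ultimately show ?thesis unfolding weighted_fm_def by blast
qed

text \<open>Both summands are moved to one frequency space, \<open>bool\<close> times the product of
  the two measures: the Boolean selects the summand whose frequency and density are used, and the
  other coordinate is integrated out.\<close>

lemma weighted_fm_combine:
  assumes "weighted_fm s v1" "weighted_fm s v2"
  shows "weighted_fm s (\<lambda>x. a *\<^sub>R v1 x + b *\<^sub>R v2 x)"
proof -
  obtain \<nu>1 f1 where r1: "fm_rep \<nu>1 f1 v1" and w1: "integrable \<nu>1 (\<lambda>\<xi>. weight s \<xi> *\<^sub>R f1 \<xi>)"
    using assms by (auto simp: weighted_fm_def)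
  obtain \<nu>2 f2 where r2: "fm_rep \<nu>2 f2 v2" and w2: "integrable \<nu>2 (\<lambda>\<xi>. weight s \<xi> *\<^sub>R f2 \<xi>)"
    using assms by (auto simp: weighted_fm_def)
  note r1' = fm_repD[OF r1] and r2' = fm_repD[OF r2]
  have [measurable_cong]: "sets \<nu>1 = sets borel" "sets \<nu>2 = sets borel" by (rule r1' r2')+
  interpret \<nu>1: finite_measure \<nu>1 by (rule r1')
  interpret \<nu>2: finite_measure \<nu>2 by (rule r2')
  interpret P: pair_sigma_finite \<nu>1 \<nu>2 ..
  define m1 m2 where "m1 = measure \<nu>1 (space \<nu>1)" and "m2 = measure \<nu>2 (space \<nu>2)"
  \<comment> \<open>Division by a vanishing mass is impossible, but a representing measure of mass
    zero makes its field vanish identically, and the other summand carries the claim.\<close>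
  consider "m1 = 0" | "m2 = 0" | "m1 > 0" "m2 > 0"
    unfolding m1_def m2_def by (metis measure_nonneg order_le_less)
  then show ?thesis
  proof cases
    case 1
    then have "AE x in \<nu>1. False"
      by (intro AE_I[of _ _ "space \<nu>1"]) (auto simp: m1_def \<nu>1.emeasure_eq_measure)
    then have "v1 x = 0" for x unfolding r1'(4) by (intro integral_eq_zero_AE) auto
    then show ?thesis using weighted_fm_scaleR[OF assms(2)] by simp
  next
    case 2
    then have "AE x in \<nu>2. False"
      by (intro AE_I[of _ _ "space \<nu>2"]) (auto simp: m2_def \<nu>2.emeasure_eq_measure)
    then have "v2 x = 0" for x unfolding r2'(4) by (intro integral_eq_zero_AE) auto
    then show ?thesis using weighted_fm_scaleR[OF assms(1)] by simp
  next
    case 3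
    define N where "N = \<nu>1 \<Otimes>\<^sub>M \<nu>2"
    have sN: "sigma_finite_measure N" unfolding N_def by (rule P.sigma_finite_measure_axioms)
    define M where "M = count_space (UNIV :: bool set) \<Otimes>\<^sub>M N"
    have fM: "finite_measure M" unfolding M_def N_def
      by (intro finite_measure_pair_measure finite_measure_count_space \<nu>1.finite_measure_axioms
            \<nu>2.finite_measure_axioms) simp
    define T where "T p = (if fst p then fst (snd p) else snd (snd p))"
      for p :: "bool \<times> (real^'a) \<times> (real^'a)"
    \<comment> \<open>Integrating out the idle coordinate produces the total mass of its measure;
      the factors \<open>1 / m2\<close> and \<open>1 / m1\<close> cancel it.\<close>
    define g where "g p = (if fst p then (a / m2) *\<^sub>R f1 (fst (snd p)) else (b / m1) *\<^sub>R f2 (snd (snd p)))"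
      for p :: "bool \<times> (real^'a) \<times> (real^'a)"
    have T: "T \<in> borel_measurable M"
      unfolding M_def N_def T_def by measurable
    \<comment> \<open>Phases and weights are both scalar factors \<open>\<phi> (T p)\<close>, so one
      computation serves the transform and the weighted integrability.\<close>
    have key: "integrable M (\<lambda>p. \<phi> (T p) *s g p)"
      "(\<integral>p. \<phi> (T p) *s g p \<partial>M) = a *\<^sub>R (\<integral>\<xi>. \<phi> \<xi> *s f1 \<xi> \<partial>\<nu>1) + b *\<^sub>R (\<integral>\<xi>. \<phi> \<xi> *s f2 \<xi> \<partial>\<nu>2)"
      if i: "integrable \<nu>1 (\<lambda>\<xi>. \<phi> \<xi> *s f1 \<xi>)" "integrable \<nu>2 (\<lambda>\<xi>. \<phi> \<xi> *s f2 \<xi>)" for \<phi> :: "real^'a \<Rightarrow> complex"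
    proof -
      define F where "F c q = (if c then (a / m2) *\<^sub>R (\<phi> (fst q) *s f1 (fst q)) else (b / m1) *\<^sub>R (\<phi> (snd q) *s f2 (snd q)))"
        for c and q :: "(real^'a) \<times> (real^'a)"
      have o: "integrable \<nu>1 (\<lambda>_. 1 :: complex)" "integrable \<nu>2 (\<lambda>_. 1 :: complex)" by auto
      note A = integrable_pair_smult[OF r1'(5) r2'(5) o(1) i(2)]
      note B = integrable_pair_fst_smult[OF r1'(5) r2'(5) o(2) i(1)]
      have FI: "integrable N (F c)" for c
        unfolding F_def N_def using A(1) B(1) by (cases c) auto
      have eq: "\<phi> (T p) *s g p = F (fst p) (snd p)" for p
        by (auto simp: T_def g_def F_def vec_eq_iff)
      show "integrable M (\<lambda>p. \<phi> (T p) *s g p)"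
        unfolding eq M_def by (rule integrable_bool_pair[OF sN FI])
      have FT: "F True = (\<lambda>q. (a / m2) *\<^sub>R (\<phi> (fst q) *s f1 (fst q)))"
        and FF: "F False = (\<lambda>q. (b / m1) *\<^sub>R (\<phi> (snd q) *s f2 (snd q)))"
        by (auto simp: F_def fun_eq_iff)
      have c1: "integral\<^sup>L N (F True) = a *\<^sub>R (\<integral>\<xi>. \<phi> \<xi> *s f1 \<xi> \<partial>\<nu>1)"
        unfolding FT N_def using B 3 by (simp add: m2_def vec_eq_iff)
      have c2: "integral\<^sup>L N (F False) = b *\<^sub>R (\<integral>\<xi>. \<phi> \<xi> *s f2 \<xi> \<partial>\<nu>2)"
        unfolding FF N_def using A 3 by (simp add: m1_def vec_eq_iff)
      show "(\<integral>p. \<phi> (T p) *s g p \<partial>M) = a *\<^sub>R (\<integral>\<xi>. \<phi> \<xi> *s f1 \<xi> \<partial>\<nu>1) + b *\<^sub>R (\<integral>\<xi>. \<phi> \<xi> *s f2 \<xi> \<partial>\<nu>2)"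
        unfolding eq M_def integrable_bool_pair(2)[OF sN, of F, OF FI] c1 c2 ..
    qed
    have g: "integrable M g" using key(1)[of "\<lambda>_. 1"] r1'(3) r2'(3) by simp
    obtain f where f: "fm_rep (distr M borel T) f (\<lambda>x. \<integral>\<omega>. cis (- (x \<bullet> T \<omega>)) *s g \<omega> \<partial>M)"
      "\<And>s. integrable M (\<lambda>\<omega>. weight s (T \<omega>) *\<^sub>R g \<omega>) \<Longrightarrow>
        integrable (distr M borel T) (\<lambda>\<xi>. weight s \<xi> *\<^sub>R f \<xi>)"
      using fm_push[OF fM T g] by blast
    have sc: "r *\<^sub>R z = complex_of_real r *s z" for r and z :: "complex^'a"
      by (simp add: vec_eq_iff scaleR_conv_of_real[where 'a = complex])
    have eq: "(\<lambda>x. \<integral>\<omega>. cis (- (x \<bullet> T \<omega>)) *s g \<omega> \<partial>M) = (\<lambda>x. a *\<^sub>R v1 x + b *\<^sub>R v2 x)"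
    proof
      fix x
      show "(\<integral>\<omega>. cis (- (x \<bullet> T \<omega>)) *s g \<omega> \<partial>M) = a *\<^sub>R v1 x + b *\<^sub>R v2 x"
        unfolding r1'(4) r2'(4)
        by (rule key(2)[where \<phi> = "\<lambda>\<xi>. cis (- (x \<bullet> \<xi>))"])
           (auto intro!: integrable_cis_smult r1'(3) r2'(3))
    qed
    have "integrable M (\<lambda>\<omega>. weight s (T \<omega>) *\<^sub>R g \<omega>)"
      unfolding sc by (rule key(1)[where \<phi> = "\<lambda>\<xi>. of_real (weight s \<xi>)"])
       (use w1 w2 in \<open>auto simp: sc\<close>)
    from f(1)[unfolded eq] f(2)[OF this] show ?thesis unfolding weighted_fm_def by blast
  qed
qed

text \<open>The Dirac measure at \<xi>, encoded as the image of the counting measure on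
  \<open>unit\<close> under a constant map.\<close>

lemma fm_rep_wave:
  "fm_rep (distr (count_space (UNIV :: unit set)) borel (\<lambda>_. \<xi>)) (\<lambda>_. z) (\<lambda>x. cis (- (x \<bullet> \<xi>)) *s z)"
proof -
  have "finite_measure (distr (count_space (UNIV :: unit set)) borel (\<lambda>_. \<xi>))"
    by (intro finite_measure.finite_measure_distr finite_measure_count_space) auto
  then show ?thesis
    by (auto simp: fm_rep_def fourier_meas_def integral_distr finite_measure.integrable_const fun_eq_iff
        lebesgue_integral_count_space_finite UNIV_unit)
qed

lemma weighted_fm_wave: "weighted_fm s (\<lambda>x. cis (- (x \<bullet> \<xi>)) *s z)"
proof -
  have "integrable (distr (count_space (UNIV :: unit set)) borel (\<lambda>_. \<xi>)) (\<lambda>\<xi>. weight s \<xi> *\<^sub>R z)"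
    by (subst integrable_distr_eq) (auto intro!: integrable_count_space)
  then show ?thesis using fm_rep_wave unfolding weighted_fm_def by blast
qed

lemma weighted_fm_sum:
  assumes "finite A" "\<And>k. k \<in> A \<Longrightarrow> weighted_fm s (v k)"
  shows "weighted_fm s (\<lambda>x. \<Sum>k\<in>A. v k x)"
  using assms
proof (induction A rule: finite_induct)
  case empty
  show ?case using weighted_fm_wave[of s 0 0] by simp
next
  case (insert k A)
  then show ?case using weighted_fm_combine[of s "v k" "\<lambda>x. \<Sum>k\<in>A. v k x" 1 1] by simp
qed

text \<open>The product of two transforms is the transform of a convolution, the image of the
  product measure under addition of frequencies. Conjugation reflects the first frequency, which
  turns the sum into a difference.\<close>

lemma weighted_fm_mult:
  assumes "fm_rep \<nu>1 f1 u" "fm_rep \<nu>2 f2 v"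
  shows "weighted_fm 0 (\<lambda>x. (u x $ k) *s v x)" "weighted_fm 0 (\<lambda>x. cnj (u x $ k) *s v x)"
proof -
  note r1' = fm_repD[OF assms(1)] and r2' = fm_repD[OF assms(2)]
  have [measurable_cong]: "sets \<nu>1 = sets borel" "sets \<nu>2 = sets borel" by (rule r1' r2')+
  have e1: "cis (- (x \<bullet> (a + b))) = cis (- (x \<bullet> a)) * cis (- (x \<bullet> b))"
    and e2: "cis (- (x \<bullet> (b - a))) = cnj (cis (- (x \<bullet> a))) * cis (- (x \<bullet> b))" for x a b :: "real^'a"
    by (simp_all add: cis_mult cis_cnj inner_add_right inner_diff_right)
  define M where "M = \<nu>1 \<Otimes>\<^sub>M \<nu>2"
  have fM: "finite_measure M" unfolding M_def by (intro finite_measure_pair_measure r1' r2')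
  have u: "u x $ k = (\<integral>\<xi>. cis (- (x \<bullet> \<xi>)) * f1 \<xi> $ k \<partial>\<nu>1)" for x
    unfolding r1'(4) by (subst integral_vec_nth) (auto intro!: integrable_cis_smult r1'(3))
  have i: "integrable \<nu>1 (\<lambda>\<xi>. cis (- (x \<bullet> \<xi>)) * f1 \<xi> $ k)" for x
    using integrable_vec_nth[OF integrable_cis_smult[OF r1'(3)], of "\<lambda>\<xi>. - (x \<bullet> \<xi>)" k] by simp
  have i2: "integrable \<nu>2 (\<lambda>\<xi>. cis (- (x \<bullet> \<xi>)) *s f2 \<xi>)" for x
    by (intro integrable_cis_smult r2'(3)) auto
  have j: "integrable M (\<lambda>p. (f1 (fst p) $ k) *s f2 (snd p))"
    unfolding M_def by (intro integrable_pair_smult r1' r2' integrable_vec_nth)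
  have T: "(\<lambda>p. fst p + snd p) \<in> borel_measurable M" unfolding M_def by measurable
  obtain f where f: "fm_rep (distr M borel (\<lambda>p. fst p + snd p)) f
      (\<lambda>x. \<integral>p. cis (- (x \<bullet> (fst p + snd p))) *s ((f1 (fst p) $ k) *s f2 (snd p)) \<partial>M)"
    using fm_push[OF fM T j] by blast
  have "(\<integral>p. cis (- (x \<bullet> (fst p + snd p))) *s ((f1 (fst p) $ k) *s f2 (snd p)) \<partial>M) = (u x $ k) *s v x" for x
    unfolding u r2'(4) M_def integrable_pair_smult(2)[OF r1'(5) r2'(5) i i2, symmetric]
    by (intro Bochner_Integration.integral_cong)
       (auto simp: vec_eq_iff e1)
  with f show "weighted_fm 0 (\<lambda>x. (u x $ k) *s v x)" using weighted_fm_0I by auto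
  have ic: "integrable \<nu>1 (\<lambda>\<xi>. cnj (cis (- (x \<bullet> \<xi>)) * f1 \<xi> $ k))" for x
    by (rule integrable_bounded_linear[OF bounded_linear_cnj i])
  have cnj_u: "cnj (\<integral>\<xi>. cis (- (x \<bullet> \<xi>)) * f1 \<xi> $ k \<partial>\<nu>1) = (\<integral>\<xi>. cnj (cis (- (x \<bullet> \<xi>)) * f1 \<xi> $ k) \<partial>\<nu>1)" for x
    by (rule integral_bounded_linear[OF bounded_linear_cnj i, symmetric])
  have jc: "integrable M (\<lambda>p. cnj (f1 (fst p) $ k) *s f2 (snd p))"
    unfolding M_def by (intro integrable_pair_smult r1' r2')
      (use integrable_vec_nth[OF r1'(3)] in simp)
  have Tc: "(\<lambda>p. snd p - fst p) \<in> borel_measurable M" unfolding M_def by measurable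
  obtain f where f: "fm_rep (distr M borel (\<lambda>p. snd p - fst p)) f
      (\<lambda>x. \<integral>p. cis (- (x \<bullet> (snd p - fst p))) *s (cnj (f1 (fst p) $ k) *s f2 (snd p)) \<partial>M)"
    using fm_push[OF fM Tc jc] by blast
  have "(\<integral>p. cis (- (x \<bullet> (snd p - fst p))) *s (cnj (f1 (fst p) $ k) *s f2 (snd p)) \<partial>M) = cnj (u x $ k) *s v x" for x
    unfolding u r2'(4) M_def cnj_u integrable_pair_smult(2)[OF r1'(5) r2'(5) ic i2, symmetric]
    by (intro Bochner_Integration.integral_cong)
       (auto simp: vec_eq_iff e2)
  with f show "weighted_fm 0 (\<lambda>x. cnj (u x $ k) *s v x)" using weighted_fm_0I by auto
qed

section \<open>Uniqueness for the linear part\<close>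

lemma mult_exp_minus_le: "0 < \<kappa> \<Longrightarrow> y * exp (- (\<kappa> * y)) \<le> 1 / \<kappa>" for y :: real
proof -
  assume k: "0 < \<kappa>"
  have "\<kappa> * y \<le> exp (\<kappa> * y)" using exp_ge_add_one_self[of "\<kappa> * y"] by linarith
  then have "\<kappa> * y * exp (- (\<kappa> * y)) \<le> exp (\<kappa> * y) * exp (- (\<kappa> * y))"
    by (rule mult_right_mono) simp
  then show ?thesis using k by (simp add: exp_minus field_simps)
qed

text \<open>One derivative out of four costs the power 1/4: in the variable
  \<open>x = r * \<tau> powr (1/4)\<close> the quartic damping is \<open>x ^ 4\<close>, and
  \<open>x\<close> times its exponential is bounded. The possibly growing quadratic part is absorbed
  into half of the damping at the price of a constant, uniformly for \<tau> \<le> 1.\<close>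

lemma parabolic_smoothing:
  fixes g G :: real
  assumes G: "0 < G"
  shows "\<exists>C>0. \<forall>r\<ge>0. \<forall>\<tau>. 0 < \<tau> \<longrightarrow> \<tau> \<le> 1 \<longrightarrow>
    (1 + r) * exp ((g * r^2 - G * r^4) * \<tau>) \<le> C * \<tau> powr (- 1/4)"
proof (intro exI[of _ "exp (g\<^sup>2 / (2 * G)) * (3 + 2 / G)"] conjI allI impI)
  show "0 < exp (g\<^sup>2 / (2 * G)) * (3 + 2 / G)" using G by (simp add: add_pos_pos)
  fix r \<tau> :: real assume r: "0 \<le> r" and t: "0 < \<tau>" "\<tau> \<le> 1"
  define x where "x = r * \<tau> powr (1/4)"
  have x0: "0 \<le> x" using r by (simp add: x_def)
  have t4: "(\<tau> powr (1/4)) ^ 4 = \<tau>" using t by (simp add: powr_powr flip: powr_numeral)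
  have x4: "x ^ 4 = r ^ 4 * \<tau>" by (simp add: x_def power_mult_distrib t4)
  \<comment> \<open>Young's inequality as a completed square; its leftover
    \<open>g^2 / (2 * G)\<close> is the origin of the exponential prefactor.\<close>
  have "0 \<le> (G * r^2 - g)\<^sup>2" by simp
  then have "2 * g * G * r^2 \<le> G^2 * r^4 + g^2" by (simp add: power2_eq_square algebra_simps numeral_eq_Suc)
  then have "g * r^2 \<le> G / 2 * r^4 + g^2 / (2 * G)" using G by (simp add: field_simps power2_eq_square)
  then have "g * r^2 - G * r^4 \<le> g^2 / (2 * G) - G / 2 * r^4" by linarith
  then have "(g * r^2 - G * r^4) * \<tau> \<le> (g^2 / (2 * G) - G / 2 * r^4) * \<tau>"
    using t by (intro mult_right_mono) auto
  also have "\<dots> \<le> g^2 / (2 * G) - G / 2 * x ^ 4"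
    using mult_left_mono[OF t(2), of "g^2 / (2 * G)"] G by (simp add: x4 algebra_simps)
  finally have e: "exp ((g * r^2 - G * r^4) * \<tau>) \<le> exp (g^2 / (2 * G)) * exp (- (G / 2 * x ^ 4))"
    by (simp flip: exp_add)
  \<comment> \<open>Reduces the bound for \<open>x\<close> to one for \<open>x ^ 4\<close>, to which
    \<open>mult_exp_minus_le\<close> applies with rate \<open>G / 2\<close>.\<close>
  have "x \<le> 1 + x ^ 4"
  proof (cases "x \<le> 1")
    case False
    then have "x ^ 1 \<le> x ^ 4" by (intro power_increasing) auto
    then show ?thesis by simp
  qed (simp add: add_increasing2)
  then have "x * exp (- (G / 2 * x ^ 4)) \<le> (1 + x ^ 4) * exp (- (G / 2 * x ^ 4))"
    by (rule mult_right_mono) simp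
  also have "\<dots> = exp (- (G / 2 * x ^ 4)) + x ^ 4 * exp (- (G / 2 * x ^ 4))" by (simp add: algebra_simps)
  also have "\<dots> \<le> 1 + 2 / G"
    using mult_exp_minus_le[of "G / 2" "x ^ 4"] G x0 by (intro add_mono) auto
  finally have xe: "x * exp (- (G / 2 * x ^ 4)) \<le> 1 + 2 / G" .
  define p where "p = \<tau> powr (- 1/4)"
  have p1: "1 \<le> p" using t powr_mono'[of "- 1/4" 0 \<tau>] by (simp add: p_def)
  have rp: "r = x * p" using t by (simp add: x_def p_def flip: powr_add)
  have "(1 + r) * exp (- (G / 2 * x ^ 4)) = exp (- (G / 2 * x ^ 4)) + (x * exp (- (G / 2 * x ^ 4))) * p"
    by (simp add: rp algebra_simps)
  also have "\<dots> \<le> p + (1 + 2 / G) * p"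
    using xe p1 G x0 by (intro add_mono mult_right_mono) (auto intro: order_trans[of _ 1])
  also have "\<dots> \<le> (3 + 2 / G) * p" using p1 by (simp add: algebra_simps)
  finally have "exp (g^2 / (2 * G)) * ((1 + r) * exp (- (G / 2 * x ^ 4))) \<le> exp (g^2 / (2 * G)) * ((3 + 2 / G) * p)"
    by (rule mult_left_mono) simp
  moreover have "(1 + r) * exp ((g * r^2 - G * r^4) * \<tau>) \<le> (1 + r) * (exp (g^2 / (2 * G)) * exp (- (G / 2 * x ^ 4)))"
    using e r by (intro mult_left_mono) auto
  ultimately show "(1 + r) * exp ((g * r^2 - G * r^4) * \<tau>) \<le> exp (g\<^sup>2 / (2 * G)) * (3 + 2 / G) * \<tau> powr (- 1/4)"
    unfolding p_def[symmetric] by (simp only: mult_ac)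
qed

text \<open>Testing against the phases of \<open>w t\<close> replaces the Duhamel integral by the mean value
  inequality: the weak singularity \<open>(t - s) powr (- 1/4)\<close> is absorbed by its primitive.\<close>
lemma duhamel_bound:
  fixes w h :: "real \<Rightarrow> 'j \<Rightarrow> complex" and \<sigma> :: "'j \<Rightarrow> complex" and r :: "'j \<Rightarrow> real"
  assumes t: "a < t" "t \<le> a + 1"
    and cont: "\<And>j. continuous_on {a..t} (\<lambda>s. w s j)"
    and deriv: "\<And>s j. a < s \<Longrightarrow> s < t \<Longrightarrow> ((\<lambda>s. w s j) has_vector_derivative \<sigma> j * w s j + h s j) (at s)"
    and r: "\<And>j. 0 \<le> r j"
    and C: "\<And>j \<tau>. 0 < \<tau> \<Longrightarrow> \<tau> \<le> 1 \<Longrightarrow> (1 + r j) * exp (Re (\<sigma> j) * \<tau>) \<le> C * \<tau> powr (- 1/4)"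
    and init: "\<And>j. w a j = 0" and F: "finite F"
    and h: "\<And>s. a < s \<Longrightarrow> s < t \<Longrightarrow> (\<Sum>j\<in>F. cmod (h s j)) \<le> B" and C0: "0 \<le> C"
  shows "(\<Sum>j\<in>F. (1 + r j) * cmod (w t j)) \<le> 4/3 * C * B * (t - a) powr (3/4)"
proof -
  \<comment> \<open>Phases frozen at the final time \<open>t\<close>: paired with them, the
    components of \<open>w t\<close> become their moduli, so the single real function
    \<open>q\<close> recovers the weighted sum at \<open>t\<close>.\<close>
  define d where "d j = cnj (sgn (w t j))" for j
  \<comment> \<open>The factor \<open>exp (\<sigma> j * (t - s))\<close> cancels the linear part of
    the equation, so that the derivative \<open>q'\<close> contains only \<open>h\<close>.\<close>
  define q where "q s = Re (\<Sum>j\<in>F. (1 + r j) * (d j * (exp (\<sigma> j * (t - s)) * w s j)))" for s :: real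
  define q' where "q' s = Re (\<Sum>j\<in>F. (1 + r j) * (d j * (exp (\<sigma> j * (t - s)) * h s j)))" for s :: real
  \<comment> \<open>The constant 4/3 is the reciprocal of the exponent 3/4. At \<open>s = t\<close>,
    where the derivative may blow up, continuity is all that the mean value inequality asks
    for.\<close>
  define \<phi> where "\<phi> s = - (4/3 * C * B) * (t - s) powr (3/4)" for s
  have dn: "cmod (d j) \<le> 1" for j by (simp add: d_def norm_sgn)
  have dw: "d j * w t j = cmod (w t j)" for j
    by (cases "w t j = 0") (auto simp: d_def sgn_eq mult.commute complex_norm_square[symmetric] power2_eq_square)
  have "norm (q t - q a) \<le> \<phi> t - \<phi> a"
  proof (rule differentiable_bound_general[where f' = q' and \<phi>' = "\<lambda>s. C * B * (t - s) powr (- 1/4)"])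
    show "a < t" by fact
    show "continuous_on {a..t} q" unfolding q_def by (intro continuous_intros cont)
    show "continuous_on {a..t} \<phi>" unfolding \<phi>_def by (intro continuous_intros continuous_on_powr') auto
    fix s assume s: "a < s" "s < t"
    have E: "((\<lambda>s. exp (\<sigma> j * (t - s)) * w s j) has_vector_derivative exp (\<sigma> j * (t - s)) * h s j) (at s)" for j
    proof -
      have "((\<lambda>s. exp (\<sigma> j * (complex_of_real t - s))) has_field_derivative - \<sigma> j * exp (\<sigma> j * (t - s))) (at (complex_of_real s))"
        by (auto intro!: derivative_eq_intros)
      then have "((\<lambda>s. exp (\<sigma> j * (t - s))) has_vector_derivative - \<sigma> j * exp (\<sigma> j * (t - s))) (at s)"
        using has_vector_derivative_real_field by fastforce
      from has_vector_derivative_mult[OF this deriv[OF s, of j]] show ?thesis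
        by (simp add: algebra_simps)
    qed
    show "(q has_vector_derivative q' s) (at s)"
      unfolding q_def q'_def
      by (intro bounded_linear.has_vector_derivative[OF bounded_linear_Re] has_vector_derivative_sum
            has_vector_derivative_mult_right E)
    have "((\<lambda>s. (t - s) powr (3/4)) has_real_derivative - (3/4 * (t - s) powr (- 1/4))) (at s)"
      using s by (auto intro!: derivative_eq_intros simp: field_simps)
    then have "(\<phi> has_real_derivative - (4/3 * C * B) * - (3/4 * (t - s) powr (- 1/4))) (at s)"
      unfolding \<phi>_def by (rule DERIV_cmult)
    then show "(\<phi> has_vector_derivative C * B * (t - s) powr (- 1/4)) (at s)"
      by (simp add: has_real_derivative_iff_has_vector_derivative mult_ac)
    have "norm (q' s) \<le> (\<Sum>j\<in>F. cmod ((1 + r j) * (d j * (exp (\<sigma> j * (t - s)) * h s j))))"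
      unfolding q'_def real_norm_def by (rule order_trans[OF abs_Re_le_cmod norm_sum])
    also have "\<dots> \<le> (\<Sum>j\<in>F. C * (t - s) powr (- 1/4) * cmod (h s j))"
    proof (rule sum_mono)
      fix j
      have "cmod ((1 + r j) * (d j * (exp (\<sigma> j * (t - s)) * h s j))) =
          cmod (d j) * (((1 + r j) * exp (Re (\<sigma> j) * (t - s))) * cmod (h s j))"
      proof -
        have "cmod (1 + complex_of_real (r j)) = 1 + r j"
          using r[of j] by (metis norm_of_real abs_of_nonneg add_nonneg_nonneg of_real_1 of_real_add zero_le_one)
        then show ?thesis by (simp add: norm_mult mult_ac)
      qed
      also have "\<dots> \<le> 1 * ((C * (t - s) powr (- 1/4)) * cmod (h s j))"
        using s t r[of j] C[of "t - s" j] by (intro mult_mono[OF dn mult_right_mono]) auto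
      finally show "cmod ((1 + r j) * (d j * (exp (\<sigma> j * (t - s)) * h s j))) \<le> C * (t - s) powr (- 1/4) * cmod (h s j)"
        by simp
    qed
    also have "\<dots> = C * (t - s) powr (- 1/4) * (\<Sum>j\<in>F. cmod (h s j))" by (simp add: sum_distrib_left)
    also have "\<dots> \<le> C * (t - s) powr (- 1/4) * B" using C0 by (intro mult_left_mono h s) auto
    finally show "norm (q' s) \<le> C * B * (t - s) powr (- 1/4)" by (simp add: mult_ac)
  qed
  moreover have "q a = 0" by (simp add: q_def init)
  moreover have "q t = (\<Sum>j\<in>F. (1 + r j) * cmod (w t j))"
  proof -
    have "Re (d j) * Re (w t j) - Im (d j) * Im (w t j) = cmod (w t j)" for j
      using arg_cong[OF dw, of Re j] by simp
    then show ?thesis by (simp add: q_def)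
  qed
  ultimately show ?thesis by (simp add: \<phi>_def)
qed

text \<open>On a window of length \<open>T\<close> each application of \<open>duhamel_bound\<close>
  halves the a priori bound \<open>K\<close>, so the weighted sums vanish there; \<open>T\<close>
  depends on \<open>C\<close> and \<open>L\<close> alone, so windows can be concatenated. The
  hypothesis on \<open>h\<close> ranges over all common bounds \<open>Y\<close> of the finite
  weighted sums, which avoids infinite sums over a possibly uncountable index type.\<close>

lemma sectorial_uniqueness:
  fixes w h :: "real \<Rightarrow> 'j \<Rightarrow> complex" and \<sigma> :: "'j \<Rightarrow> complex" and r :: "'j \<Rightarrow> real"
  assumes G: "0 < G" and r: "\<And>j. 0 \<le> r j" and \<sigma>: "\<And>j. Re (\<sigma> j) = g * r j ^ 2 - G * r j ^ 4"
    and cont: "\<And>j. continuous_on {0..} (\<lambda>s. w s j)"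
    and deriv: "\<And>s j. 0 < s \<Longrightarrow> ((\<lambda>s. w s j) has_vector_derivative \<sigma> j * w s j + h s j) (at s)"
    and bound: "\<And>t F. 0 \<le> t \<Longrightarrow> finite F \<Longrightarrow> (\<Sum>j\<in>F. (1 + r j) * cmod (w t j)) \<le> K"
    and h: "\<And>t Y F. 0 < t \<Longrightarrow> (\<And>F. finite F \<Longrightarrow> (\<Sum>j\<in>F. (1 + r j) * cmod (w t j)) \<le> Y) \<Longrightarrow>
       finite F \<Longrightarrow> (\<Sum>j\<in>F. cmod (h t j)) \<le> L * Y"
    and init: "\<And>j. w 0 j = 0" and t: "0 \<le> t"
  shows "w t j = 0"
proof -
  obtain C where C: "C > 0" "\<And>x \<tau>. 0 \<le> x \<Longrightarrow> 0 < \<tau> \<Longrightarrow> \<tau> \<le> 1 \<Longrightarrow>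
    (1 + x) * exp ((g * x^2 - G * x^4) * \<tau>) \<le> C * \<tau> powr (- 1/4)"
    using parabolic_smoothing[OF G, of g] by blast
  \<comment> \<open>A window short enough that the constant in front of the Duhamel estimate drops
    below 1/2.\<close>
  have "((\<lambda>T. 4/3 * C * \<bar>L\<bar> * T powr (3/4)) \<longlongrightarrow> 4/3 * C * \<bar>L\<bar> * 0 powr (3/4)) (at_right 0)"
    by (intro tendsto_intros tendsto_powr') (auto intro: eventually_mono[OF eventually_at_right_less])
  then have "\<forall>\<^sub>F T in at_right 0. 4/3 * C * \<bar>L\<bar> * T powr (3/4) < 1/2"
    by (rule order_tendstoD) simp
  then have "\<forall>\<^sub>F T in at_right 0. 4/3 * C * \<bar>L\<bar> * T powr (3/4) < 1/2 \<and> T \<le> 1 \<and> 0 < T"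
    using eventually_at_right_real[OF zero_less_one]
    by eventually_elim auto
  then obtain T where T: "4/3 * C * \<bar>L\<bar> * T powr (3/4) < 1/2" "T \<le> 1" "0 < T"
    by (metis (no_types, lifting) eventually_happens trivial_limit_at_right_real)
  have step: "w s j = 0" if a: "0 \<le> a" "\<And>j. w a j = 0" and s: "a \<le> s" "s \<le> a + T" for a s j
  proof -
    \<comment> \<open>Induction on the number of halvings; the case \<open>m = 0\<close> is the a
      priori bound.\<close>
    have K: "\<forall>s F. a \<le> s \<longrightarrow> s \<le> a + T \<longrightarrow> finite F \<longrightarrow> (\<Sum>j\<in>F. (1 + r j) * cmod (w s j)) \<le> K / 2 ^ m" for m
    proof (induction m)
      case 0
      then show ?case using bound a by auto
    next
      case (Suc m)
      have Km: "0 \<le> K / 2 ^ m" using Suc.IH[rule_format, of a "{}"] T by simp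
      show ?case
      proof (intro allI impI)
        fix s and F :: "'j set" assume s: "a \<le> s" "s \<le> a + T" "finite F"
        show "(\<Sum>j\<in>F. (1 + r j) * cmod (w s j)) \<le> K / 2 ^ Suc m"
        proof (cases "s = a")
          case True
          then show ?thesis using a Km by simp
        next
          case False
          have "(\<Sum>j\<in>F. (1 + r j) * cmod (w s j)) \<le> 4/3 * C * (\<bar>L\<bar> * (K / 2 ^ m)) * (s - a) powr (3/4)"
          proof (rule duhamel_bound[where h = h and \<sigma> = \<sigma>])
            show "a < s" "s \<le> a + 1" using False s T by auto
            show "continuous_on {a..s} (\<lambda>s. w s j)" for j
              by (rule continuous_on_subset[OF cont]) (use a in auto)
            show "((\<lambda>s. w s j) has_vector_derivative \<sigma> j * w x j + h x j) (at x)" if "a < x" for x j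
              using deriv a that by auto
            show "(1 + r j) * exp (Re (\<sigma> j) * \<tau>) \<le> C * \<tau> powr (- 1/4)" if "0 < \<tau>" "\<tau> \<le> 1" for \<tau> j
              unfolding \<sigma> by (rule C(2)[OF r that])
            show "(\<Sum>j\<in>F. cmod (h x j)) \<le> \<bar>L\<bar> * (K / 2 ^ m)" if x: "a < x" "x < s" for x
            proof -
              have "(\<Sum>j\<in>F. cmod (h x j)) \<le> L * (K / 2 ^ m)"
                by (rule h) (use Suc.IH x s a in auto)
              also have "\<dots> \<le> \<bar>L\<bar> * (K / 2 ^ m)" using Km by (intro mult_right_mono) auto
              finally show ?thesis .
            qed
          qed (use a r s C in auto)
          also have "\<dots> \<le> 4/3 * C * (\<bar>L\<bar> * (K / 2 ^ m)) * T powr (3/4)"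
            using s by (intro mult_left_mono powr_mono2 mult_nonneg_nonneg Km) (auto intro: less_imp_le[OF C(1)])
          also have "\<dots> = (4/3 * C * \<bar>L\<bar> * T powr (3/4)) * (K / 2 ^ m)" by (simp add: mult_ac)
          also have "\<dots> \<le> 1/2 * (K / 2 ^ m)" using T Km by (intro mult_right_mono) auto
          finally show ?thesis by simp
        qed
      qed
    qed
    have "(\<lambda>m. K / 2 ^ m) \<longlonglongrightarrow> 0" by (rule LIMSEQ_divide_realpow_zero) simp
    then have "(1 + r j) * cmod (w s j) \<le> 0"
      by (rule LIMSEQ_le_const) (use K[rule_format, of s "{j}"] s in auto)
    then show ?thesis using r[of j] by (simp add: mult_le_0_iff)
  qed
  have "\<forall>s j. 0 \<le> s \<longrightarrow> s \<le> real k * T \<longrightarrow> w s j = 0" for k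
  proof (induction k)
    case 0
    then show ?case using init by auto
  next
    case (Suc k)
    then have "w (real k * T) j = 0" for j using T by auto
    then have "w s j = 0" if "real k * T \<le> s" "s \<le> real k * T + T" for s j
      using step[of "real k * T" s] that T by auto
    with Suc show ?case by (auto simp: algebra_simps)
  qed
  moreover obtain k where "t \<le> real k * T"
    using T reals_Archimedean3[of T] by (meson less_imp_le)
  ultimately show ?thesis using t by blast
qed

section \<open>Bohr means\<close>

text \<open>An arbitrary enumeration of the coordinates, which gives each of them its own power of
  the step size.\<close>

definition coord_index :: "'n::finite \<Rightarrow> nat" where
  "coord_index = (SOME f. bij_betw f UNIV {0..<CARD('n)})"

lemma coord_index: "inj (coord_index :: 'n::finite \<Rightarrow> nat)" "coord_index (i :: 'n) < CARD('n)"
proof -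
  have "\<exists>f :: 'n \<Rightarrow> nat. bij_betw f UNIV {0..<CARD('n)}"
    by (rule ex_bij_betw_finite_nat) simp
  then have "bij_betw (coord_index :: 'n \<Rightarrow> nat) UNIV {0..<CARD('n)}"
    unfolding coord_index_def by (rule someI_ex)
  then show "inj (coord_index :: 'n \<Rightarrow> nat)" "coord_index i < CARD('n)"
    by (auto simp: bij_betw_def)
qed

text \<open>The averages below run over the points \<open>j *\<^sub>R bohr_step N\<close>. Every nonzero frequency eventually has
  a nonzero phase increment along the curve \<open>(y, y\<^sup>2, \<dots>)\<close>, and the number of sample points beats the
  inverse of that increment.\<close>
definition bohr_step :: "nat \<Rightarrow> real^'n::finite" where
  "bohr_step N = (\<chi> i. (1 / real (Suc N)) ^ Suc (coord_index i))"

text \<open>The phase increment of a fixed nonzero frequency shrinks at worst like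
  \<open>Suc N\<close> to the power \<open>- CARD('n)\<close>; one further factor makes its product
  with the number of samples diverge.\<close>

definition bohr_size :: "'n::finite itself \<Rightarrow> nat \<Rightarrow> nat" where
  "bohr_size _ N = Suc N ^ Suc CARD('n)"

text \<open>Sampling at finitely many points keeps every average a finite linear combination of
  point values, so measurability and exchange with integrals are immediate. The sign in
  \<open>cis\<close> undoes the phase \<open>cis (- (x \<bullet> \<xi>))\<close> of the
  transform.\<close>

definition bohr_avg :: "nat \<Rightarrow> real^'n::finite \<Rightarrow> (real^'n \<Rightarrow> complex) \<Rightarrow> complex" where
  "bohr_avg N \<xi> v = (\<Sum>j<bohr_size TYPE('n) N. cis (real j * (bohr_step N \<bullet> \<xi>)) * v (real j *\<^sub>R bohr_step N))
     / of_nat (bohr_size TYPE('n) N)"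

definition bohr_mean :: "real^'n::finite \<Rightarrow> (real^'n \<Rightarrow> complex) \<Rightarrow> complex" where
  "bohr_mean \<xi> v = lim (\<lambda>N. bohr_avg N \<xi> v)"

lemma norm_bohr_avg_le:
  assumes "\<And>x. cmod (v x) \<le> B" shows "cmod (bohr_avg N \<xi> v) \<le> B"
proof -
  have p: "bohr_size TYPE('a) N > 0" by (simp add: bohr_size_def)
  have "cmod (\<Sum>j<bohr_size TYPE('a) N. cis (real j * (bohr_step N \<bullet> \<xi>)) * v (real j *\<^sub>R bohr_step N))
    \<le> (\<Sum>j<bohr_size TYPE('a) N. B)"
    by (rule order_trans[OF norm_sum sum_mono]) (simp add: norm_mult assms)
  then show ?thesis using p by (simp add: bohr_avg_def norm_divide divide_le_eq mult.commute)
qed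

section \<open>Orthogonality of characters\<close>

lemma cmod_one_minus_cis: "\<bar>\<theta>\<bar> \<le> 1 \<Longrightarrow> \<bar>\<theta>\<bar> / 2 \<le> cmod (1 - cis \<theta>)"
proof -
  assume t: "\<bar>\<theta>\<bar> \<le> 1"
  have *: "x / 2 \<le> sin x" if "0 \<le> x" "x \<le> 1" for x :: real
  proof -
    have "sin 0 - 0 / 2 \<le> sin x - x / 2"
    proof (rule DERIV_nonneg_imp_nondecreasing[OF that(1)])
      fix y assume y: "0 \<le> y" "y \<le> x"
      \<comment> \<open>By the half-angle formula this gives \<open>cos y \<ge> 1/2\<close> on the
        unit interval, so \<open>sin x - x / 2\<close> is nondecreasing there.\<close>
      have "\<bar>sin (y / 2)\<bar> \<le> \<bar>1 / 2\<bar>" using abs_sin_x_le_abs_x[of "y / 2"] y that by auto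
      then have "(sin (y / 2))\<^sup>2 \<le> (1 / 2)\<^sup>2" by (simp only: abs_le_square_iff)
      then have "0 \<le> cos y - 1 / 2" using cos_double_sin[of "y / 2"] by (simp add: power2_eq_square)
      moreover have "((\<lambda>x. sin x - x / 2) has_real_derivative cos y - 1 / 2) (at y)"
        by (auto intro!: derivative_eq_intros)
      ultimately show "\<exists>d. ((\<lambda>x. sin x - x / 2) has_real_derivative d) (at y) \<and> 0 \<le> d" by blast
    qed
    then show ?thesis by simp
  qed
  have "\<bar>\<theta>\<bar> / 2 \<le> \<bar>sin \<theta>\<bar>"
    using *[of \<theta>] *[of "- \<theta>"] t by (cases "0 \<le> \<theta>") auto
  also have "\<dots> = \<bar>Im (1 - cis \<theta>)\<bar>" by simp
  also have "\<dots> \<le> cmod (1 - cis \<theta>)" by (rule abs_Im_le_cmod)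
  finally show ?thesis .
qed

text \<open>The nonzero coordinate of least index dominates: the increment equals
  \<open>y N ^ Suc k\<close> times a factor tending to that coordinate. So it tends to zero, but
  more slowly than the number of samples grows.\<close>

lemma bohr_step_inner:
  fixes \<eta> :: "real^'n::finite"
  assumes "\<eta> \<noteq> 0"
  shows "\<forall>\<^sub>F N in sequentially. \<bar>bohr_step N \<bullet> \<eta>\<bar> \<le> 1"
    and "filterlim (\<lambda>N. real (bohr_size TYPE('n) N) * \<bar>bohr_step N \<bullet> \<eta>\<bar>) at_top sequentially"
proof -
  define y where "y N = 1 / real (Suc N)" for N
  have y0: "y \<longlonglongrightarrow> 0" unfolding y_def by (rule lim_1_over_n[THEN filterlim_compose[OF _ filterlim_Suc]])
  have yp: "y N > 0" for N by (simp add: y_def)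
  have inner: "bohr_step N \<bullet> \<eta> = (\<Sum>i\<in>UNIV. y N ^ Suc (coord_index i) * \<eta> $ i)" for N
    by (simp add: bohr_step_def inner_vec_def y_def)
  have "(\<lambda>N. \<Sum>i\<in>UNIV. y N ^ Suc (coord_index i) * \<eta> $ i) \<longlonglongrightarrow> (\<Sum>i\<in>UNIV. 0 ^ Suc (coord_index i) * \<eta> $ i)"
    by (intro tendsto_intros y0)
  then have "(\<lambda>N. \<bar>bohr_step N \<bullet> \<eta>\<bar>) \<longlonglongrightarrow> 0"
    unfolding inner by (simp add: tendsto_rabs_zero)
  from order_tendstoD(2)[OF this, of 1] show "\<forall>\<^sub>F N in sequentially. \<bar>bohr_step N \<bullet> \<eta>\<bar> \<le> 1"
    by (auto elim: eventually_mono)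
  have "\<exists>i. \<eta> $ i \<noteq> 0" using assms by (auto simp: vec_eq_iff)
  then obtain m where m: "\<eta> $ m \<noteq> 0" "\<And>i. \<eta> $ i \<noteq> 0 \<Longrightarrow> coord_index m \<le> coord_index i"
    using ex_has_least_nat[of "\<lambda>i. \<eta> $ i \<noteq> 0" _ coord_index] by blast
  define k where "k = coord_index m"
  \<comment> \<open>Zero coordinates are dropped explicitly: those of index below \<open>k\<close>
    would meet the truncated subtraction \<open>coord_index i - k\<close>.\<close>
  define z where "z N = (\<Sum>i\<in>UNIV. (if i = m then \<eta> $ i else if \<eta> $ i = 0 then 0 else y N ^ (coord_index i - k) * \<eta> $ i))" for N
  have z: "bohr_step N \<bullet> \<eta> = y N ^ Suc k * z N" for N
    unfolding inner z_def sum_distrib_left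
  proof (rule sum.cong)
    fix i show "y N ^ Suc (coord_index i) * \<eta> $ i =
      y N ^ Suc k * (if i = m then \<eta> $ i else if \<eta> $ i = 0 then 0 else y N ^ (coord_index i - k) * \<eta> $ i)"
      using m(2)[of i] by (auto simp: k_def simp flip: power_add)
  qed simp
  have "z \<longlonglongrightarrow> (\<Sum>i\<in>UNIV. (if i = m then \<eta> $ i else 0))"
    unfolding z_def
  proof (rule tendsto_sum)
    fix i
    show "(\<lambda>N. if i = m then \<eta> $ i else if \<eta> $ i = 0 then 0 else y N ^ (coord_index i - k) * \<eta> $ i)
      \<longlonglongrightarrow> (if i = m then \<eta> $ i else 0)"
    proof (cases "i = m \<or> \<eta> $ i = 0")
      case False
      then have "coord_index i \<noteq> k" using coord_index(1) by (auto simp: k_def inj_def)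
      with m(2)[of i] False have "0 < coord_index i - k" by (auto simp: k_def)
      moreover have "(\<lambda>N. y N ^ (coord_index i - k) * \<eta> $ i) \<longlonglongrightarrow> 0 ^ (coord_index i - k) * \<eta> $ i"
        by (intro tendsto_intros y0)
      ultimately show ?thesis using False by (simp add: power_0_left)
    qed auto
  qed
  then have zl: "(\<lambda>N. \<bar>z N\<bar>) \<longlonglongrightarrow> \<bar>\<eta> $ m\<bar>" by (simp add: tendsto_rabs)
  have ge: "real (bohr_size TYPE('n) N) * \<bar>bohr_step N \<bullet> \<eta>\<bar> \<ge> \<bar>z N\<bar> * real (Suc N)" for N
  proof -
    have k: "k < CARD('n)" unfolding k_def by (rule coord_index)
    have "real (bohr_size TYPE('n) N) * \<bar>bohr_step N \<bullet> \<eta>\<bar> = real (Suc N) ^ (CARD('n) - k) * \<bar>z N\<bar>"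
    proof -
      have "Suc CARD('n) = (CARD('n) - k) + Suc k" using k by simp
      then have "real (bohr_size TYPE('n) N) = real (Suc N) ^ (CARD('n) - k) * real (Suc N) ^ Suc k"
        unfolding bohr_size_def by (metis of_nat_power power_add)
      moreover have "real (Suc N) ^ Suc k * y N ^ Suc k = 1"
        unfolding power_mult_distrib[symmetric] by (simp add: y_def)
      ultimately show ?thesis using yp[of N] by (simp add: z abs_mult)
    qed
    moreover have "real (Suc N) ^ 1 \<le> real (Suc N) ^ (CARD('n) - k)"
      using k by (intro power_increasing) auto
    ultimately show ?thesis by (simp add: mult.commute mult_left_mono)
  qed
  have "filterlim (\<lambda>N. \<bar>z N\<bar> * real (Suc N)) at_top sequentially"
    by (rule filterlim_tendsto_pos_mult_at_top[OF zl])
       (use m in \<open>auto intro!: filterlim_compose[OF filterlim_real_sequentially filterlim_Suc] simp del: of_nat_Suc\<close>)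
  then show "filterlim (\<lambda>N. real (bohr_size TYPE('n) N) * \<bar>bohr_step N \<bullet> \<eta>\<bar>) at_top sequentially"
    by (rule filterlim_at_top_mono) (use ge in auto)
qed

text \<open>For nonzero \<xi> the average is a geometric sum with ratio \<open>cis \<theta>\<close>,
  bounded by \<open>4 / (m * \<bar>\<theta>\<bar>)\<close>, where \<theta> is the phase increment
  and \<open>m\<close> the number of samples.\<close>

lemma bohr_avg_one: "(\<lambda>N. bohr_avg N \<xi> (\<lambda>_. 1)) \<longlonglongrightarrow> (if \<xi> = 0 then 1 else 0)"
proof (cases "\<xi> = 0")
  case True
  have [simp]: "bohr_size TYPE('a) N \<noteq> 0" for N by (simp add: bohr_size_def)
  with True show ?thesis by (simp add: bohr_avg_def)
next
  case False
  note l = bohr_step_inner[OF False]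
  have "(\<lambda>N. 4 / (real (bohr_size TYPE('a) N) * \<bar>bohr_step N \<bullet> \<xi>\<bar>)) \<longlonglongrightarrow> 0"
    by (rule real_tendsto_divide_at_top[OF tendsto_const l(2)])
  moreover have "\<forall>\<^sub>F N in sequentially. norm (bohr_avg N \<xi> (\<lambda>_. 1)) \<le> 4 / (real (bohr_size TYPE('a) N) * \<bar>bohr_step N \<bullet> \<xi>\<bar>)"
    using l(1) filterlim_at_top_dense[THEN iffD1, OF l(2), rule_format, of 0]
  proof eventually_elim
    case (elim N)
    define \<theta> where "\<theta> = bohr_step N \<bullet> \<xi>"
    define m where "m = bohr_size TYPE('a) N"
    have t: "\<bar>\<theta>\<bar> \<le> 1" "\<bar>\<theta>\<bar> > 0" "m > 0" using elim by (auto simp: \<theta>_def m_def bohr_size_def zero_less_mult_iff)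
    have c1: "\<bar>\<theta>\<bar> / 2 \<le> cmod (1 - cis \<theta>)" by (rule cmod_one_minus_cis[OF t(1)])
    then have ne: "cis \<theta> \<noteq> 1" using t by auto
    have "(\<Sum>j<m. cis (real j * \<theta>)) = (\<Sum>j<m. cis \<theta> ^ j)"
      by (intro sum.cong refl Complex.DeMoivre[symmetric])
    also have "\<dots> = (1 - cis \<theta> ^ m) / (1 - cis \<theta>)" using ne by (simp add: sum_gp_strict)
    finally have "cmod (\<Sum>j<m. cis (real j * \<theta>)) = cmod (1 - cis \<theta> ^ m) / cmod (1 - cis \<theta>)"
      by (simp add: norm_divide)
    also have "\<dots> \<le> 2 / (\<bar>\<theta>\<bar> / 2)"
      using c1 t norm_triangle_ineq4[of 1 "cis \<theta> ^ m"] by (intro frac_le) (auto simp: norm_power)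
    finally have "cmod (\<Sum>j<m. cis (real j * \<theta>)) \<le> 4 / \<bar>\<theta>\<bar>" by simp
    then have "cmod (\<Sum>j<m. cis (real j * \<theta>)) / m \<le> 4 / \<bar>\<theta>\<bar> / m" by (rule divide_right_mono) simp
    then show ?case
      by (simp add: bohr_avg_def norm_divide m_def[symmetric] \<theta>_def[symmetric] mult.commute)
  qed
  ultimately show ?thesis using False by (auto intro: Lim_null_comparison)
qed

text \<open>Multiplication by \<open>cis (- (x \<bullet> \<eta>))\<close> shifts the frequency from
  \<xi> to \<open>\<xi> - \<eta>\<close>. The finite average passes under the integral, and the
  uniform bound on \<open>w\<close> provides the dominating function.\<close>

lemma bohr_avg_mult_tendsto:
  fixes \<nu> :: "(real^'n::finite) measure"
  assumes s [measurable_cong]: "sets \<nu> = sets borel" and g: "integrable \<nu> g"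
    and v: "\<And>x. v x = (\<integral>\<eta>. cis (- (x \<bullet> \<eta>)) * g \<eta> \<partial>\<nu>)"
    and w: "\<And>x. cmod (w x) \<le> B" "\<And>\<xi>. (\<lambda>N. bohr_avg N \<xi> w) \<longlonglongrightarrow> \<beta> \<xi>"
  shows "(\<lambda>N. bohr_avg N \<xi> (\<lambda>x. v x * w x)) \<longlonglongrightarrow> (\<integral>\<eta>. g \<eta> * \<beta> (\<xi> - \<eta>) \<partial>\<nu>)"
proof -
  have [measurable]: "g \<in> borel_measurable \<nu>" using g by auto
  have I: "integrable \<nu> (\<lambda>\<eta>. cis (a * (b \<bullet> (\<xi> - \<eta>))) * z * g \<eta>)" for a b z
    by (rule Bochner_Integration.integrable_bound[of \<nu> "\<lambda>\<eta>. z * g \<eta>"])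
       (use g in \<open>auto simp: norm_mult\<close>)
  have eq: "bohr_avg N \<xi> (\<lambda>x. v x * w x) = (\<integral>\<eta>. g \<eta> * bohr_avg N (\<xi> - \<eta>) w \<partial>\<nu>)" for N
  proof -
    have "cis (real j * (bohr_step N \<bullet> \<xi>)) * (v (real j *\<^sub>R bohr_step N) * w (real j *\<^sub>R bohr_step N)) =
      (\<integral>\<eta>. cis (real j * (bohr_step N \<bullet> (\<xi> - \<eta>))) * w (real j *\<^sub>R bohr_step N) * g \<eta> \<partial>\<nu>)" for j
    proof -
      have "cis (real j * (bohr_step N \<bullet> (\<xi> - \<eta>))) = cis (real j * (bohr_step N \<bullet> \<xi>)) * cis (- (real j * (bohr_step N \<bullet> \<eta>)))" for \<eta>
        by (simp add: cis_mult inner_diff_right right_diff_distrib)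
      then show ?thesis
        by (simp add: v mult_ac flip: integral_mult_right_zero)
    qed
    moreover have "g \<eta> * bohr_avg N (\<xi> - \<eta>) w = (\<Sum>j<bohr_size TYPE('n) N.
        cis (real j * (bohr_step N \<bullet> (\<xi> - \<eta>))) * w (real j *\<^sub>R bohr_step N) * g \<eta>) / of_nat (bohr_size TYPE('n) N)" for \<eta>
      by (simp add: bohr_avg_def sum_distrib_left mult_ac)
    ultimately show ?thesis
      by (simp only: integral_divide_zero Bochner_Integration.integral_sum[OF I]) (simp only: bohr_avg_def)
  qed
  have m: "(\<lambda>\<eta>. bohr_avg N (\<xi> - \<eta>) w) \<in> borel_measurable \<nu>" for N
    unfolding bohr_avg_def by measurable
  have "(\<lambda>N. \<integral>\<eta>. g \<eta> * bohr_avg N (\<xi> - \<eta>) w \<partial>\<nu>) \<longlonglongrightarrow> (\<integral>\<eta>. g \<eta> * \<beta> (\<xi> - \<eta>) \<partial>\<nu>)"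
  proof (rule integral_dominated_convergence[where w = "\<lambda>\<eta>. cmod (g \<eta>) * B"])
    show "(\<lambda>\<eta>. g \<eta> * \<beta> (\<xi> - \<eta>)) \<in> borel_measurable \<nu>"
      using borel_measurable_LIMSEQ_metric[OF m w(2)] by measurable
    show "(\<lambda>\<eta>. g \<eta> * bohr_avg N (\<xi> - \<eta>) w) \<in> borel_measurable \<nu>" for N using m by simp
    show "integrable \<nu> (\<lambda>\<eta>. cmod (g \<eta>) * B)" using g by auto
  qed (auto intro!: AE_I2 tendsto_intros w(2) mult_left_mono norm_bohr_avg_le w(1) simp: norm_mult)
  then show ?thesis by (simp add: eq)
qed

text \<open>Expresses that the atoms have total mass at most \<open>K\<close> without referring to a
  representing measure. Bounds on all finite sums replace summation over the continuum of
  frequencies, and convergence is recorded since \<open>lim\<close> alone does not provide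
  it.\<close>

definition bohr_summable :: "real \<Rightarrow> (real^'n::finite \<Rightarrow> complex) \<Rightarrow> bool" where
  "bohr_summable K w \<longleftrightarrow> (\<exists>B. \<forall>x. cmod (w x) \<le> B) \<and> (\<forall>\<xi>. convergent (\<lambda>N. bohr_avg N \<xi> w)) \<and>
     (\<forall>F. finite F \<longrightarrow> (\<Sum>\<xi>\<in>F. cmod (bohr_mean \<xi> w)) \<le> K)"

lemma bohr_summableD:
  assumes "bohr_summable K w"
  shows "(\<lambda>N. bohr_avg N \<xi> w) \<longlonglongrightarrow> bohr_mean \<xi> w"
    and "\<exists>B. \<forall>x. cmod (w x) \<le> B"
    and "finite F \<Longrightarrow> (\<Sum>\<xi>\<in>F. cmod (bohr_mean \<xi> w)) \<le> K"
    and "0 \<le> K"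
proof -
  show "finite F \<Longrightarrow> (\<Sum>\<xi>\<in>F. cmod (bohr_mean \<xi> w)) \<le> K" for F
    using assms by (auto simp: bohr_summable_def)
  from this[of "{}"] show "0 \<le> K" by simp
qed (use assms in \<open>auto simp: bohr_summable_def bohr_mean_def convergent_LIMSEQ_iff\<close>)

lemma bohr_summableI:
  assumes "\<And>x. cmod (w x) \<le> B" "\<And>\<xi>. (\<lambda>N. bohr_avg N \<xi> w) \<longlonglongrightarrow> \<beta> \<xi>"
    "\<And>F. finite F \<Longrightarrow> (\<Sum>\<xi>\<in>F. cmod (\<beta> \<xi>)) \<le> K"
  shows "bohr_summable K w" "bohr_mean \<xi> w = \<beta> \<xi>"
proof -
  have l: "lim (\<lambda>N. bohr_avg N \<xi> w) = \<beta> \<xi>" for \<xi> by (rule limI[OF assms(2)])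
  show "bohr_mean \<xi> w = \<beta> \<xi>" by (simp add: bohr_mean_def l)
  show "bohr_summable K w"
    unfolding bohr_summable_def bohr_mean_def l using assms unfolding convergent_def by blast
qed

lemma bohr_summable_mono: "bohr_summable K w \<Longrightarrow> K \<le> K' \<Longrightarrow> bohr_summable K' w"
  by (fastforce simp: bohr_summable_def)

lemma bohr_avg_add: "bohr_avg N \<xi> (\<lambda>x. v x + w x) = bohr_avg N \<xi> v + bohr_avg N \<xi> w"
  by (simp add: bohr_avg_def algebra_simps sum.distrib add_divide_distrib)

lemma bohr_avg_cmult: "bohr_avg N \<xi> (\<lambda>x. c * v x) = c * bohr_avg N \<xi> v"
  by (simp add: bohr_avg_def sum_distrib_left mult_ac)

lemma bohr_avg_cnj: "bohr_avg N \<xi> (\<lambda>x. cnj (v x)) = cnj (bohr_avg N (- \<xi>) v)"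
  by (simp add: bohr_avg_def cis_cnj)

lemma bohr_summable_add:
  assumes v: "bohr_summable K v" and w: "bohr_summable L w"
  shows "bohr_summable (K + L) (\<lambda>x. v x + w x)"
    and "bohr_mean \<xi> (\<lambda>x. v x + w x) = bohr_mean \<xi> v + bohr_mean \<xi> w"
proof -
  obtain B C where B: "\<And>x. cmod (v x) \<le> B" and C: "\<And>x. cmod (w x) \<le> C"
    using bohr_summableD(2)[OF v] bohr_summableD(2)[OF w] by blast
  have 1: "cmod (v x + w x) \<le> B + C" for x
    using norm_triangle_ineq[of "v x" "w x"] B[of x] C[of x] by linarith
  have 2: "(\<lambda>N. bohr_avg N \<xi> (\<lambda>x. v x + w x)) \<longlonglongrightarrow> bohr_mean \<xi> v + bohr_mean \<xi> w" for \<xi>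
    unfolding bohr_avg_add by (intro tendsto_add bohr_summableD(1)[OF v] bohr_summableD(1)[OF w])
  have 3: "(\<Sum>\<xi>\<in>F. cmod (bohr_mean \<xi> v + bohr_mean \<xi> w)) \<le> K + L" if "finite F" for F
  proof -
    have "(\<Sum>\<xi>\<in>F. cmod (bohr_mean \<xi> v + bohr_mean \<xi> w)) \<le> (\<Sum>\<xi>\<in>F. cmod (bohr_mean \<xi> v) + cmod (bohr_mean \<xi> w))"
      by (intro sum_mono norm_triangle_ineq)
    then show ?thesis
      using bohr_summableD(3)[OF v that] bohr_summableD(3)[OF w that] by (simp add: sum.distrib)
  qed
  show "bohr_summable (K + L) (\<lambda>x. v x + w x)"
    "bohr_mean \<xi> (\<lambda>x. v x + w x) = bohr_mean \<xi> v + bohr_mean \<xi> w"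
    by (rule bohr_summableI(1)[OF 1 2 3], assumption, rule bohr_summableI(2)[OF 1 2 3])
qed

lemma bohr_summable_cmult:
  assumes w: "bohr_summable K w"
  shows "bohr_summable (cmod c * K) (\<lambda>x. c * w x)"
    and "bohr_mean \<xi> (\<lambda>x. c * w x) = c * bohr_mean \<xi> w"
proof -
  obtain B where B: "\<And>x. cmod (w x) \<le> B" using bohr_summableD(2)[OF w] by blast
  have 1: "cmod (c * w x) \<le> cmod c * B" for x by (simp add: norm_mult B mult_left_mono)
  have 2: "(\<lambda>N. bohr_avg N \<xi> (\<lambda>x. c * w x)) \<longlonglongrightarrow> c * bohr_mean \<xi> w" for \<xi>
    unfolding bohr_avg_cmult by (intro tendsto_mult tendsto_const bohr_summableD(1)[OF w])
  have 3: "(\<Sum>\<xi>\<in>F. cmod (c * bohr_mean \<xi> w)) \<le> cmod c * K" if "finite F" for F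
    using bohr_summableD(3)[OF w that] by (simp add: norm_mult mult_left_mono flip: sum_distrib_left)
  show "bohr_summable (cmod c * K) (\<lambda>x. c * w x)" "bohr_mean \<xi> (\<lambda>x. c * w x) = c * bohr_mean \<xi> w"
    by (rule bohr_summableI(1)[OF 1 2 3], assumption, rule bohr_summableI(2)[OF 1 2 3])
qed

lemma bohr_summable_cnj:
  assumes w: "bohr_summable K w"
  shows "bohr_summable K (\<lambda>x. cnj (w x))"
    and "bohr_mean \<xi> (\<lambda>x. cnj (w x)) = cnj (bohr_mean (- \<xi>) w)"
proof -
  obtain B where B: "\<And>x. cmod (w x) \<le> B" using bohr_summableD(2)[OF w] by blast
  have 1: "cmod (cnj (w x)) \<le> B" for x by (simp add: B)
  have 2: "(\<lambda>N. bohr_avg N \<xi> (\<lambda>x. cnj (w x))) \<longlonglongrightarrow> cnj (bohr_mean (- \<xi>) w)" for \<xi>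
    unfolding bohr_avg_cnj by (intro tendsto_cnj bohr_summableD(1)[OF w])
  have 3: "(\<Sum>\<xi>\<in>F. cmod (cnj (bohr_mean (- \<xi>) w))) \<le> K" if "finite F" for F
    using bohr_summableD(3)[OF w, of "uminus ` F"] that by (simp add: sum.reindex)
  show "bohr_summable K (\<lambda>x. cnj (w x))" "bohr_mean \<xi> (\<lambda>x. cnj (w x)) = cnj (bohr_mean (- \<xi>) w)"
    by (rule bohr_summableI(1)[OF 1 2 3], assumption, rule bohr_summableI(2)[OF 1 2 3])
qed

lemma bohr_summable_zero:
  fixes \<xi> :: "real^'n::finite"
  shows "bohr_summable 0 (\<lambda>_ :: real^'n. 0)" "bohr_mean \<xi> (\<lambda>_. 0) = 0"
  by (rule bohr_summableI[where \<beta> = "\<lambda>_. 0" and B = 0 and K = 0]; simp add: bohr_avg_def)+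

lemma bohr_summable_sum:
  fixes w :: "'k \<Rightarrow> real^'n::finite \<Rightarrow> complex"
  assumes "finite A" "\<And>k. k \<in> A \<Longrightarrow> bohr_summable (K k) (w k)"
  shows "bohr_summable (\<Sum>k\<in>A. K k) (\<lambda>x. \<Sum>k\<in>A. w k x)"
    and "bohr_mean \<xi> (\<lambda>x. \<Sum>k\<in>A. w k x) = (\<Sum>k\<in>A. bohr_mean \<xi> (w k))"
proof -
  have "bohr_summable (\<Sum>k\<in>A. K k) (\<lambda>x. \<Sum>k\<in>A. w k x) \<and>
     bohr_mean \<xi> (\<lambda>x. \<Sum>k\<in>A. w k x) = (\<Sum>k\<in>A. bohr_mean \<xi> (w k))"
    using assms
  proof (induction A rule: finite_induct)
    case empty
    then show ?case by (simp add: bohr_summable_zero)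
  next
    case (insert k A)
    then show ?case
      using bohr_summable_add[of "K k" "w k" "\<Sum>k\<in>A. K k" "\<lambda>x. \<Sum>k\<in>A. w k x"] by simp
  qed
  then show "bohr_summable (\<Sum>k\<in>A. K k) (\<lambda>x. \<Sum>k\<in>A. w k x)"
    "bohr_mean \<xi> (\<lambda>x. \<Sum>k\<in>A. w k x) = (\<Sum>k\<in>A. bohr_mean \<xi> (w k))" by auto
qed

lemma norm_fourier_le:
  fixes \<nu> :: "(real^'n::finite) measure" and g :: "real^'n \<Rightarrow> complex"
  assumes [measurable_cong]: "sets \<nu> = sets borel" and g: "integrable \<nu> g"
  shows "cmod (\<integral>\<eta>. cis (- (x \<bullet> \<eta>)) * g \<eta> \<partial>\<nu>) \<le> (\<integral>\<eta>. cmod (g \<eta>) \<partial>\<nu>)"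
  by (rule order_trans[OF integral_norm_bound]) (simp add: norm_mult)

text \<open>The means of the product form a convolution of the density of \<open>v\<close> with the
  means of \<open>w\<close>. For each fixed \<eta> the shifted finite set still collects at most
  \<open>K\<close>, and integration against \<open>cmod (g \<eta>)\<close> yields
  \<open>L * K\<close>. The roles are asymmetric: \<open>v\<close> is a transform, while the
  estimate sees \<open>w\<close> through its means.\<close>

lemma bohr_summable_mult:
  fixes \<nu> :: "(real^'n::finite) measure"
  assumes s: "sets \<nu> = sets borel" and g: "integrable \<nu> g"
    and v: "\<And>x. v x = (\<integral>\<eta>. cis (- (x \<bullet> \<eta>)) * g \<eta> \<partial>\<nu>)" and L: "(\<integral>\<eta>. cmod (g \<eta>) \<partial>\<nu>) \<le> L"
    and w: "bohr_summable K w"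
  shows "bohr_summable (L * K) (\<lambda>x. v x * w x)"
    and "bohr_mean \<xi> (\<lambda>x. v x * w x) = (\<integral>\<eta>. g \<eta> * bohr_mean (\<xi> - \<eta>) w \<partial>\<nu>)"
proof -
  have [measurable_cong]: "sets \<nu> = sets borel" by fact
  have [measurable]: "g \<in> borel_measurable \<nu>" using g by auto
  obtain B where B: "\<And>x. cmod (w x) \<le> B" using bohr_summableD(2)[OF w] by blast
  have B0: "0 \<le> B" using B[of 0] norm_ge_zero order_trans by blast
  have L0: "0 \<le> L" using L by (rule order_trans[rotated]) simp
  have 1: "cmod (v x * w x) \<le> L * B" for x
    using norm_fourier_le[OF s g, of x] L B[of x] L0 by (auto simp: norm_mult v intro!: mult_mono)
  note wt = bohr_summableD(1)[OF w]
  have 2: "(\<lambda>N. bohr_avg N \<xi> (\<lambda>x. v x * w x)) \<longlonglongrightarrow> (\<integral>\<eta>. g \<eta> * bohr_mean (\<xi> - \<eta>) w \<partial>\<nu>)" for \<xi>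
    by (rule bohr_avg_mult_tendsto[OF s g v B wt])
  have m: "(\<lambda>\<eta>. bohr_mean (\<xi> - \<eta>) w) \<in> borel_measurable \<nu>" for \<xi>
    by (rule borel_measurable_LIMSEQ_metric[where f = "\<lambda>N \<eta>. bohr_avg N (\<xi> - \<eta>) w"])
       (auto simp: bohr_avg_def wt[unfolded bohr_avg_def])
  have le: "cmod (bohr_mean \<xi> w) \<le> K" for \<xi> using bohr_summableD(3)[OF w, of "{\<xi>}"] by simp
  have i: "integrable \<nu> (\<lambda>\<eta>. cmod (g \<eta> * bohr_mean (\<xi> - \<eta>) w))" for \<xi>
    by (rule Bochner_Integration.integrable_bound[of \<nu> "\<lambda>\<eta>. cmod (g \<eta>) * K"])
      (use g m bohr_summableD(4)[OF w] in \<open>auto simp: norm_mult intro!: mult_left_mono le\<close>)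
  have 3: "(\<Sum>\<xi>\<in>F. cmod (\<integral>\<eta>. g \<eta> * bohr_mean (\<xi> - \<eta>) w \<partial>\<nu>)) \<le> L * K" if F: "finite F" for F
  proof -
    have "(\<Sum>\<xi>\<in>F. cmod (\<integral>\<eta>. g \<eta> * bohr_mean (\<xi> - \<eta>) w \<partial>\<nu>)) \<le> (\<Sum>\<xi>\<in>F. \<integral>\<eta>. cmod (g \<eta> * bohr_mean (\<xi> - \<eta>) w) \<partial>\<nu>)"
      by (intro sum_mono integral_norm_bound)
    also have "\<dots> = (\<integral>\<eta>. (\<Sum>\<xi>\<in>F. cmod (g \<eta> * bohr_mean (\<xi> - \<eta>) w)) \<partial>\<nu>)"
      by (rule Bochner_Integration.integral_sum[symmetric]) (rule i)
    also have "\<dots> \<le> (\<integral>\<eta>. cmod (g \<eta>) * K \<partial>\<nu>)"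
    proof (rule integral_mono)
      fix \<eta>
      have "(\<Sum>\<xi>\<in>F. cmod (bohr_mean (\<xi> - \<eta>) w)) = (\<Sum>\<xi>\<in>(\<lambda>\<xi>. \<xi> - \<eta>) ` F. cmod (bohr_mean \<xi> w))"
        by (subst sum.reindex) (auto simp: inj_on_def)
      also have "\<dots> \<le> K" by (rule bohr_summableD(3)[OF w]) (use F in simp)
      finally show "(\<Sum>\<xi>\<in>F. cmod (g \<eta> * bohr_mean (\<xi> - \<eta>) w)) \<le> cmod (g \<eta>) * K"
        by (simp add: norm_mult mult_left_mono flip: sum_distrib_left)
    qed (use g i in auto)
    also have "\<dots> \<le> L * K" using L bohr_summableD(4)[OF w] by (simp add: mult_right_mono)
    finally show ?thesis .
  qed
  show "bohr_summable (L * K) (\<lambda>x. v x * w x)"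
    "bohr_mean \<xi> (\<lambda>x. v x * w x) = (\<integral>\<eta>. g \<eta> * bohr_mean (\<xi> - \<eta>) w \<partial>\<nu>)"
    by (rule bohr_summableI(1)[OF 1 2 3], assumption, rule bohr_summableI(2)[OF 1 2 3])
qed

lemma bohr_summable_one: "bohr_summable 1 (\<lambda>_ :: real^'n::finite. 1)"
  "bohr_mean (\<xi> :: real^'n::finite) (\<lambda>_. 1) = (if \<xi> = 0 then 1 else 0)"
proof -
  have 3: "(\<Sum>\<xi>\<in>F. cmod (if \<xi> = 0 then 1 else 0)) \<le> 1" if "finite F" for F :: "(real^'n::finite) set"
    using that by (simp add: if_distrib sum.delta cong: if_cong)
  show "bohr_summable 1 (\<lambda>_ :: real^'n::finite. 1)" "bohr_mean \<xi> (\<lambda>_. 1) = (if \<xi> = 0 then 1 else 0)"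
    by (rule bohr_summableI[where B = 1, OF _ bohr_avg_one 3]; simp)+
qed

text \<open>The case \<open>w = 1\<close> of the product rule, where only \<eta> = \<xi>
  contributes. The mean is computed from \<open>v\<close> alone, so the atom on the right does not
  depend on the representing pair.\<close>

lemma bohr_summable_fourier:
  fixes \<nu> :: "(real^'n::finite) measure"
  assumes s: "sets \<nu> = sets borel" and g: "integrable \<nu> g" and f: "finite_measure \<nu>"
    and v: "\<And>x. v x = (\<integral>\<eta>. cis (- (x \<bullet> \<eta>)) * g \<eta> \<partial>\<nu>)"
  shows "bohr_summable (\<integral>\<eta>. cmod (g \<eta>) \<partial>\<nu>) v"
    and "bohr_mean \<xi> v = measure \<nu> {\<xi>} *\<^sub>R g \<xi>"
proof -
  note m = bohr_summable_mult[OF s g v order_refl bohr_summable_one(1)]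
  show "bohr_summable (\<integral>\<eta>. cmod (g \<eta>) \<partial>\<nu>) v" using m(1) by simp
  have "bohr_mean \<xi> v = (\<integral>\<eta>. g \<eta> * (if \<xi> - \<eta> = 0 then 1 else 0) \<partial>\<nu>)"
    using m(2)[of \<xi>] by (simp add: bohr_summable_one(2))
  also have "\<dots> = (\<integral>\<eta>. indicator {\<xi>} \<eta> *\<^sub>R g \<xi> \<partial>\<nu>)"
    by (intro Bochner_Integration.integral_cong) (auto simp: indicator_def)
  also have "\<dots> = measure \<nu> {\<xi>} *\<^sub>R g \<xi>"
    using f s by (subst integral_scaleR_left) (auto simp: integrable_indicator_iff finite_measure.emeasure_finite less_top[symmetric])
  finally show "bohr_mean \<xi> v = measure \<nu> {\<xi>} *\<^sub>R g \<xi>" .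
qed

text \<open>At every point at most one of the indicators is nonzero, so the finite sum is dominated
  by \<open>k\<close> before integrating.\<close>

lemma weighted_atom_sum_le:
  fixes \<nu> :: "(real^'n::finite) measure" and k :: "real^'n \<Rightarrow> real"
  assumes s: "sets \<nu> = sets borel" and f: "finite_measure \<nu>"
    and k: "integrable \<nu> k" "\<And>\<xi>. 0 \<le> k \<xi>" and F: "finite F"
  shows "(\<Sum>\<xi>\<in>F. measure \<nu> {\<xi>} * k \<xi>) \<le> (\<integral>\<eta>. k \<eta> \<partial>\<nu>)"
proof -
  interpret finite_measure \<nu> by fact
  have [measurable]: "{\<xi>} \<in> sets \<nu>" for \<xi> using s by simp
  have i: "integrable \<nu> (\<lambda>\<eta>. indicator {\<xi>} \<eta> *\<^sub>R k \<xi>)" for \<xi>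
    by (intro integrable_scaleR_left) (simp add: integrable_indicator_iff emeasure_finite less_top[symmetric])
  have "(\<Sum>\<xi>\<in>F. measure \<nu> {\<xi>} * k \<xi>) = (\<Sum>\<xi>\<in>F. \<integral>\<eta>. indicator {\<xi>} \<eta> *\<^sub>R k \<xi> \<partial>\<nu>)"
    by (intro sum.cong refl, subst integral_scaleR_left)
       (auto simp: integrable_indicator_iff emeasure_finite less_top[symmetric])
  also have "\<dots> = (\<integral>\<eta>. (\<Sum>\<xi>\<in>F. indicator {\<xi>} \<eta> *\<^sub>R k \<xi>) \<partial>\<nu>)"
    by (rule Bochner_Integration.integral_sum[symmetric]) (rule i)
  also have "\<dots> \<le> (\<integral>\<eta>. k \<eta> \<partial>\<nu>)"
  proof (rule integral_mono)
    fix \<eta>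
    have "(\<Sum>\<xi>\<in>F. indicator {\<xi>} \<eta> *\<^sub>R k \<xi>) = (\<Sum>\<xi>\<in>F. if \<xi> = \<eta> then k \<eta> else 0)"
      by (intro sum.cong) auto
    also have "\<dots> \<le> k \<eta>" using F k(2) by (simp add: sum.delta)
    finally show "(\<Sum>\<xi>\<in>F. indicator {\<xi>} \<eta> *\<^sub>R k \<xi>) \<le> k \<eta>" .
  qed (use i k in auto)
  finally show ?thesis .
qed

section \<open>Fourier modes of the linear terms\<close>

lemma cmod_cis_minus_one: "cmod (cis t - 1) \<le> \<bar>t\<bar>"
  using dist_exp_i_1[of t] abs_sin_x_le_abs_x[of "t / 2"] by (simp add: cis_conv_exp)

text \<open>Brings derivatives into the quotient form of \<open>fm_deriv\<close>; it serves the
  spatial derivatives of a field as well as the time derivatives of its modes.\<close>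

lemma has_vector_derivative_iff_quotient:
  "(f has_vector_derivative d) (at x) \<longleftrightarrow> ((\<lambda>h. (f (x + h) - f x) /\<^sub>R h) \<longlongrightarrow> d) (at 0)"
proof -
  have eq: "norm (f (x + h) - f x - h *\<^sub>R d) / norm h = norm ((f (x + h) - f x) /\<^sub>R h - d)" if "h \<noteq> 0" for h
  proof -
    have "(f (x + h) - f x) /\<^sub>R h - d = (f (x + h) - f x - h *\<^sub>R d) /\<^sub>R h"
      using that by (simp add: scaleR_diff_right)
    then show ?thesis by (simp add: divide_inverse_commute)
  qed
  have "(f has_vector_derivative d) (at x) \<longleftrightarrow> ((\<lambda>h. norm (f (x + h) - f x - h *\<^sub>R d) / norm h) \<longlongrightarrow> 0) (at 0)"
    by (simp add: has_vector_derivative_def has_derivative_at bounded_linear_scaleR_left)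
  also have "\<dots> \<longleftrightarrow> ((\<lambda>h. norm ((f (x + h) - f x) /\<^sub>R h - d)) \<longlongrightarrow> 0) (at 0)"
    by (rule LIM_equal) (use eq in auto)
  also have "\<dots> \<longleftrightarrow> ((\<lambda>h. (f (x + h) - f x) /\<^sub>R h) \<longlongrightarrow> d) (at 0)"
    by (simp add: tendsto_norm_zero_iff LIM_zero_iff)
  finally show ?thesis .
qed

text \<open>Differentiation under the integral: \<open>cmod_cis_minus_one\<close> bounds the
  difference quotients by \<open>norm \<xi> * norm (f \<xi>)\<close>, uniformly in the
  increment.\<close>

lemma fourier_has_vector_derivative:
  fixes \<nu> :: "(real^'n::finite) measure"
  assumes s [measurable_cong]: "sets \<nu> = sets borel" and f: "integrable \<nu> f"
    and f1: "integrable \<nu> (\<lambda>\<xi>. norm \<xi> *\<^sub>R f \<xi>)"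
  shows "((\<lambda>h. fourier_meas \<nu> f (x + h *\<^sub>R axis j 1)) has_vector_derivative
    fourier_meas \<nu> (\<lambda>\<xi>. (- \<i> * \<xi> $ j) *s f \<xi>) x) (at 0)"
proof -
  have [measurable]: "f \<in> borel_measurable \<nu>" using f by auto
  let ?c = "\<lambda>\<xi>. cis (- (x \<bullet> \<xi>))"
  define q where "q h \<xi> = ((cis (- (h * \<xi> $ j)) - 1) / of_real h * ?c \<xi>) *s f \<xi>" for h \<xi>
  have sh: "cis (- ((x + h *\<^sub>R axis j 1) \<bullet> \<xi>)) = cis (- (h * \<xi> $ j)) * ?c \<xi>" for h and \<xi> :: "real^'n"
    by (simp add: cis_mult inner_add_left inner_axis inner_commute[of "axis j 1"] add.commute)
  have lim: "((\<lambda>h. q h \<xi>) \<longlongrightarrow> ?c \<xi> *s ((- \<i> * \<xi> $ j) *s f \<xi>)) (at 0)" for \<xi>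
  proof -
    have "((\<lambda>h. cis (- (h * \<xi> $ j))) has_vector_derivative - \<i> * \<xi> $ j) (at 0)"
      unfolding has_vector_derivative_def
      by (rule derivative_eq_intros refl | simp add: scaleR_conv_of_real fun_eq_iff)+
    then have "((\<lambda>h. (cis (- (h * \<xi> $ j)) - 1) / of_real h) \<longlongrightarrow> - \<i> * \<xi> $ j) (at 0)"
      unfolding has_vector_derivative_iff_quotient
      by (simp add: scaleR_conv_of_real divide_inverse mult.commute)
    then have "((\<lambda>h. (cis (- (h * \<xi> $ j)) - 1) / of_real h * ?c \<xi>) \<longlongrightarrow> - \<i> * \<xi> $ j * ?c \<xi>) (at 0)"
      by (rule tendsto_mult_right)
    from bounded_linear.tendsto[OF bounded_linear_smult_left this, of "f \<xi>"]
    show ?thesis unfolding q_def by (simp add: mult_ac vector_smult_assoc)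
  qed
  have int: "integrable \<nu> (\<lambda>\<xi>. cis (- ((x + h *\<^sub>R axis j 1) \<bullet> \<xi>)) *s f \<xi>)" for h
    by (rule integrable_cis_smult[OF f]) measurable
  have dq: "(fourier_meas \<nu> f (x + h *\<^sub>R axis j 1) - fourier_meas \<nu> f x) /\<^sub>R h = integral\<^sup>L \<nu> (q h)" for h
  proof -
    have "fourier_meas \<nu> f (x + h *\<^sub>R axis j 1) - fourier_meas \<nu> f x =
      (\<integral>\<xi>. cis (- ((x + h *\<^sub>R axis j 1) \<bullet> \<xi>)) *s f \<xi> - ?c \<xi> *s f \<xi> \<partial>\<nu>)"
      unfolding fourier_meas_def using int[of h] int[of 0] by (simp add: Bochner_Integration.integral_diff)
    then have "(fourier_meas \<nu> f (x + h *\<^sub>R axis j 1) - fourier_meas \<nu> f x) /\<^sub>R h =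
      (\<integral>\<xi>. (cis (- ((x + h *\<^sub>R axis j 1) \<bullet> \<xi>)) *s f \<xi> - ?c \<xi> *s f \<xi>) /\<^sub>R h \<partial>\<nu>)" by simp
    also have "\<dots> = integral\<^sup>L \<nu> (q h)"
      by (intro Bochner_Integration.integral_cong refl)
         (unfold sh, auto simp: q_def vec_eq_iff scaleR_conv_of_real[where 'a = complex] divide_inverse algebra_simps)
    finally show ?thesis .
  qed
  have "((\<lambda>h. integral\<^sup>L \<nu> (q h)) \<longlongrightarrow> fourier_meas \<nu> (\<lambda>\<xi>. (- \<i> * \<xi> $ j) *s f \<xi>) x) (at 0)"
    unfolding tendsto_at_iff_sequentially
  proof (intro allI impI)
    fix X :: "nat \<Rightarrow> real" assume X: "\<forall>i. X i \<in> UNIV - {0}" "X \<longlonglongrightarrow> 0"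
    have "(\<lambda>i. integral\<^sup>L \<nu> (q (X i))) \<longlonglongrightarrow> (\<integral>\<xi>. ?c \<xi> *s ((- \<i> * \<xi> $ j) *s f \<xi>) \<partial>\<nu>)"
    proof (rule integral_dominated_convergence[where w = "\<lambda>\<xi>. norm (norm \<xi> *\<^sub>R f \<xi>)"])
      show "(\<lambda>\<xi>. ?c \<xi> *s ((- \<i> * \<xi> $ j) *s f \<xi>)) \<in> borel_measurable \<nu>" by measurable
      show "q (X i) \<in> borel_measurable \<nu>" for i unfolding q_def by measurable
      show "integrable \<nu> (\<lambda>\<xi>. norm (norm \<xi> *\<^sub>R f \<xi>))" using f1 by (rule integrable_norm)
      show "AE \<xi> in \<nu>. (\<lambda>i. q (X i) \<xi>) \<longlonglongrightarrow> ?c \<xi> *s ((- \<i> * \<xi> $ j) *s f \<xi>)"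
        using lim X by (auto simp: tendsto_at_iff_sequentially o_def)
      show "AE \<xi> in \<nu>. norm (q (X i) \<xi>) \<le> norm (norm \<xi> *\<^sub>R f \<xi>)" for i
      proof (rule AE_I2)
        fix \<xi>
        have "cmod (cis (- (X i * \<xi> $ j)) - 1) \<le> \<bar>X i\<bar> * \<bar>\<xi> $ j\<bar>"
          using cmod_cis_minus_one[of "- (X i * \<xi> $ j)"] by (simp add: abs_mult)
        also have "\<dots> \<le> \<bar>X i\<bar> * norm \<xi>" by (intro mult_left_mono component_le_norm_cart) simp
        finally have "cmod (cis (- (X i * \<xi> $ j)) - 1) / \<bar>X i\<bar> \<le> norm \<xi>"
          using X by (simp add: divide_le_eq mult.commute)
        from mult_right_mono[OF this, of "norm (f \<xi>)"] show "norm (q (X i) \<xi>) \<le> norm (norm \<xi> *\<^sub>R f \<xi>)"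
          by (simp add: q_def norm_vector_smult norm_mult norm_divide)
      qed
    qed
    then show "((\<lambda>h. integral\<^sup>L \<nu> (q h)) \<circ> X) \<longlonglongrightarrow> fourier_meas \<nu> (\<lambda>\<xi>. (- \<i> * \<xi> $ j) *s f \<xi>) x"
      by (simp add: o_def fourier_meas_def)
  qed
  then have "((\<lambda>h. (fourier_meas \<nu> f (x + h *\<^sub>R axis j 1) - fourier_meas \<nu> f x) /\<^sub>R h)
      \<longlongrightarrow> fourier_meas \<nu> (\<lambda>\<xi>. (- \<i> * \<xi> $ j) *s f \<xi>) x) (at 0)" by (simp only: dq)
  then show ?thesis
    unfolding has_vector_derivative_iff_quotient by simp
qed

lemma pderiv_fourier_meas:
  assumes "sets \<nu> = sets borel" "integrable \<nu> f" "integrable \<nu> (\<lambda>\<xi>. norm \<xi> *\<^sub>R f \<xi>)"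
  shows "pderiv_j j (fourier_meas \<nu> f) = fourier_meas \<nu> (\<lambda>\<xi>. (- \<i> * \<xi> $ j) *s f \<xi>)"
  unfolding pderiv_j_def
  by (rule ext, rule vector_derivative_at, rule fourier_has_vector_derivative[OF assms])

text \<open>A derivative multiplies the density by a polynomial symbol and leaves the measure fixed,
  so it lowers \<open>k\<close> by its order and the transforms can be differentiated
  repeatedly.\<close>

definition fm_moments :: "nat \<Rightarrow> (real^('n::finite)) measure \<Rightarrow> (real^'n \<Rightarrow> complex^'n) \<Rightarrow> bool" where
  "fm_moments k \<nu> f \<longleftrightarrow> sets \<nu> = sets borel \<and> finite_measure \<nu> \<and> integrable \<nu> f \<and>
     integrable \<nu> (\<lambda>\<xi>. (norm \<xi> ^ k) *\<^sub>R f \<xi>)"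

text \<open>Since \<open>r ^ a \<le> 1 + r ^ k\<close> for \<open>a \<le> k\<close>, the moments of
  order 0 and \<open>k\<close> control all those in between.\<close>

lemma fm_moments_mult:
  assumes f: "fm_moments k \<nu> f" and p: "p \<in> borel_measurable borel" and le: "\<And>\<xi>. cmod (p \<xi>) \<le> C * norm \<xi> ^ m"
    and mk: "l + m \<le> k"
  shows "fm_moments l \<nu> (\<lambda>\<xi>. p \<xi> *s f \<xi>)"
proof -
  have [measurable_cong]: "sets \<nu> = sets borel" and i: "integrable \<nu> f" "integrable \<nu> (\<lambda>\<xi>. (norm \<xi> ^ k) *\<^sub>R f \<xi>)"
    using f by (auto simp: fm_moments_def)
  have [measurable]: "f \<in> borel_measurable \<nu>" "p \<in> borel_measurable borel" using i p by auto
  have pw: "r ^ a \<le> 1 + r ^ k" if "0 \<le> r" "a \<le> k" for r :: real and a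
  proof (cases "r \<le> 1")
    case True
    then have "r ^ a \<le> 1" using that by (simp add: power_le_one)
    then show ?thesis using that(1) by (simp add: add_increasing2)
  next
    case False
    then have "r ^ a \<le> r ^ k" using that by (intro power_increasing) auto
    then show ?thesis by simp
  qed
  have C: "C * norm \<xi> ^ m \<ge> 0" for \<xi> :: "real^'a" using le[of \<xi>] norm_ge_zero order_trans by blast
  have J: "integrable \<nu> (\<lambda>\<xi>. (norm \<xi> ^ a) *\<^sub>R (p \<xi> *s f \<xi>))" if "a + m \<le> k" for a
  proof (rule Bochner_Integration.integrable_bound[of \<nu> "\<lambda>\<xi>. \<bar>C\<bar> * (norm (f \<xi>) + norm ((norm \<xi> ^ k) *\<^sub>R f \<xi>))"])
    show "integrable \<nu> (\<lambda>\<xi>. \<bar>C\<bar> * (norm (f \<xi>) + norm ((norm \<xi> ^ k) *\<^sub>R f \<xi>)))"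
      by (intro integrable_mult_right Bochner_Integration.integrable_add integrable_norm i)
    show "AE \<xi> in \<nu>. norm ((norm \<xi> ^ a) *\<^sub>R (p \<xi> *s f \<xi>)) \<le> norm (\<bar>C\<bar> * (norm (f \<xi>) + norm ((norm \<xi> ^ k) *\<^sub>R f \<xi>)))"
    proof (rule AE_I2)
      fix \<xi>
      have "norm ((norm \<xi> ^ a) *\<^sub>R (p \<xi> *s f \<xi>)) = norm \<xi> ^ a * cmod (p \<xi>) * norm (f \<xi>)"
        by (simp add: norm_vector_smult)
      also have "\<dots> \<le> norm \<xi> ^ a * (C * norm \<xi> ^ m) * norm (f \<xi>)"
        by (intro mult_right_mono mult_left_mono le) auto
      also have "\<dots> = C * norm \<xi> ^ (a + m) * norm (f \<xi>)" by (simp add: power_add mult_ac)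
      also have "\<dots> \<le> \<bar>C\<bar> * (1 + norm \<xi> ^ k) * norm (f \<xi>)"
        by (intro mult_right_mono mult_mono pw that) auto
      finally show "norm ((norm \<xi> ^ a) *\<^sub>R (p \<xi> *s f \<xi>)) \<le> norm (\<bar>C\<bar> * (norm (f \<xi>) + norm ((norm \<xi> ^ k) *\<^sub>R f \<xi>)))"
        by (simp add: algebra_simps abs_mult)
    qed
  qed measurable
  show ?thesis using f J[of l] J[of 0] mk by (simp add: fm_moments_def)
qed

lemma fm_moments_mono: "fm_moments k \<nu> f \<Longrightarrow> l \<le> k \<Longrightarrow> fm_moments l \<nu> f"
  using fm_moments_mult[of k \<nu> f "\<lambda>_. 1" 1 0 l] by simp

lemma fm_momentsD:
  assumes "fm_moments k \<nu> f"
  shows "sets \<nu> = sets borel" "finite_measure \<nu>" "integrable \<nu> f" "integrable \<nu> (\<lambda>\<xi>. (norm \<xi> ^ k) *\<^sub>R f \<xi>)"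
    "fm_rep \<nu> f (fourier_meas \<nu> f)"
  using assms by (auto simp: fm_moments_def fm_rep_def)

lemma pderiv_moments:
  assumes f: "fm_moments (Suc k) \<nu> f"
  shows "pderiv_j j (fourier_meas \<nu> f) = fourier_meas \<nu> (\<lambda>\<xi>. (- \<i> * \<xi> $ j) *s f \<xi>)"
    and "fm_moments k \<nu> (\<lambda>\<xi>. (- \<i> * \<xi> $ j) *s f \<xi>)"
proof -
  have "fm_moments 1 \<nu> f" by (rule fm_moments_mono[OF f]) simp
  from fm_momentsD[OF this] show "pderiv_j j (fourier_meas \<nu> f) = fourier_meas \<nu> (\<lambda>\<xi>. (- \<i> * \<xi> $ j) *s f \<xi>)"
    by (intro pderiv_fourier_meas) auto
  show "fm_moments k \<nu> (\<lambda>\<xi>. (- \<i> * \<xi> $ j) *s f \<xi>)"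
    by (rule fm_moments_mult[OF f, of _ 1 1]) (auto simp: norm_mult component_le_norm_cart)
qed

lemma lapl_moments:
  fixes f :: "real^'n::finite \<Rightarrow> complex^'n"
  assumes f: "fm_moments (Suc (Suc k)) \<nu> f"
  shows "lapl (fourier_meas \<nu> f) = fourier_meas \<nu> (\<lambda>\<xi>. (- of_real ((norm \<xi>)\<^sup>2)) *s f \<xi>)"
    and "fm_moments k \<nu> (\<lambda>\<xi>. (- of_real ((norm \<xi>)\<^sup>2)) *s f \<xi>)"
proof -
  show "lapl (fourier_meas \<nu> f) = fourier_meas \<nu> (\<lambda>\<xi>. (- of_real ((norm \<xi>)\<^sup>2)) *s f \<xi>)"
  proof
    fix x
    let ?g = "\<lambda>j \<xi>. cis (- (x \<bullet> \<xi>)) *s ((- \<i> * \<xi> $ j) *s ((- \<i> * \<xi> $ j) *s f \<xi>))"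
    have I: "integrable \<nu> (?g j)" for j
      using fm_momentsD[OF pderiv_moments(2)[OF pderiv_moments(2)[OF f, of j], of j]]
      by (intro integrable_cis_smult) auto
    have "lapl (fourier_meas \<nu> f) x = (\<Sum>j\<in>UNIV. \<integral>\<xi>. ?g j \<xi> \<partial>\<nu>)"
      unfolding lapl_def pderiv_moments(1)[OF f] pderiv_moments(1)[OF pderiv_moments(2)[OF f]]
      by (simp add: fourier_meas_def)
    also have "\<dots> = (\<integral>\<xi>. (\<Sum>j\<in>UNIV. ?g j \<xi>) \<partial>\<nu>)"
      by (rule Bochner_Integration.integral_sum[symmetric]) (rule I)
    also have "(\<lambda>\<xi>. \<Sum>j\<in>UNIV. ?g j \<xi>) = (\<lambda>\<xi>. cis (- (x \<bullet> \<xi>)) *s ((- of_real ((norm \<xi>)\<^sup>2)) *s f \<xi>))"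
    proof
      fix \<xi> :: "real^'n"
      have "(norm \<xi>)\<^sup>2 = (\<Sum>j\<in>UNIV. (\<xi> $ j)\<^sup>2)"
        unfolding power2_norm_eq_inner inner_vec_def by (simp add: power2_eq_square)
      then show "(\<Sum>j\<in>UNIV. ?g j \<xi>) = cis (- (x \<bullet> \<xi>)) *s ((- of_real ((norm \<xi>)\<^sup>2)) *s f \<xi>)"
        by (simp add: vec_eq_iff sum_distrib_left sum_distrib_right power2_eq_square sum_negf algebra_simps)
    qed
    finally show "lapl (fourier_meas \<nu> f) x = fourier_meas \<nu> (\<lambda>\<xi>. (- of_real ((norm \<xi>)\<^sup>2)) *s f \<xi>) x"
      by (simp add: fourier_meas_def)
  qed
  show "fm_moments k \<nu> (\<lambda>\<xi>. (- of_real ((norm \<xi>)\<^sup>2)) *s f \<xi>)"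
    by (rule fm_moments_mult[OF f, of _ 1 2]) (auto simp: norm_power)
qed

definition bohr_field :: "('n::finite) field \<Rightarrow> bool" where
  "bohr_field v \<longleftrightarrow> (\<forall>i. \<exists>K. bohr_summable K (\<lambda>x. v x $ i))"

text \<open>The atom at \<xi> of any representing measure, read off the values of the field by a
  Bohr mean.\<close>

definition mode :: "('n::finite) field \<Rightarrow> real^'n \<Rightarrow> 'n \<Rightarrow> complex" where
  "mode v \<xi> i = bohr_mean \<xi> (\<lambda>x. v x $ i)"

lemma bohr_field_add:
  assumes v: "bohr_field v" and w: "bohr_field w"
  shows "bohr_field (\<lambda>x. v x + w x)" "mode (\<lambda>x. v x + w x) \<xi> i = mode v \<xi> i + mode w \<xi> i"
proof -
  have "(\<exists>K. bohr_summable K (\<lambda>x. (v x + w x) $ i)) \<and> mode (\<lambda>x. v x + w x) \<xi> i = mode v \<xi> i + mode w \<xi> i" for i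
  proof -
    obtain K L where K: "bohr_summable K (\<lambda>x. v x $ i)" "bohr_summable L (\<lambda>x. w x $ i)"
      using v w unfolding bohr_field_def by blast
    show ?thesis using bohr_summable_add[OF K] by (auto simp: mode_def)
  qed
  then show "bohr_field (\<lambda>x. v x + w x)" "mode (\<lambda>x. v x + w x) \<xi> i = mode v \<xi> i + mode w \<xi> i"
    by (auto simp: bohr_field_def)
qed

lemma bohr_field_scaleR:
  assumes v: "bohr_field v"
  shows "bohr_field (\<lambda>x. c *\<^sub>R v x)" "mode (\<lambda>x. c *\<^sub>R v x) \<xi> i = of_real c * mode v \<xi> i"
proof -
  have "(\<exists>K. bohr_summable K (\<lambda>x. (c *\<^sub>R v x) $ i)) \<and> mode (\<lambda>x. c *\<^sub>R v x) \<xi> i = of_real c * mode v \<xi> i" for i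
  proof -
    obtain K where K: "bohr_summable K (\<lambda>x. v x $ i)"
      using v unfolding bohr_field_def by blast
    show ?thesis using bohr_summable_cmult[OF K, where c = "of_real c"]
      by (auto simp: mode_def scaleR_conv_of_real[where 'a = complex])
  qed
  then show "bohr_field (\<lambda>x. c *\<^sub>R v x)" "mode (\<lambda>x. c *\<^sub>R v x) \<xi> i = of_real c * mode v \<xi> i"
    by (auto simp: bohr_field_def)
qed

lemma bohr_field_diff:
  assumes "bohr_field v" "bohr_field w"
  shows "bohr_field (\<lambda>x. v x - w x)" "mode (\<lambda>x. v x - w x) \<xi> i = mode v \<xi> i - mode w \<xi> i"
  using bohr_field_add[OF assms(1) bohr_field_scaleR(1)[OF assms(2), of "-1"]]
    bohr_field_scaleR(2)[OF assms(2), of "-1"] by simp_all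

lemma fm_rep_component:
  assumes r: "fm_rep \<nu> f v"
  shows "v x $ i = (\<integral>\<xi>. cis (- (x \<bullet> \<xi>)) * f \<xi> $ i \<partial>\<nu>)" "integrable \<nu> (\<lambda>\<xi>. f \<xi> $ i)"
proof -
  note r' = fm_repD[OF r]
  have [measurable_cong]: "sets \<nu> = sets borel" by (rule r')
  show "v x $ i = (\<integral>\<xi>. cis (- (x \<bullet> \<xi>)) * f \<xi> $ i \<partial>\<nu>)"
    unfolding r'(4) by (subst integral_vec_nth) (auto intro!: integrable_cis_smult r'(3))
  show "integrable \<nu> (\<lambda>\<xi>. f \<xi> $ i)" by (rule integrable_vec_nth[OF r'(3)])
qed

text \<open>Connects the intrinsic left side with any representation, which lets different
  representations of the same field be used side by side.\<close>

lemma mode_fm_rep: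
  assumes r: "fm_rep \<nu> f v"
  shows "bohr_field v" "mode v \<xi> i = measure \<nu> {\<xi>} *\<^sub>R (f \<xi> $ i)"
proof -
  note c = fm_rep_component[OF r] and r' = fm_repD[OF r]
  note b = bohr_summable_fourier[OF r'(1) c(2) r'(2) c(1)]
  show "bohr_field v" unfolding bohr_field_def using b(1) by blast
  show "mode v \<xi> i = measure \<nu> {\<xi>} *\<^sub>R (f \<xi> $ i)" unfolding mode_def by (rule b(2))
qed

lemma weighted_fm_bohr_field: "weighted_fm s v \<Longrightarrow> bohr_field v"
  unfolding weighted_fm_def using mode_fm_rep(1) by blast

lemma mode_multiplier:
  assumes "fm_moments k \<nu> f" "fm_moments l \<nu> (\<lambda>\<xi>. p \<xi> *s f \<xi>)"
  shows "bohr_field (fourier_meas \<nu> (\<lambda>\<xi>. p \<xi> *s f \<xi>))"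
    and "mode (fourier_meas \<nu> (\<lambda>\<xi>. p \<xi> *s f \<xi>)) \<xi> i = p \<xi> * mode (fourier_meas \<nu> f) \<xi> i"
  using mode_fm_rep[OF fm_momentsD(5)[OF assms(1)]] mode_fm_rep[OF fm_momentsD(5)[OF assms(2)]] by auto

section \<open>The Helmholtz projection on Fourier modes\<close>

definition leray :: "real^'n::finite \<Rightarrow> ('n \<Rightarrow> complex) \<Rightarrow> 'n \<Rightarrow> complex" where
  "leray \<xi> z i = (if \<xi> = 0 then 0 else z i - (\<Sum>k\<in>UNIV. of_real (\<xi> $ k) * z k) / of_real ((norm \<xi>)\<^sup>2) * of_real (\<xi> $ i))"

lemma leray_scaleR: "leray \<xi> (\<lambda>k. of_real c * z k) i = of_real c * leray \<xi> z i"
  by (simp add: leray_def algebra_simps sum_distrib_left)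

lemma leray_add: "leray \<xi> (\<lambda>k. y k + z k) i = leray \<xi> y i + leray \<xi> z i"
  by (simp add: leray_def algebra_simps sum.distrib add_divide_distrib)

text \<open>Cruder than the contraction property of an orthogonal projection, but adapted to sums of
  moduli of components.\<close>

lemma norm_leray_le: "cmod (leray \<xi> z i) \<le> cmod (z i) + (\<Sum>k\<in>UNIV. cmod (z k))"
proof (cases "\<xi> = 0")
  case False
  have "cmod ((\<Sum>k\<in>UNIV. of_real (\<xi> $ k) * z k) / of_real ((norm \<xi>)\<^sup>2) * of_real (\<xi> $ i)) =
    cmod (\<Sum>k\<in>UNIV. of_real (\<xi> $ k) * z k) * \<bar>\<xi> $ i\<bar> / (norm \<xi>)\<^sup>2"
    by (simp add: norm_mult norm_divide norm_power)
  also have "\<dots> \<le> (norm \<xi> * (\<Sum>k\<in>UNIV. cmod (z k))) * norm \<xi> / (norm \<xi>)\<^sup>2"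
  proof (intro divide_right_mono mult_mono component_le_norm_cart)
    have "cmod (\<Sum>k\<in>UNIV. of_real (\<xi> $ k) * z k) \<le> (\<Sum>k\<in>UNIV. norm \<xi> * cmod (z k))"
      by (rule order_trans[OF norm_sum sum_mono]) (auto simp: norm_mult intro!: mult_right_mono component_le_norm_cart)
    then show "cmod (\<Sum>k\<in>UNIV. of_real (\<xi> $ k) * z k) \<le> norm \<xi> * (\<Sum>k\<in>UNIV. cmod (z k))"
      by (simp add: sum_distrib_left)
  qed (auto intro!: mult_nonneg_nonneg sum_nonneg)
  also have "\<dots> = (\<Sum>k\<in>UNIV. cmod (z k))" using False by (simp add: power2_eq_square)
  finally show ?thesis using False unfolding leray_def
    by (simp only: if_False) (rule order_trans[OF norm_triangle_ineq4], simp)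
qed (simp add: leray_def sum_nonneg)

text \<open>The projection picks some representation of \<open>w\<close>, which exists by
  hypothesis. Its symbol acts pointwise on the density, hence on each atom, and the atoms of
  \<open>w\<close> are the same whichever representation is picked.\<close>

lemma helmholtz_mode:
  fixes w :: "('n::finite) field"
  assumes "weighted_fm s w"
  shows "bohr_field (helmholtz w)" "mode (helmholtz w) \<xi> i = leray \<xi> (mode w \<xi>) i"
proof -
  define p where "p = (SOME p. fm_rep (fst p) (snd p) w)"
  have "\<exists>p. fm_rep (fst p) (snd p) w" using assms unfolding weighted_fm_def by auto
  then have p: "fm_rep (fst p) (snd p) w" unfolding p_def by (rule someI_ex)
  define \<nu> f where "\<nu> = fst p" and "f = snd p"
  have r: "fm_rep \<nu> f w" using p by (simp add: \<nu>_def f_def)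
  note r' = fm_repD[OF r]
  have [measurable_cong]: "sets \<nu> = sets borel" by (rule r')
  have [measurable]: "f \<in> borel_measurable \<nu>" using r'(3) by auto
  define g where "g \<xi> = (if \<xi> = 0 then 0 else
        f \<xi> - ((\<Sum>i\<in>UNIV. complex_of_real (\<xi> $ i) * f \<xi> $ i) / complex_of_real ((norm \<xi>)\<^sup>2))
               *s (\<chi> i. complex_of_real (\<xi> $ i)))" for \<xi>
  have gi: "g \<xi> $ i = leray \<xi> (\<lambda>i. f \<xi> $ i) i" for \<xi> i by (simp add: g_def leray_def)
  have "integrable \<nu> g"
  proof (rule integrable_vecI)
    fix i
    show "integrable \<nu> (\<lambda>\<xi>. g \<xi> $ i)"
      unfolding gi
    proof (rule Bochner_Integration.integrable_bound)
      show "integrable \<nu> (\<lambda>\<xi>. cmod (f \<xi> $ i) + (\<Sum>k\<in>UNIV. cmod (f \<xi> $ k)))"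
        by (intro Bochner_Integration.integrable_add Bochner_Integration.integrable_sum integrable_norm integrable_vec_nth r'(3))
      show "(\<lambda>\<xi>. leray \<xi> (\<lambda>i. f \<xi> $ i) i) \<in> borel_measurable \<nu>"
        unfolding leray_def by measurable
      show "AE \<xi> in \<nu>. cmod (leray \<xi> (\<lambda>i. f \<xi> $ i) i) \<le> norm (cmod (f \<xi> $ i) + (\<Sum>k\<in>UNIV. cmod (f \<xi> $ k)))"
        by (intro AE_I2) (auto intro!: order_trans[OF norm_leray_le])
    qed
  qed
  then have rg: "fm_rep \<nu> g (fourier_meas \<nu> g)" using r' by (simp add: fm_rep_def)
  have h: "helmholtz w = fourier_meas \<nu> g"
    unfolding helmholtz_def p_def[symmetric] Let_def \<nu>_def[symmetric] f_def[symmetric] g_def[abs_def] ..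
  show "bohr_field (helmholtz w)" unfolding h by (rule mode_fm_rep(1)[OF rg])
  show "mode (helmholtz w) \<xi> i = leray \<xi> (mode w \<xi>) i"
    unfolding h mode_fm_rep(2)[OF rg] gi mode_fm_rep(2)[OF r] scaleR_conv_of_real[where 'a = complex] leray_scaleR ..
qed

section \<open>Perturbation of a plane wave\<close>

text \<open>An operator bound on atomic mass, common to the components of the solution and to the
  plane wave, so that nonlinear terms can be estimated factor by factor.\<close>

definition bohr_multiplier :: "real \<Rightarrow> (real^'n::finite \<Rightarrow> complex) \<Rightarrow> bool" where
  "bohr_multiplier L v \<longleftrightarrow> (\<forall>K w. bohr_summable K w \<longrightarrow> bohr_summable (L * K) (\<lambda>x. v x * w x))"

lemma bohr_multiplierD: "bohr_multiplier L v \<Longrightarrow> bohr_summable K w \<Longrightarrow> bohr_summable (L * K) (\<lambda>x. v x * w x)"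
  by (simp add: bohr_multiplier_def)

lemma bohr_multiplier_fm_rep:
  assumes r: "fm_rep \<nu> f u" and L: "(\<integral>\<xi>. norm (f \<xi>) \<partial>\<nu>) \<le> L"
  shows "bohr_multiplier L (\<lambda>x. u x $ i)"
proof -
  note c = fm_rep_component[OF r] and r' = fm_repD[OF r]
  have "(\<integral>\<xi>. cmod (f \<xi> $ i) \<partial>\<nu>) \<le> (\<integral>\<xi>. norm (f \<xi>) \<partial>\<nu>)"
    by (rule integral_mono) (use c(2) r'(3) in \<open>auto simp: Finite_Cartesian_Product.norm_nth_le\<close>)
  then show ?thesis
    unfolding bohr_multiplier_def using bohr_summable_mult(1)[OF r'(1) c(2) c(1)] L order_trans by blast
qed

lemma bohr_multiplier_wave:
  shows "bohr_multiplier (cmod z) (\<lambda>x. cis (- (x \<bullet> \<xi>0)) * z)"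
    and "bohr_summable (cmod z) (\<lambda>x. cis (- (x \<bullet> \<xi>0)) * z)"
    and "bohr_mean \<xi> (\<lambda>x. cis (- (x \<bullet> \<xi>0)) * z) = (if \<xi> = \<xi>0 then z else 0)"
proof -
  let ?\<nu> = "distr (count_space (UNIV :: unit set)) borel (\<lambda>_. \<xi>0)"
  have f: "finite_measure ?\<nu>"
    by (intro finite_measure.finite_measure_distr finite_measure_count_space) auto
  have i: "integrable ?\<nu> (\<lambda>_. z)" by (rule finite_measure.integrable_const[OF f])
  have v: "cis (- (x \<bullet> \<xi>0)) * z = (\<integral>\<eta>. cis (- (x \<bullet> \<eta>)) * z \<partial>?\<nu>)" for x
    by (subst integral_distr) (auto simp: lebesgue_integral_count_space_finite UNIV_unit)
  have n: "(\<integral>\<eta>. cmod z \<partial>?\<nu>) = cmod z"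
    by (subst integral_distr) (auto simp: lebesgue_integral_count_space_finite UNIV_unit)
  have m: "measure ?\<nu> {\<xi>} = (if \<xi> = \<xi>0 then 1 else 0)"
    by (subst measure_distr) (auto simp: UNIV_unit)
  show "bohr_multiplier (cmod z) (\<lambda>x. cis (- (x \<bullet> \<xi>0)) * z)"
    unfolding bohr_multiplier_def using bohr_summable_mult(1)[OF sets_distr i v eq_refl[OF n]] by blast
  show "bohr_summable (cmod z) (\<lambda>x. cis (- (x \<bullet> \<xi>0)) * z)"
    using bohr_summable_fourier(1)[OF sets_distr i f v] unfolding n .
  show "bohr_mean \<xi> (\<lambda>x. cis (- (x \<bullet> \<xi>0)) * z) = (if \<xi> = \<xi>0 then z else 0)"
    using bohr_summable_fourier(2)[OF sets_distr i f v, of \<xi>] m by simp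
qed

lemma bohr_multiplier_mono: "bohr_multiplier L v \<Longrightarrow> L \<le> L' \<Longrightarrow> bohr_multiplier L' v"
  unfolding bohr_multiplier_def by (meson bohr_summable_mono bohr_summableD(4) mult_right_mono)

lemma of_real_norm_power2: "complex_of_real ((norm z)\<^sup>2) = (\<Sum>k\<in>UNIV. z $ k * cnj (z $ k))" for z :: "complex^'n"
proof -
  have "(norm z)\<^sup>2 = (\<Sum>k\<in>UNIV. (cmod (z $ k))\<^sup>2)"
    by (simp add: norm_vec_def L2_set_def sum_nonneg)
  then show ?thesis by (simp only: of_real_sum complex_norm_square)
qed

lemma sum_of_real_mult: "(\<Sum>k\<in>UNIV. complex_of_real (x $ k) * of_real (y $ k)) = of_real (x \<bullet> y)"
  by (simp add: inner_vec_def)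

text \<open>Splitting off a plane wave changes the mean at one frequency only. The cubic and
  quadratic estimates thus reduce to exhibiting the term as a summable remainder plus a
  wave.\<close>

lemma bohr_sum_le:
  assumes r: "bohr_summable K r" and v: "\<And>x. v x = r x + cis (- (x \<bullet> \<xi>0)) * z" and F: "finite F"
  shows "(\<Sum>\<xi>\<in>F. cmod (bohr_mean \<xi> v - (if \<xi> = \<xi>0 then z else 0))) \<le> K"
proof -
  have "v = (\<lambda>x. r x + cis (- (x \<bullet> \<xi>0)) * z)" using v by auto
  then have "bohr_mean \<xi> v - (if \<xi> = \<xi>0 then z else 0) = bohr_mean \<xi> r" for \<xi>
    using bohr_summable_add(2)[OF r bohr_multiplier_wave(2)] by (simp add: bohr_multiplier_wave(3))
  then show ?thesis using bohr_summableD(3)[OF r F] by simp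
qed

text \<open>A snapshot of the solution at one time. Two representations occur: \<open>f\<close> has
  a first moment, so that \<open>u\<close> can be differentiated, while \<open>f0\<close> supplies
  the total variation bound \<epsilon>. They may differ, but their atoms agree. \<open>W\<close>
  collects the atoms left after removing the wave, and the weight in \<open>Y\<close> covers both
  them and the atoms of the first derivatives.\<close>

context
  fixes u :: "('n::finite) field" and \<nu> \<nu>0 :: "(real^'n) measure" and f f0 :: "real^'n \<Rightarrow> complex^'n"
    and \<epsilon> Y :: real and a \<xi>0 :: "real^'n" and c :: complex and W :: "real^'n \<Rightarrow> 'n \<Rightarrow> complex"
  assumes f: "fm_moments 1 \<nu> f" and u: "u = fourier_meas \<nu> f"
    and r0: "fm_rep \<nu>0 f0 u" and e0: "(\<integral>\<xi>. norm (f0 \<xi>) \<partial>\<nu>0) \<le> \<epsilon>"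
    and a1: "a \<bullet> a = 1" and a0: "a \<bullet> \<xi>0 = 0" and c: "cmod c \<le> \<epsilon>"
    and W: "\<And>\<xi> i. W \<xi> i = mode u \<xi> i - (if \<xi> = \<xi>0 then c * a $ i else 0)"
    and Y: "\<And>F. finite F \<Longrightarrow> (\<Sum>\<xi>\<in>F. \<Sum>i\<in>UNIV. (1 + norm \<xi>) * cmod (W \<xi> i)) \<le> Y"
begin

definition "plane_wave x = cis (- (x \<bullet> \<xi>0)) * c"
definition "remainder i x = u x $ i - plane_wave x * a $ i"
text \<open>\<open>- \<i> * \<xi>0 $ j\<close> is the symbol of the derivative at \<xi>0, so the
  subtracted term is the derivative of the wave component.\<close>

definition "pderiv_remainder j i x = pderiv_j j u x $ i - - \<i> * \<xi>0 $ j * (plane_wave x * a $ i)"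

lemma eps_nonneg: "0 \<le> \<epsilon>" using c norm_ge_zero order_trans by blast

lemma abs_a_le: "\<bar>a $ i\<bar> \<le> 1"
  using component_le_norm_cart[of a i] a1 by (simp add: norm_eq_sqrt_inner)

lemma weighted_le:
  assumes "finite F" "\<And>\<xi>. cmod (p \<xi>) \<le> (1 + norm \<xi>)"
  shows "(\<Sum>\<xi>\<in>F. cmod (p \<xi> * W \<xi> i)) \<le> Y"
proof -
  have "(\<Sum>\<xi>\<in>F. cmod (p \<xi> * W \<xi> i)) \<le> (\<Sum>\<xi>\<in>F. \<Sum>i\<in>UNIV. (1 + norm \<xi>) * cmod (W \<xi> i))"
  proof (rule sum_mono)
    fix \<xi>
    have "cmod (p \<xi> * W \<xi> i) \<le> (1 + norm \<xi>) * cmod (W \<xi> i)"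
      using assms(2) by (simp add: norm_mult mult_right_mono)
    also have "\<dots> \<le> (\<Sum>i\<in>UNIV. (1 + norm \<xi>) * cmod (W \<xi> i))"
      by (rule member_le_sum) auto
    finally show "cmod (p \<xi> * W \<xi> i) \<le> (\<Sum>i\<in>UNIV. (1 + norm \<xi>) * cmod (W \<xi> i))" .
  qed
  then show ?thesis using Y[OF assms(1)] by linarith
qed

text \<open>The first hypothesis secures boundedness and convergence of the averages; the mass of
  the difference is taken from the second, so that no contribution of the wave is added to
  \<open>Y\<close>.\<close>

lemma bohr_summable_diff_wave:
  assumes v: "bohr_summable K v" and le: "\<And>F. finite F \<Longrightarrow> (\<Sum>\<xi>\<in>F. cmod (bohr_mean \<xi> v - (if \<xi> = \<xi>0 then z else 0))) \<le> Y"
  shows "bohr_summable Y (\<lambda>x. v x - cis (- (x \<bullet> \<xi>0)) * z)"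
proof -
  note w = bohr_summable_cmult[OF bohr_multiplier_wave(2)[of z \<xi>0], where c = "-1"]
  note s = bohr_summable_add[OF v w(1)]
  have "bohr_mean \<xi> (\<lambda>x. v x + - 1 * (cis (- (x \<bullet> \<xi>0)) * z)) = bohr_mean \<xi> v - (if \<xi> = \<xi>0 then z else 0)" for \<xi>
    unfolding s(2) w(2) bohr_multiplier_wave(3) by simp
  with s(1) le have "bohr_summable Y (\<lambda>x. v x + - 1 * (cis (- (x \<bullet> \<xi>0)) * z))"
    unfolding bohr_summable_def by simp
  then show ?thesis by simp
qed

lemma remainder_summable: "bohr_summable Y (remainder i)"
proof -
  obtain K where K: "bohr_summable K (\<lambda>x. u x $ i)"
    using mode_fm_rep(1)[OF r0] by (auto simp: bohr_field_def)
  have "bohr_summable Y (\<lambda>x. u x $ i - cis (- (x \<bullet> \<xi>0)) * (c * a $ i))"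
    by (rule bohr_summable_diff_wave[OF K])
       (use weighted_le[of _ "\<lambda>_. 1" i] in \<open>simp add: W mode_def\<close>)
  then show ?thesis by (simp add: remainder_def[abs_def] plane_wave_def mult_ac)
qed

lemma pderiv_remainder_summable: "bohr_summable Y (pderiv_remainder j i)"
proof -
  note d = pderiv_moments[OF f[unfolded One_nat_def], of j]
  note m = mode_multiplier[OF f d(2)]
  have pu: "pderiv_j j u = fourier_meas \<nu> (\<lambda>\<xi>. (- \<i> * \<xi> $ j) *s f \<xi>)" unfolding u by (rule d)
  obtain K where K: "bohr_summable K (\<lambda>x. pderiv_j j u x $ i)"
    using m(1) by (auto simp: bohr_field_def pu)
  have mm: "bohr_mean \<xi> (\<lambda>x. pderiv_j j u x $ i) = - \<i> * \<xi> $ j * mode u \<xi> i" for \<xi>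
    using m(2)[of \<xi> i] by (simp add: mode_def pu flip: u)
  have "bohr_summable Y (\<lambda>x. pderiv_j j u x $ i - cis (- (x \<bullet> \<xi>0)) * (- \<i> * \<xi>0 $ j * c * a $ i))"
  proof (rule bohr_summable_diff_wave[OF K])
    fix F :: "(real^'n) set" assume F: "finite F"
    have "bohr_mean \<xi> (\<lambda>x. pderiv_j j u x $ i) - (if \<xi> = \<xi>0 then - \<i> * \<xi>0 $ j * c * a $ i else 0)
      = (- \<i> * \<xi> $ j) * W \<xi> i" for \<xi>
      by (simp add: mm W algebra_simps)
    moreover have "cmod (- \<i> * \<xi> $ j) \<le> 1 + norm \<xi>" for \<xi> :: "real^'n"
      using component_le_norm_cart[of \<xi> j] by (simp add: norm_mult)
    ultimately show "(\<Sum>\<xi>\<in>F. cmod (bohr_mean \<xi> (\<lambda>x. pderiv_j j u x $ i) -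
        (if \<xi> = \<xi>0 then - \<i> * \<xi>0 $ j * c * a $ i else 0))) \<le> Y"
      using weighted_le[OF F, of "\<lambda>\<xi>. - \<i> * \<xi> $ j" i] by (simp only:)
  qed
  then show ?thesis by (simp add: pderiv_remainder_def[abs_def] plane_wave_def mult_ac)
qed

lemma u_multiplier: "bohr_multiplier \<epsilon> (\<lambda>x. u x $ i)"
  by (rule bohr_multiplier_fm_rep[OF r0 e0])

lemma plane_wave_multiplier: assumes "cmod z \<le> 1" shows "bohr_multiplier \<epsilon> (\<lambda>x. plane_wave x * z)"
proof -
  have "cmod (c * z) \<le> \<epsilon> * 1" unfolding norm_mult using c assms by (intro mult_mono eps_nonneg) auto
  then show ?thesis
    using bohr_multiplier_mono[OF bohr_multiplier_wave(1)[of "c * z" \<xi>0]] by (simp add: plane_wave_def mult_ac)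
qed

lemma norm_plane_wave: "plane_wave x * cnj (plane_wave x) = of_real ((cmod c)\<^sup>2)"
  unfolding complex_norm_square[symmetric] by (simp add: plane_wave_def norm_mult)

lemma sum_a2: "(\<Sum>k\<in>UNIV. complex_of_real (a $ k) * a $ k) = 1"
  by (simp add: sum_of_real_mult a1)

text \<open>A telescoping expansion: one factor of the cubic term after another is replaced by the
  wave. Each of the three error terms contains one remainder and two factors of size \<epsilon>; the
  pure wave is left at the end, and summation over \<open>k\<close> uses
  \<open>a \<bullet> a = 1\<close>.\<close>

lemma cubic_bound:
  assumes F: "finite F"
  shows "(\<Sum>\<xi>\<in>F. cmod (mode (\<lambda>y. (norm (u y))\<^sup>2 *\<^sub>R u y) \<xi> i -
     (if \<xi> = \<xi>0 then of_real ((cmod c)\<^sup>2) * c * a $ i else 0))) \<le> real CARD('n) * (3 * \<epsilon>\<^sup>2 * Y)"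
  unfolding mode_def
proof (rule bohr_sum_le[OF _ _ F])
  have ai: "cmod (a $ i) \<le> 1" for i using abs_a_le by simp
  \<comment> \<open>Multiplication by a conjugate is written as conjugating, multiplying and
    conjugating again: the multiplier bounds are stated for \<open>u\<close> and the wave
    themselves, and conjugation preserves atomic mass.\<close>
  define r where "r k x = u x $ k * cnj (u x $ k * cnj (remainder i x)) + (u x $ k * (plane_wave x * a $ i * cnj (remainder k x))
    + cnj (plane_wave x * a $ k * cnj (plane_wave x * a $ i * remainder k x)))" for k x
  have "bohr_summable (\<epsilon> * (\<epsilon> * Y) + (\<epsilon> * (\<epsilon> * Y) + \<epsilon> * (\<epsilon> * Y))) (r k)" for k
    unfolding r_def[abs_def]
    by (intro bohr_summable_add(1) bohr_summable_cnj(1) bohr_multiplierD[OF u_multiplier]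
      bohr_multiplierD[OF plane_wave_multiplier[OF ai]] remainder_summable)
  then have "bohr_summable (\<Sum>k\<in>(UNIV::'n set). \<epsilon> * (\<epsilon> * Y) + (\<epsilon> * (\<epsilon> * Y) + \<epsilon> * (\<epsilon> * Y))) (\<lambda>x. \<Sum>k\<in>UNIV. r k x)"
    by (intro bohr_summable_sum(1)) auto
  then show "bohr_summable (real CARD('n) * (3 * \<epsilon>\<^sup>2 * Y)) (\<lambda>x. \<Sum>k\<in>UNIV. r k x)"
    by (simp add: power2_eq_square algebra_simps)
  fix x
  have "u x $ k * cnj (u x $ k) * u x $ i = r k x + (complex_of_real (a $ k) * a $ k) * (of_real ((cmod c)\<^sup>2) * plane_wave x * a $ i)" for k
    unfolding norm_plane_wave[of x, symmetric] by (simp add: r_def remainder_def algebra_simps)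
  then have "(\<Sum>k\<in>UNIV. u x $ k * cnj (u x $ k) * u x $ i) =
      (\<Sum>k\<in>UNIV. r k x) + (\<Sum>k\<in>UNIV. complex_of_real (a $ k) * a $ k) * (of_real ((cmod c)\<^sup>2) * plane_wave x * a $ i)"
    by (simp add: sum.distrib sum_distrib_right)
  moreover have "((norm (u x))\<^sup>2 *\<^sub>R u x) $ i = (\<Sum>k\<in>UNIV. u x $ k * cnj (u x $ k) * u x $ i)"
    unfolding vector_scaleR_component scaleR_conv_of_real[where 'a = complex] of_real_norm_power2
    by (simp add: sum_distrib_right)
  ultimately show "((norm (u x))\<^sup>2 *\<^sub>R u x) $ i = (\<Sum>k\<in>UNIV. r k x) +
      cis (- (x \<bullet> \<xi>0)) * (of_real ((cmod c)\<^sup>2) * c * a $ i)"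
    by (simp add: sum_a2 plane_wave_def mult_ac)
qed

text \<open>The interaction of the wave with itself is proportional to
  \<open>a \<bullet> \<xi>0\<close> and drops out, hence nothing is subtracted. Here the derivative
  of the remainder occurs, and with it the factor \<open>norm \<xi>\<close> in the weight of
  \<open>Y\<close>.\<close>

lemma conv_bound:
  assumes F: "finite F"
  shows "(\<Sum>\<xi>\<in>F. cmod (mode (conv u u) \<xi> i)) \<le> real CARD('n) * ((1 + norm \<xi>0) * \<epsilon> * Y)"
proof -
  have ai: "cmod (a $ i) \<le> 1" for i using abs_a_le by simp
  define r where "r j x = u x $ j * pderiv_remainder j i x + (- \<i> * \<xi>0 $ j) * (plane_wave x * a $ i * remainder j x)" for j x
  have "bohr_summable (\<epsilon> * Y + cmod (- \<i> * \<xi>0 $ j) * (\<epsilon> * Y)) (r j)" for j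
    unfolding r_def[abs_def]
    by (intro bohr_summable_add(1) bohr_summable_cmult(1) bohr_multiplierD[OF u_multiplier]
      bohr_multiplierD[OF plane_wave_multiplier[OF ai]] remainder_summable pderiv_remainder_summable)
  moreover have "\<epsilon> * Y + cmod (- \<i> * \<xi>0 $ j) * (\<epsilon> * Y) \<le> (1 + norm \<xi>0) * \<epsilon> * Y" for j
    using mult_right_mono[OF component_le_norm_cart[of \<xi>0 j], of "\<epsilon> * Y"] eps_nonneg bohr_summableD(4)[OF remainder_summable]
    by (simp add: norm_mult algebra_simps)
  ultimately have "bohr_summable ((1 + norm \<xi>0) * \<epsilon> * Y) (r j)" for j
    using bohr_summable_mono by blast
  then have s: "bohr_summable (\<Sum>k\<in>(UNIV::'n set). (1 + norm \<xi>0) * \<epsilon> * Y) (\<lambda>x. \<Sum>k\<in>UNIV. r k x)"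
    by (intro bohr_summable_sum(1)) auto
  have "conv u u x $ i = (\<Sum>k\<in>UNIV. r k x)" for x
  proof -
    have "u x $ j * pderiv_j j u x $ i = r j x + (- \<i> * (plane_wave x)\<^sup>2 * a $ i) * (complex_of_real (a $ j) * \<xi>0 $ j)" for j
      by (simp add: r_def remainder_def pderiv_remainder_def power2_eq_square algebra_simps)
    moreover have "(\<Sum>j\<in>UNIV. complex_of_real (a $ j) * \<xi>0 $ j) = 0"
      by (simp add: sum_of_real_mult a0)
    ultimately have "(\<Sum>j\<in>UNIV. u x $ j * pderiv_j j u x $ i) = (\<Sum>k\<in>UNIV. r k x)"
      by (simp only: sum.distrib sum_distrib_left[symmetric]) simp
    then show ?thesis by (simp add: conv_def)
  qed
  then have "mode (conv u u) \<xi> i = bohr_mean \<xi> (\<lambda>x. \<Sum>k\<in>UNIV. r k x)" for \<xi> by (simp add: mode_def)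
  then show ?thesis using bohr_summableD(3)[OF s F] by simp
qed

text \<open>On the wave \<open>V \<bullet> u\<close> vanishes and \<open>|u|^2\<close> is constant,
  so the pure wave contributes only at frequency 0. Of the factor 4, two units come from the two
  error terms of \<open>|u|^2\<close> and two from the coefficient 2 of
  \<open>(u \<bullet> V) u\<close>.\<close>

lemma Nl_bound:
  assumes F: "finite F" and V: "V \<bullet> a = 0" and b: "0 \<le> beta"
  shows "(\<Sum>\<xi>\<in>F. cmod (mode (Nl beta V u) \<xi> i - (if \<xi> = 0 then - of_real (beta * (cmod c)\<^sup>2 * V $ i) else 0)))
    \<le> real CARD('n) * (4 * beta * norm V * \<epsilon> * Y)"
  unfolding mode_def
proof (rule bohr_sum_le[OF _ _ F])
  have ai: "cmod (a $ i) \<le> 1" for i using abs_a_le by simp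
  define r where "r k x = (- of_real (beta * V $ i)) * (u x $ k * cnj (remainder k x) + cnj (plane_wave x * a $ k * cnj (remainder k x)))
    + (- of_real (2 * beta * V $ k)) * (u x $ i * remainder k x)" for k x
  have "bohr_summable (cmod (- of_real (beta * V $ i)) * (\<epsilon> * Y + \<epsilon> * Y) + cmod (- of_real (2 * beta * V $ k)) * (\<epsilon> * Y)) (r k)" for k
    unfolding r_def[abs_def]
    by (intro bohr_summable_add(1) bohr_summable_cmult(1) bohr_summable_cnj(1) bohr_multiplierD[OF u_multiplier]
      bohr_multiplierD[OF plane_wave_multiplier[OF ai]] remainder_summable)
  moreover have "cmod (- of_real (beta * V $ i)) * (\<epsilon> * Y + \<epsilon> * Y) + cmod (- of_real (2 * beta * V $ k)) * (\<epsilon> * Y)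
      \<le> 4 * beta * norm V * \<epsilon> * Y" for k
  proof -
    have "0 \<le> \<epsilon> * Y" using eps_nonneg bohr_summableD(4)[OF remainder_summable] by simp
    then have "\<bar>V $ j\<bar> * (beta * (\<epsilon> * Y)) \<le> norm V * (beta * (\<epsilon> * Y))" for j
      using b by (intro mult_right_mono component_le_norm_cart) auto
    from this[of i] this[of k] show ?thesis using b by (simp add: norm_mult abs_mult algebra_simps)
  qed
  ultimately have "bohr_summable (4 * beta * norm V * \<epsilon> * Y) (r k)" for k
    using bohr_summable_mono by blast
  then have s: "bohr_summable (\<Sum>k\<in>(UNIV::'n set). 4 * beta * norm V * \<epsilon> * Y) (\<lambda>x. \<Sum>k\<in>UNIV. r k x)"
    by (intro bohr_summable_sum(1)) auto
  then show "bohr_summable (real CARD('n) * (4 * beta * norm V * \<epsilon> * Y)) (\<lambda>x. \<Sum>k\<in>UNIV. r k x)" by simp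
  fix x
  have Va: "(\<Sum>j\<in>UNIV. complex_of_real (V $ j) * a $ j) = 0"
    by (simp add: sum_of_real_mult V)
  have "- of_real (beta * V $ i) * (u x $ k * cnj (u x $ k)) - of_real (2 * beta) * (V $ k * u x $ k * u x $ i) =
     r k x + (complex_of_real (a $ k) * a $ k) * (- of_real (beta * V $ i) * of_real ((cmod c)\<^sup>2))
      - (complex_of_real (V $ k) * a $ k) * (of_real (2 * beta) * plane_wave x * u x $ i)" for k
    unfolding norm_plane_wave[of x, symmetric] by (simp add: r_def remainder_def algebra_simps)
  then have "(\<Sum>k\<in>UNIV. - of_real (beta * V $ i) * (u x $ k * cnj (u x $ k)) - of_real (2 * beta) * (V $ k * u x $ k * u x $ i)) =
     (\<Sum>k\<in>UNIV. r k x) + (- of_real (beta * V $ i) * of_real ((cmod c)\<^sup>2))"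
    by (simp only: sum.distrib sum_subtractf sum_a2 Va sum_distrib_right[symmetric]) simp
  moreover have "Nl beta V u x $ i = - of_real (beta * V $ i) * of_real ((norm (u x))\<^sup>2) - of_real (2 * beta) * (dotV V (u x) * u x $ i)"
    by (simp add: Nl_def cvec_def scaleR_conv_of_real[where 'a = complex] mult_ac)
  moreover have "\<dots> = (\<Sum>k\<in>UNIV. - of_real (beta * V $ i) * (u x $ k * cnj (u x $ k)) - of_real (2 * beta) * (V $ k * u x $ k * u x $ i))"
    unfolding of_real_norm_power2 dotV_def by (simp add: sum_subtractf sum_distrib_left sum_distrib_right sum_negf mult_ac)
  \<comment> \<open>The constant is written as a wave of frequency 0 to fit
    \<open>bohr_sum_le\<close>.\<close>
  ultimately show "Nl beta V u x $ i = (\<Sum>k\<in>UNIV. r k x) + cis (- (x \<bullet> 0)) * (- of_real (beta * (cmod c)\<^sup>2 * V $ i))"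
    by (simp add: mult_ac)
qed

end

section \<open>The equation for the Fourier modes\<close>

lemma weighted_fm_mono0: "weighted_fm s v \<Longrightarrow> weighted_fm 0 v"
  unfolding weighted_fm_def[of s] using weighted_fm_0I by blast

lemma weighted_fm_smult: assumes "weighted_fm s u" "weighted_fm s v"
  shows "weighted_fm 0 (\<lambda>x. (u x $ k) *s v x)" "weighted_fm 0 (\<lambda>x. cnj (u x $ k) *s v x)"
  using assms weighted_fm_mult unfolding weighted_fm_def[of s] by blast+

text \<open>The second field is kept general so that the constant \<open>cvec V\<close> can take its
  place in the quadratic term.\<close>

lemma weighted_fm_norm_square:
  assumes "weighted_fm 0 u" "weighted_fm 0 v" shows "weighted_fm 0 (\<lambda>x. (norm (u x))\<^sup>2 *\<^sub>R v x)"
proof -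
  have "weighted_fm 0 (\<lambda>x. \<Sum>k\<in>UNIV. (u x $ k) *s (cnj (u x $ k) *s v x))"
    by (intro weighted_fm_sum weighted_fm_smult(1)[OF assms(1) weighted_fm_smult(2)[OF assms]]) simp
  also have "(\<lambda>x. \<Sum>k\<in>UNIV. (u x $ k) *s (cnj (u x $ k) *s v x)) = (\<lambda>x. (norm (u x))\<^sup>2 *\<^sub>R v x)"
    by (simp add: fun_eq_iff vec_eq_iff scaleR_conv_of_real[where 'a = complex] of_real_norm_power2
        sum_distrib_right mult.assoc del: of_real_power)
  finally show ?thesis .
qed

lemma weighted_fm_Nl: assumes "weighted_fm 0 u" shows "weighted_fm 0 (Nl beta V u)"
proof -
  have V: "weighted_fm 0 (\<lambda>_ :: real^'a. cvec V)" using weighted_fm_wave[of 0 0 "cvec V"] by simp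
  have "weighted_fm 0 (\<lambda>x. \<Sum>k\<in>UNIV. V $ k *\<^sub>R ((u x $ k) *s u x))"
    by (intro weighted_fm_sum weighted_fm_scaleR weighted_fm_smult(1)[OF assms assms]) simp
  from weighted_fm_combine[OF weighted_fm_norm_square[OF assms V] this, of "- beta" "- (2 * beta)"]
  have "weighted_fm 0 (\<lambda>x. (- beta) *\<^sub>R ((norm (u x))\<^sup>2 *\<^sub>R cvec V) + (- (2 * beta)) *\<^sub>R (\<Sum>k\<in>UNIV. V $ k *\<^sub>R ((u x $ k) *s u x)))" .
  also have "(\<lambda>x. (- beta) *\<^sub>R ((norm (u x))\<^sup>2 *\<^sub>R cvec V) + (- (2 * beta)) *\<^sub>R (\<Sum>k\<in>UNIV. V $ k *\<^sub>R ((u x $ k) *s u x))) = Nl beta V u"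
  proof
    fix x
    have "(\<Sum>k\<in>UNIV. V $ k *\<^sub>R ((u x $ k) *s u x)) = dotV V (u x) *s u x"
      by (simp add: vec_eq_iff dotV_def scaleR_conv_of_real[where 'a = complex] sum_distrib_right mult.assoc)
    then show "(- beta) *\<^sub>R ((norm (u x))\<^sup>2 *\<^sub>R cvec V) + (- (2 * beta)) *\<^sub>R (\<Sum>k\<in>UNIV. V $ k *\<^sub>R ((u x $ k) *s u x)) = Nl beta V u x"
      by (simp add: Nl_def vec_eq_iff scaleR_conv_of_real[where 'a = complex])
  qed
  finally show ?thesis .
qed

lemma mode_smult_sum:
  assumes "\<And>j. bohr_field (v j)"
  shows "bohr_field (\<lambda>x. \<Sum>j\<in>UNIV. c j *s v j x)"
    and "mode (\<lambda>x. \<Sum>j\<in>(UNIV :: 'k::finite set). c j *s v j x) \<xi> i = (\<Sum>j\<in>UNIV. c j * mode (v j) \<xi> i)"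
proof -
  have "(\<exists>K. bohr_summable K (\<lambda>x. (\<Sum>j\<in>UNIV. c j *s v j x) $ i)) \<and>
    mode (\<lambda>x. \<Sum>j\<in>UNIV. c j *s v j x) \<xi> i = (\<Sum>j\<in>UNIV. c j * mode (v j) \<xi> i)" for i
  proof -
    have "\<forall>j. \<exists>K. bohr_summable K (\<lambda>x. v j x $ i)" using assms unfolding bohr_field_def by blast
    then obtain K where "\<forall>j. bohr_summable (K j) (\<lambda>x. v j x $ i)" by (rule choice[THEN exE])
    then have K: "bohr_summable (K j) (\<lambda>x. v j x $ i)" for j by blast
    have b: "bohr_summable (cmod (c j) * K j) (\<lambda>x. c j * v j x $ i)" for j
      by (rule bohr_summable_cmult(1)[OF K])
    note s = bohr_summable_sum[of "UNIV :: 'k set" "\<lambda>j. cmod (c j) * K j" "\<lambda>j x. c j * v j x $ i", OF finite_class.finite_UNIV b]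
    show ?thesis using s bohr_summable_cmult(2)[OF K] by (auto simp: mode_def)
  qed
  then show "bohr_field (\<lambda>x. \<Sum>j\<in>UNIV. c j *s v j x)"
    "mode (\<lambda>x. \<Sum>j\<in>(UNIV :: 'k::finite set). c j *s v j x) \<xi> i = (\<Sum>j\<in>UNIV. c j * mode (v j) \<xi> i)"
    by (auto simp: bohr_field_def)
qed

text \<open>The symbol of minus the diagonal part of \<open>A0\<close>. With phases
  \<open>cis (- (x \<bullet> \<xi>))\<close> the transport term has symbol
  \<open>- \<i> * lam0 * (V \<bullet> \<xi>)\<close>, hence the plus sign; it is imaginary and does
  not affect growth. The projected term with \<open>V\<close> is of order zero and is treated as
  part of the forcing.\<close>

definition drift :: "real \<Rightarrow> real \<Rightarrow> real \<Rightarrow> real^'n::finite \<Rightarrow> real^'n \<Rightarrow> complex" where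
  "drift lam0 G0 G2 V \<xi> = \<i> * of_real (lam0 * (V \<bullet> \<xi>)) - of_real (G0 * (norm \<xi>)\<^sup>2 + G2 * norm \<xi> ^ 4)"

text \<open>Differential operators act on atoms by their symbols, projections by
  \<open>leray\<close>. All projected terms are gathered under a single \<open>leray\<close>, so
  that the pure-wave parts can be separated inside it before estimating.\<close>

lemma mode_equation:
  fixes f :: "real^'n::finite \<Rightarrow> complex^'n"
  assumes f: "fm_moments 4 \<nu> f" and u: "u = fourier_meas \<nu> f" and w: "weighted_fm s w"
    and eq: "\<And>x. w x + A0 lam0 beta G0 G2 V u x + Hn lam0 beta V u x = 0"
  shows "mode w \<xi> i = drift lam0 G0 G2 V \<xi> * mode u \<xi> i
     - leray \<xi> (\<lambda>k. of_real (2 * beta * V $ k) * (\<Sum>j\<in>UNIV. of_real (V $ j) * mode u \<xi> j)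
         + (of_real beta * mode (\<lambda>y. (norm (u y))\<^sup>2 *\<^sub>R u y) \<xi> k
         + (of_real lam0 * mode (conv u u) \<xi> k - mode (Nl beta V u) \<xi> k))) i"
proof -
  have ru: "fm_rep \<nu> f u" unfolding u by (rule fm_momentsD(5)[OF f])
  have fu: "weighted_fm 0 u" by (rule weighted_fm_0I[OF ru])
  have f1: "fm_moments (Suc 3) \<nu> f" and f2: "fm_moments (Suc (Suc (Suc (Suc 0)))) \<nu> f" using f by (simp_all add: numeral_eq_Suc)
  note d = pderiv_moments[OF f1] and l = lapl_moments[OF f2]
  note ll = lapl_moments[OF l(2)]
  have pd: "bohr_field (pderiv_j j u)" "mode (pderiv_j j u) \<xi> i = - \<i> * \<xi> $ j * mode u \<xi> i" for j
    unfolding u d(1) by (rule mode_multiplier[OF f d(2)])+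
  have fpd: "weighted_fm 0 (pderiv_j j u)" for j
    unfolding u d(1) by (rule weighted_fm_0I[OF fm_momentsD(5)[OF d(2)]])
  have cv: "bohr_field (conv (\<lambda>_. cvec V) u)"
    "mode (conv (\<lambda>_. cvec V) u) \<xi> i = - \<i> * of_real (V \<bullet> \<xi>) * mode u \<xi> i"
    unfolding conv_def cvec_def
    using mode_smult_sum[of "\<lambda>j. pderiv_j j u" "\<lambda>j. of_real (V $ j)", OF pd(1)]
    by (auto simp: pd(2) inner_vec_def sum_distrib_left sum_distrib_right mult_ac sum_negf)
  have lu: "bohr_field (lapl u)" "mode (lapl u) \<xi> i = - of_real ((norm \<xi>)\<^sup>2) * mode u \<xi> i"
    unfolding u l(1) by (rule mode_multiplier[OF f l(2)])+
  have llu: "bohr_field (lapl (lapl u))" "mode (lapl (lapl u)) \<xi> i = of_real (norm \<xi> ^ 4) * mode u \<xi> i"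
    unfolding u l(1) ll(1)
    using mode_multiplier[OF l(2) ll(2)] mode_multiplier[OF f l(2)]
    by (auto simp: power2_eq_square numeral_eq_Suc mult_ac)
  have bl: "bounded_linear (\<lambda>z. dotV V z *s cvec V)"
  proof -
    have "bounded_linear (dotV V)" unfolding dotV_def
      by (intro bounded_linear_sum bounded_linear_compose[OF bounded_linear_mult_right bounded_linear_vec_nth])
    then show ?thesis by (rule bounded_linear_compose[OF bounded_linear_smult_left])
  qed
  have rV: "fm_rep \<nu> (\<lambda>\<xi>. dotV V (f \<xi>) *s cvec V) (\<lambda>y. dotV V (u y) *s cvec V)"
    by (rule fm_rep_linear[OF ru bl]) (simp add: dotV_def vec_eq_iff sum_distrib_left mult_ac)
  have mV: "mode (\<lambda>y. dotV V (u y) *s cvec V) \<xi> k = of_real (V $ k) * (\<Sum>j\<in>UNIV. of_real (V $ j) * mode u \<xi> j)" for k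
    unfolding mode_fm_rep(2)[OF rV] mode_fm_rep(2)[OF ru]
    by (simp add: dotV_def cvec_def scaleR_conv_of_real[where 'a = complex] sum_distrib_left sum_distrib_right mult_ac)
  note hV = helmholtz_mode[OF weighted_fm_0I[OF rV]]
  note h1 = helmholtz_mode[OF weighted_fm_norm_square[OF fu fu]]
  have "weighted_fm 0 (conv u u)" unfolding conv_def by (intro weighted_fm_sum weighted_fm_smult(1)[OF fu fpd]) simp
  note h2 = helmholtz_mode[OF this]
  note h3 = helmholtz_mode[OF weighted_fm_Nl[OF fu]]
  have A: "bohr_field (A0 lam0 beta G0 G2 V u)"
    "mode (A0 lam0 beta G0 G2 V u) \<xi> i = of_real lam0 * (- \<i> * of_real (V \<bullet> \<xi>) * mode u \<xi> i)
      + of_real (2 * beta) * leray \<xi> (mode (\<lambda>y. dotV V (u y) *s cvec V) \<xi>) i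
      - of_real G0 * (- of_real ((norm \<xi>)\<^sup>2) * mode u \<xi> i) + of_real G2 * (of_real (norm \<xi> ^ 4) * mode u \<xi> i)"
    unfolding A0_def
    using bohr_field_add[OF bohr_field_diff(1)[OF bohr_field_add(1)[OF bohr_field_scaleR(1)[OF cv(1)]
       bohr_field_scaleR(1)[OF hV(1)]] bohr_field_scaleR(1)[OF lu(1)]] bohr_field_scaleR(1)[OF llu(1)]]
    by (simp_all only: bohr_field_add bohr_field_diff bohr_field_scaleR cv hV lu llu)
  have H: "bohr_field (Hn lam0 beta V u)"
    "mode (Hn lam0 beta V u) \<xi> i = of_real beta * leray \<xi> (mode (\<lambda>y. (norm (u y))\<^sup>2 *\<^sub>R u y) \<xi>) i
     + of_real lam0 * leray \<xi> (mode (conv u u) \<xi>) i - leray \<xi> (mode (Nl beta V u) \<xi>) i"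
    unfolding Hn_def
    by (simp_all only: bohr_field_add bohr_field_diff bohr_field_scaleR h1 h2 h3)
  have "w x = - (A0 lam0 beta G0 G2 V u x + Hn lam0 beta V u x)" for x
    using eq[of x] by (simp only: eq_neg_iff_add_eq_0 add.assoc)
  then have "w = (\<lambda>x. - 1 *\<^sub>R (A0 lam0 beta G0 G2 V u x + Hn lam0 beta V u x))" by auto
  then have w_eq: "mode w \<xi> i = - (mode (A0 lam0 beta G0 G2 V u) \<xi> i + mode (Hn lam0 beta V u) \<xi> i)"
    using bohr_field_scaleR(2)[OF bohr_field_add(1)[OF A(1) H(1)], of "-1"] bohr_field_add(2)[OF A(1) H(1)] by simp
  have leray_eq: "leray \<xi> (\<lambda>k. of_real (2 * beta * V $ k) * (\<Sum>j\<in>UNIV. of_real (V $ j) * mode u \<xi> j)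
         + (of_real beta * mode (\<lambda>y. (norm (u y))\<^sup>2 *\<^sub>R u y) \<xi> k
         + (of_real lam0 * mode (conv u u) \<xi> k - mode (Nl beta V u) \<xi> k))) i =
     of_real (2 * beta) * leray \<xi> (mode (\<lambda>y. dotV V (u y) *s cvec V) \<xi>) i +
     (of_real beta * leray \<xi> (mode (\<lambda>y. (norm (u y))\<^sup>2 *\<^sub>R u y) \<xi>) i
     + (of_real lam0 * leray \<xi> (mode (conv u u) \<xi>) i - leray \<xi> (mode (Nl beta V u) \<xi>) i))"
  proof -
    have diff: "leray \<xi> (\<lambda>k. y k - z k) i = leray \<xi> y i - leray \<xi> z i" for y z
      using leray_add[of \<xi> y "\<lambda>k. of_real (-1) * z k" i] leray_scaleR[of \<xi> "-1" z i] by simp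
    have e: "of_real (2 * beta * V $ k) * (\<Sum>j\<in>UNIV. of_real (V $ j) * mode u \<xi> j) =
       of_real (2 * beta) * mode (\<lambda>y. dotV V (u y) *s cvec V) \<xi> k" for k
      by (simp add: mV mult_ac)
    show ?thesis by (simp only: e leray_add leray_scaleR diff)
  qed
  show ?thesis
    unfolding w_eq leray_eq A(2) H(2) drift_def by (simp add: algebra_simps)
qed

section \<open>Modes bounded by the norms of the solution space\<close>

lemma mode_le_atom:
  assumes r: "fm_rep \<nu> f v"
  shows "cmod (mode v \<xi> i) \<le> (\<integral>\<xi>. norm (f \<xi>) \<partial>\<nu>)"
proof -
  note r' = fm_repD[OF r]
  have "cmod (mode v \<xi> i) \<le> measure \<nu> {\<xi>} * norm (f \<xi>)"
    unfolding mode_fm_rep(2)[OF r] by (simp add: mult_left_mono Finite_Cartesian_Product.norm_nth_le)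
  also have "\<dots> \<le> (\<integral>\<xi>. norm (f \<xi>) \<partial>\<nu>)"
    using weighted_atom_sum_le[OF r'(1,2), of "\<lambda>\<xi>. norm (f \<xi>)" "{\<xi>}"] r'(3) by simp
  finally show ?thesis .
qed

text \<open>The mode does not depend on the representation, so it is a lower bound of the set whose
  infimum is the norm; the hypothesis makes this set nonempty.\<close>

lemma mode_le_fm_norm: assumes "weighted_fm s v" shows "cmod (mode v \<xi> i) \<le> fm_norm v"
  unfolding fm_norm_def
  by (rule cInf_greatest) (use assms mode_le_atom in \<open>auto simp: weighted_fm_def\<close>)

lemma mode_le_fmpow_norm: assumes "weighted_fm s v" shows "cmod (mode v \<xi> i) \<le> fmpow_norm s v"
  unfolding fmpow_norm_def
proof (rule cInf_greatest)
  fix y assume "y \<in> {(\<integral>\<xi>. norm (f \<xi>) \<partial>\<nu>) + (\<integral>\<xi>. weight s \<xi> * norm (f \<xi>) \<partial>\<nu>)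
                         | \<nu> f. fm_rep \<nu> f v \<and> integrable \<nu> (\<lambda>\<xi>. weight s \<xi> *\<^sub>R f \<xi>)}"
  then obtain \<nu> f where y: "y = (\<integral>\<xi>. norm (f \<xi>) \<partial>\<nu>) + (\<integral>\<xi>. weight s \<xi> * norm (f \<xi>) \<partial>\<nu>)" and r: "fm_rep \<nu> f v" by blast
  have "0 \<le> (\<integral>\<xi>. weight s \<xi> * norm (f \<xi>) \<partial>\<nu>)" by (rule Bochner_Integration.integral_nonneg) simp
  then show "cmod (mode v \<xi> i) \<le> y" using mode_le_atom[OF r, of \<xi> i] unfolding y by linarith
qed (use assms in \<open>auto simp: weighted_fm_def\<close>)

text \<open>Taking a mode is linear and bounded by \<open>fm_norm\<close>, so convergence of the
  difference quotients in norm passes to each mode. Increments smaller than \<open>t\<close> keep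
  the time nonnegative, where \<open>u\<close> is known to be a transform.\<close>

lemma mode_has_vector_derivative:
  fixes u :: "real \<Rightarrow> ('n::finite) field"
  assumes u: "\<And>t. 0 \<le> t \<Longrightarrow> weighted_fm 0 (u t)" and w: "weighted_fm 0 w" and t: "0 < t" and d: "fm_deriv u w t"
  shows "((\<lambda>t. mode (u t) \<xi> i) has_vector_derivative mode w \<xi> i) (at t)"
  unfolding has_vector_derivative_iff_quotient
proof (rule LIM_zero_cancel, rule Lim_null_comparison)
  show "((\<lambda>h. fm_norm (\<lambda>x. (u (t + h) x - u t x) /\<^sub>R h - w x)) \<longlongrightarrow> 0) (at 0)"
    using d by (simp add: fm_deriv_def)
  have "\<forall>\<^sub>F h in at 0. dist h 0 < t" using t eventually_at_ball by (auto simp: eventually_at)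
  then show "\<forall>\<^sub>F h in at 0. norm ((mode (u (t + h)) \<xi> i - mode (u t) \<xi> i) /\<^sub>R h - mode w \<xi> i)
     \<le> fm_norm (\<lambda>x. (u (t + h) x - u t x) /\<^sub>R h - w x)"
  proof eventually_elim
    case (elim h)
    have fh: "weighted_fm 0 (u (t + h))" "weighted_fm 0 (u t)" using u t elim by (auto simp: dist_real_def)
    note b = weighted_fm_bohr_field[OF fh(1)] weighted_fm_bohr_field[OF fh(2)] weighted_fm_bohr_field[OF w]
    have "weighted_fm 0 (\<lambda>x. 1 *\<^sub>R ((1 / h) *\<^sub>R u (t + h) x + (- (1 / h)) *\<^sub>R u t x) + (-1) *\<^sub>R w x)"
      by (intro weighted_fm_combine fh w)
    then have "weighted_fm 0 (\<lambda>x. (u (t + h) x - u t x) /\<^sub>R h - w x)"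
      by (simp add: scaleR_diff_right divide_inverse)
    from mode_le_fm_norm[OF this, of \<xi> i] show ?case
      unfolding bohr_field_diff(2)[OF bohr_field_scaleR(1)[OF bohr_field_diff(1)[OF b(1,2)]] b(3)]
        bohr_field_scaleR(2)[OF bohr_field_diff(1)[OF b(1,2)]] bohr_field_diff(2)[OF b(1,2)]
      by (simp add: scaleR_conv_of_real)
  qed
qed

lemma mode_continuous_on:
  fixes u :: "real \<Rightarrow> ('n::finite) field"
  assumes u: "\<And>t. 0 \<le> t \<Longrightarrow> weighted_fm s (u t)"
    and c: "\<And>t. 0 \<le> t \<Longrightarrow> ((\<lambda>r. fmpow_norm s (\<lambda>x. u r x - u t x)) \<longlongrightarrow> 0) (at t within {0..})"
  shows "continuous_on {0..} (\<lambda>t. mode (u t) \<xi> i)"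
  unfolding continuous_on_def
proof
  fix t :: real assume t: "t \<in> {0..}"
  show "((\<lambda>t. mode (u t) \<xi> i) \<longlongrightarrow> mode (u t) \<xi> i) (at t within {0..})"
  proof (rule LIM_zero_cancel, rule Lim_null_comparison)
    show "((\<lambda>r. fmpow_norm s (\<lambda>x. u r x - u t x)) \<longlongrightarrow> 0) (at t within {0..})" using c t by simp
    show "\<forall>\<^sub>F r in at t within {0..}. norm (mode (u r) \<xi> i - mode (u t) \<xi> i) \<le> fmpow_norm s (\<lambda>x. u r x - u t x)"
      unfolding eventually_at_filter
    proof (rule always_eventually, intro allI impI)
      fix r :: real assume r: "r \<in> {0..}"
      have b: "weighted_fm s (u r)" "weighted_fm s (u t)" using u r t by auto
      have "weighted_fm s (\<lambda>x. u r x - u t x)" using weighted_fm_combine[OF b, of 1 "-1"] by simp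
      from mode_le_fmpow_norm[OF this, of \<xi> i]
      show "norm (mode (u r) \<xi> i - mode (u t) \<xi> i) \<le> fmpow_norm s (\<lambda>x. u r x - u t x)"
        unfolding bohr_field_diff(2)[OF weighted_fm_bohr_field[OF b(1)] weighted_fm_bohr_field[OF b(2)]] .
    qed
  qed
qed

lemma fmpow_norm_lessE:
  assumes "weighted_fm s v" "fmpow_norm s v < \<epsilon>"
  obtains \<nu> f where "fm_rep \<nu> f v" "integrable \<nu> (\<lambda>\<xi>. weight s \<xi> *\<^sub>R f \<xi>)"
    "(\<integral>\<xi>. norm (f \<xi>) \<partial>\<nu>) + (\<integral>\<xi>. weight s \<xi> * norm (f \<xi>) \<partial>\<nu>) < \<epsilon>"
proof -
  let ?S = "{(\<integral>\<xi>. norm (f \<xi>) \<partial>\<nu>) + (\<integral>\<xi>. weight s \<xi> * norm (f \<xi>) \<partial>\<nu>)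
                         | \<nu> f. fm_rep \<nu> f v \<and> integrable \<nu> (\<lambda>\<xi>. weight s \<xi> *\<^sub>R f \<xi>)}"
  have "?S \<noteq> {}" using assms(1) by (auto simp: weighted_fm_def)
  from cInf_lessD[OF this assms(2)[unfolded fmpow_norm_def]] show thesis using that by blast
qed

text \<open>Applied with \<open>s = 4 * \<gamma>\<close>, this is where \<gamma> \<ge> 1/4 enters:
  for \<open>1 \<le> s\<close> the weight \<open>1 + norm \<xi>\<close> is at most
  \<open>2 + weight s \<xi>\<close>, so the norm of the solution space controls the atoms with one
  derivative.\<close>

lemma weighted_mode_sum_le:
  fixes v :: "('n::finite) field"
  assumes r: "fm_rep \<nu> f v" and w: "integrable \<nu> (\<lambda>\<xi>. weight s \<xi> *\<^sub>R f \<xi>)" and s: "1 \<le> s"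
    and e: "(\<integral>\<xi>. norm (f \<xi>) \<partial>\<nu>) + (\<integral>\<xi>. weight s \<xi> * norm (f \<xi>) \<partial>\<nu>) < \<epsilon>" and F: "finite F"
  shows "(\<Sum>\<xi>\<in>F. \<Sum>i\<in>UNIV. (1 + norm \<xi>) * cmod (mode v \<xi> i)) \<le> real CARD('n) * (2 * \<epsilon>)"
proof -
  note r' = fm_repD[OF r]
  have le: "1 + norm \<xi> \<le> 2 + weight s \<xi>" for \<xi> :: "real^'n"
  proof (cases "norm \<xi> \<le> 1")
    case False
    then have "norm \<xi> powr 1 \<le> norm \<xi> powr s" using s by (intro powr_mono) auto
    moreover have "norm \<xi> powr 1 = norm \<xi>" using False by simp
    ultimately show ?thesis by (simp add: weight_def)
  qed (simp add: add_increasing2)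
  have wi: "integrable \<nu> (\<lambda>\<xi>. weight s \<xi> * norm (f \<xi>))" using integrable_norm[OF w] by simp
  have I: "integrable \<nu> (\<lambda>\<xi>. 2 * norm (f \<xi>) + weight s \<xi> * norm (f \<xi>))"
    using wi r'(3) by auto
  have nn: "0 \<le> (\<integral>\<xi>. weight s \<xi> * norm (f \<xi>) \<partial>\<nu>)" by (rule Bochner_Integration.integral_nonneg) simp
  have "(\<Sum>\<xi>\<in>F. (1 + norm \<xi>) * cmod (mode v \<xi> i)) \<le> 2 * \<epsilon>" for i
  proof -
    have "(\<Sum>\<xi>\<in>F. (1 + norm \<xi>) * cmod (mode v \<xi> i)) \<le> (\<Sum>\<xi>\<in>F. measure \<nu> {\<xi>} * (2 * norm (f \<xi>) + weight s \<xi> * norm (f \<xi>)))"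
    proof (rule sum_mono)
      fix \<xi>
      have "(1 + norm \<xi>) * cmod (f \<xi> $ i) \<le> (2 + weight s \<xi>) * norm (f \<xi>)"
        by (intro mult_mono le Finite_Cartesian_Product.norm_nth_le) auto
      then have "measure \<nu> {\<xi>} * ((1 + norm \<xi>) * cmod (f \<xi> $ i)) \<le> measure \<nu> {\<xi>} * ((2 + weight s \<xi>) * norm (f \<xi>))"
        by (rule mult_left_mono) simp
      then show "(1 + norm \<xi>) * cmod (mode v \<xi> i) \<le> measure \<nu> {\<xi>} * (2 * norm (f \<xi>) + weight s \<xi> * norm (f \<xi>))"
        unfolding mode_fm_rep(2)[OF r] by (simp add: algebra_simps)
    qed
    also have "\<dots> \<le> (\<integral>\<xi>. 2 * norm (f \<xi>) + weight s \<xi> * norm (f \<xi>) \<partial>\<nu>)"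
      by (rule weighted_atom_sum_le[OF r'(1,2) I _ F]) simp
    also have "\<dots> = 2 * (\<integral>\<xi>. norm (f \<xi>) \<partial>\<nu>) + (\<integral>\<xi>. weight s \<xi> * norm (f \<xi>) \<partial>\<nu>)"
      using wi r'(3) by simp
    also have "\<dots> \<le> 2 * \<epsilon>" using e nn by linarith
    finally show ?thesis .
  qed
  then have "(\<Sum>i\<in>(UNIV::'n set). \<Sum>\<xi>\<in>F. (1 + norm \<xi>) * cmod (mode v \<xi> i)) \<le> (\<Sum>i\<in>(UNIV::'n set). 2 * \<epsilon>)"
    by (intro sum_mono)
  then show ?thesis by (subst sum.swap) simp
qed

lemma norm_dotV_le: "cmod (dotV a z) \<le> norm a * norm z"
proof -
  have "cmod (dotV a z) \<le> (\<Sum>i\<in>UNIV. \<bar>a $ i\<bar> * \<bar>cmod (z $ i)\<bar>)"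
    unfolding dotV_def by (rule order_trans[OF norm_sum]) (simp add: norm_mult)
  also have "\<dots> \<le> L2_set (\<lambda>i. a $ i) UNIV * L2_set (\<lambda>i. cmod (z $ i)) UNIV" by (rule L2_set_mult_ineq)
  finally show ?thesis by (simp add: norm_vec_def L2_set_def)
qed

text \<open>Cauchy-Schwarz at the level of the density gives the bound \<epsilon> without a
  dimensional factor, as the amplitude has to meet exactly the smallness required in
  \<open>landau_growth\<close>.\<close>

lemma norm_dotV_mode_le:
  assumes r: "fm_rep \<nu> f v" and e: "(\<integral>\<xi>. norm (f \<xi>) \<partial>\<nu>) \<le> \<epsilon>" and a: "norm a = 1"
  shows "cmod (\<Sum>i\<in>UNIV. of_real (a $ i) * mode v \<xi> i) \<le> \<epsilon>"
proof -
  note r' = fm_repD[OF r]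
  have "(\<Sum>i\<in>UNIV. of_real (a $ i) * mode v \<xi> i) = measure \<nu> {\<xi>} *\<^sub>R dotV a (f \<xi>)"
    unfolding mode_fm_rep(2)[OF r] dotV_def
    by (simp add: scaleR_conv_of_real sum_distrib_left mult_ac)
  then have "cmod (\<Sum>i\<in>UNIV. of_real (a $ i) * mode v \<xi> i) \<le> measure \<nu> {\<xi>} * norm (f \<xi>)"
    using norm_dotV_le[of a "f \<xi>"] a by (simp add: mult_left_mono)
  also have "\<dots> \<le> (\<integral>\<xi>. norm (f \<xi>) \<partial>\<nu>)"
    using weighted_atom_sum_le[OF r'(1,2), of "\<lambda>\<xi>. norm (f \<xi>)" "{\<xi>}"] r'(3) by simp
  finally show ?thesis using e by simp
qed

lemma fm_X_fmw: "fm_X s v \<Longrightarrow> weighted_fm s v"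
  unfolding fm_X_def weighted_fm_def by blast

lemma fm_X_4_moments: assumes "fm_X 4 v" obtains \<nu> f where "fm_moments 4 \<nu> f" "v = fourier_meas \<nu> f"
proof -
  obtain \<nu> f where r: "fm_rep \<nu> f v" "integrable \<nu> (\<lambda>\<xi>. weight 4 \<xi> *\<^sub>R f \<xi>)"
    using assms unfolding fm_X_def by blast
  have "weight 4 \<xi> = norm \<xi> ^ 4" for \<xi> :: "real^'a"
    by (cases "\<xi> = 0") (auto simp: weight_def)
  with r that show thesis by (auto simp: fm_moments_def fm_rep_def)
qed

lemma leray_orthogonal:
  assumes "a \<bullet> \<xi> = 0" "\<xi> \<noteq> 0"
  shows "leray \<xi> (\<lambda>k. z * of_real (a $ k)) i = z * of_real (a $ i)"
proof -
  have "(\<Sum>k\<in>UNIV. of_real (\<xi> $ k) * (z * of_real (a $ k))) = z * (\<Sum>k\<in>UNIV. complex_of_real (a $ k) * of_real (\<xi> $ k))"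
    by (simp add: sum_distrib_left mult_ac)
  then show ?thesis using assms by (simp add: leray_def sum_of_real_mult)
qed

lemma sum_norm_leray_le:
  fixes z :: "real^'n::finite \<Rightarrow> 'n \<Rightarrow> complex"
  shows "(\<Sum>\<xi>\<in>F. \<Sum>i\<in>UNIV. cmod (leray \<xi> (z \<xi>) i)) \<le> (1 + real CARD('n)) * (\<Sum>\<xi>\<in>F. \<Sum>i\<in>UNIV. cmod (z \<xi> i))"
proof -
  have le: "(\<Sum>i\<in>(UNIV::'n set). cmod (leray \<xi> (z \<xi>) i)) \<le> (1 + real CARD('n)) * (\<Sum>i\<in>UNIV. cmod (z \<xi> i))" for \<xi>
  proof -
    have "(\<Sum>i\<in>(UNIV::'n set). cmod (leray \<xi> (z \<xi>) i)) \<le> (\<Sum>i\<in>(UNIV::'n set). cmod (z \<xi> i) + (\<Sum>k\<in>UNIV. cmod (z \<xi> k)))"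
      by (intro sum_mono norm_leray_le)
    then show ?thesis by (simp add: sum.distrib algebra_simps)
  qed
  show ?thesis by (subst sum_distrib_left, rule sum_mono, rule le)
qed

text \<open>\<open>sectorial_uniqueness\<close> is applied to pairs of frequency and component; a
  finite set of pairs is enlarged to a product with all components.\<close>

lemma sum_pairs_le:
  fixes g :: "'a \<Rightarrow> 'n::finite \<Rightarrow> real"
  assumes J: "finite J" and g: "\<And>\<xi> i. 0 \<le> g \<xi> i"
  shows "(\<Sum>p\<in>J. g (fst p) (snd p)) \<le> (\<Sum>\<xi>\<in>fst ` J. \<Sum>i\<in>UNIV. g \<xi> i)"
proof -
  have "(\<Sum>p\<in>J. g (fst p) (snd p)) \<le> (\<Sum>p\<in>fst ` J \<times> UNIV. g (fst p) (snd p))"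
    by (rule sum_mono2) (use J g in \<open>auto intro: rev_image_eqI\<close>)
  also have "\<dots> = (\<Sum>\<xi>\<in>fst ` J. \<Sum>i\<in>UNIV. g \<xi> i)"
    by (simp add: sum.cartesian_product case_prod_unfold)
  finally show ?thesis .
qed

text \<open>Along the plane wave the equation reduces to the Landau amplitude equation.\<close>
lemma landau_growth:
  fixes c :: "real \<Rightarrow> complex"
  assumes mu: "0 < \<mu>" and b: "0 < beta" "beta * \<epsilon>\<^sup>2 \<le> \<mu> / 2" and \<sigma>: "Re \<sigma> = \<mu>"
    and cont: "continuous_on {0..} c"
    and d: "\<And>t. 0 < t \<Longrightarrow> (c has_vector_derivative \<sigma> * c t - of_real (beta * (cmod (c t))\<^sup>2) * c t) (at t)"
    and le: "\<And>t. 0 \<le> t \<Longrightarrow> cmod (c t) \<le> \<epsilon>" and c0: "c 0 \<noteq> 0"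
  shows False
proof -
  \<comment> \<open>While \<open>beta * (cmod (c t))\<^sup>2\<close> is at most
    \<open>\<mu> / 2\<close>, the squared modulus grows at least at rate \<mu>, so \<open>p\<close>
    is nondecreasing.\<close>
  define p where "p t = (cmod (c t))\<^sup>2 * exp (- \<mu> * t)" for t
  have mono: "p 0 \<le> p t" if t: "0 < t" for t
  proof -
    have D: "(p has_real_derivative (\<mu> * (cmod (c x))\<^sup>2 - 2 * beta * (cmod (c x)) ^ 4) * exp (- \<mu> * x)) (at x)" if x: "0 < x" for x
    proof -
      let ?d = "\<sigma> * c x - of_real (beta * (cmod (c x))\<^sup>2) * c x"
      have re: "((\<lambda>t. Re (c t)) has_real_derivative Re ?d) (at x)"
        and im: "((\<lambda>t. Im (c t)) has_real_derivative Im ?d) (at x)"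
        using bounded_linear.has_vector_derivative[OF bounded_linear_Re d[OF x]]
          bounded_linear.has_vector_derivative[OF bounded_linear_Im d[OF x]]
        by (auto simp: has_real_derivative_iff_has_vector_derivative)
      have gen: "((\<lambda>t. ((f t)\<^sup>2 + (g t)\<^sup>2) * exp (- \<mu> * t)) has_real_derivative
          (2 * f x * f' + 2 * g x * g') * exp (- \<mu> * x) + ((f x)\<^sup>2 + (g x)\<^sup>2) * (- \<mu> * exp (- \<mu> * x))) (at x)"
        if "(f has_real_derivative f') (at x)" "(g has_real_derivative g') (at x)" for f g :: "real \<Rightarrow> real" and f' g'
        by (auto intro!: derivative_eq_intros that simp: algebra_simps)
      have key: "2 * Re (c x) * Re ?d + 2 * Im (c x) * Im ?d = 2 * \<mu> * (cmod (c x))\<^sup>2 - 2 * beta * (cmod (c x))\<^sup>2 * (cmod (c x))\<^sup>2"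
        using \<sigma> unfolding cmod_power2 by (simp add: algebra_simps power2_eq_square)
      have val: "(2 * Re (c x) * Re ?d + 2 * Im (c x) * Im ?d) * exp (- \<mu> * x)
          + ((Re (c x))\<^sup>2 + (Im (c x))\<^sup>2) * (- \<mu> * exp (- \<mu> * x)) =
          (\<mu> * (cmod (c x))\<^sup>2 - 2 * beta * (cmod (c x)) ^ 4) * exp (- \<mu> * x)"
        unfolding key cmod_power2[symmetric] by (simp add: algebra_simps numeral_eq_Suc)
      have "p = (\<lambda>t. ((Re (c t))\<^sup>2 + (Im (c t))\<^sup>2) * exp (- \<mu> * t))" by (simp add: p_def[abs_def] cmod_power2)
      then show ?thesis using gen[OF re im] unfolding val by simp
    qed
    have cp: "continuous_on {0..t} p"
      unfolding p_def by (intro continuous_intros continuous_on_subset[OF cont]) auto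
    have dp: "p differentiable (at x)" if "0 < x" "x < t" for x
      using D[OF that(1)] unfolding real_differentiable_def by blast
    obtain l z where z: "0 < z" "z < t" "(p has_real_derivative l) (at z)" "p t - p 0 = (t - 0) * l"
      using MVT[OF t cp dp] by blast
    have "l = (\<mu> * (cmod (c z))\<^sup>2 - 2 * beta * (cmod (c z)) ^ 4) * exp (- \<mu> * z)"
      by (rule DERIV_unique[OF z(3) D[OF z(1)]])
    moreover have "2 * beta * (cmod (c z)) ^ 4 \<le> \<mu> * (cmod (c z))\<^sup>2"
    proof -
      have "(cmod (c z))\<^sup>2 \<le> \<epsilon>\<^sup>2" using le[of z] z by (intro power_mono) auto
      then have "beta * (cmod (c z))\<^sup>2 \<le> beta * \<epsilon>\<^sup>2" using b by (intro mult_left_mono) auto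
      then have "2 * beta * (cmod (c z))\<^sup>2 \<le> \<mu>" using b by linarith
      from mult_right_mono[OF this, of "(cmod (c z))\<^sup>2"] show ?thesis by (simp add: numeral_eq_Suc mult_ac)
    qed
    ultimately have "0 \<le> l" by simp
    then show ?thesis using z(4) t by (smt (verit) mult_nonneg_nonneg)
  qed
  define A where "A = (cmod (c 0))\<^sup>2"
  have A: "0 < A" using c0 by (simp add: A_def)
  \<comment> \<open>Chosen so that already the linear lower bound for the exponential gives
    \<open>2 * A + \<epsilon>\<^sup>2\<close>, above the ceiling
    \<open>\<epsilon>\<^sup>2\<close>.\<close>
  define t where "t = (\<epsilon>\<^sup>2 / A + 1) / \<mu>"
  have t: "0 < t" using mu A by (simp add: t_def add_nonneg_pos)
  have "A \<le> (cmod (c t))\<^sup>2 * exp (- \<mu> * t)" using mono[OF t] by (simp add: p_def A_def)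
  also have "\<dots> \<le> \<epsilon>\<^sup>2 * exp (- \<mu> * t)" using le[of t] t by (intro mult_right_mono power_mono) auto
  finally have "A * exp (\<mu> * t) \<le> \<epsilon>\<^sup>2 * (exp (- \<mu> * t) * exp (\<mu> * t))"
    by (metis exp_ge_zero mult.assoc mult_right_mono)
  then have "A * exp (\<mu> * t) \<le> \<epsilon>\<^sup>2" by (simp flip: exp_add)
  moreover have "A * (1 + \<mu> * t) \<le> A * exp (\<mu> * t)" using A exp_ge_add_one_self by (intro mult_left_mono) auto
  moreover have "A * (1 + \<mu> * t) = 2 * A + \<epsilon>\<^sup>2" using A mu by (simp add: t_def field_simps)
  ultimately show False using A by linarith
qed

text \<open>The sources of \<open>W\<close> are bounded by the weighted mass of \<open>W\<close>
  itself, with a constant that may be large: smallness is provided by short time windows in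
  \<open>sectorial_uniqueness\<close>. Once \<open>W = 0\<close>, the equation for \<open>c\<close>
  loses its coupling and contradicts \<open>landau_growth\<close>.\<close>

lemma no_small_global_solution:
  fixes a V \<xi>0 :: "real^'n::finite" and u :: "real \<Rightarrow> ('n::finite) field"
  assumes G2: "0 < G2" and beta: "0 < beta" and a1: "a \<bullet> a = 1" and Va: "V \<bullet> a = 0" and a0: "a \<bullet> \<xi>0 = 0"
    and x0: "\<xi>0 \<noteq> 0" and mu: "\<mu> = - (G0 * (norm \<xi>0)\<^sup>2 + G2 * norm \<xi>0 ^ 4)" "0 < \<mu>"
    and eps: "beta * \<epsilon>\<^sup>2 \<le> \<mu> / 2" and \<gamma>: "1/4 \<le> \<gamma>" and c0: "c0 \<noteq> (0 :: real)"
    and glob: "global_solution lam0 beta G0 G2 V \<gamma> u"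
    and init: "u 0 = (\<lambda>x. cis (- (x \<bullet> \<xi>0)) *s (of_real c0 *s cvec a))"
    and small: "\<And>t. 0 \<le> t \<Longrightarrow> fmpow_norm (4 * \<gamma>) (u t) < \<epsilon>"
  shows False
proof -
  define N where "N = real CARD('n)"
  have N: "0 \<le> N" by (simp add: N_def)
  have fw: "weighted_fm (4 * \<gamma>) (u t)" if "0 \<le> t" for t
    using glob that fm_X_fmw unfolding global_solution_def by blast
  obtain u' where u': "\<And>t. 0 < t \<Longrightarrow> fm_X 4 (u t)" "\<And>t. 0 < t \<Longrightarrow> fm_X 0 (u' t)" "\<And>t. 0 < t \<Longrightarrow> fm_deriv u (u' t) t"
    "\<And>t x. 0 < t \<Longrightarrow> u' t x + A0 lam0 beta G0 G2 V (u t) x + Hn lam0 beta V (u t) x = 0"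
    using glob unfolding global_solution_def by blast
  \<comment> \<open>Only the component along \<open>a\<close> of the atom at \<xi>0; the part of
    that atom transversal to \<open>a\<close> stays in \<open>W\<close>.\<close>
  define c where "c t = (\<Sum>i\<in>UNIV. of_real (a $ i) * mode (u t) \<xi>0 i)" for t
  define W where "W t \<xi> i = mode (u t) \<xi> i - (if \<xi> = \<xi>0 then c t * of_real (a $ i) else 0)" for t \<xi> i
  have na: "norm a = 1" using a1 by (simp add: norm_eq_sqrt_inner)
  have ai: "\<bar>a $ i\<bar> \<le> 1" for i using component_le_norm_cart[of a i] na by simp
  have aa: "(\<Sum>k\<in>UNIV. complex_of_real (a $ k) * of_real (a $ k)) = 1" by (simp add: sum_of_real_mult a1)
  have Va': "(\<Sum>k\<in>UNIV. complex_of_real (V $ k) * of_real (a $ k)) = 0" by (simp add: sum_of_real_mult Va)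

  have rep: "\<exists>\<nu> f. fm_rep \<nu> f (u t) \<and> (\<integral>\<xi>. norm (f \<xi>) \<partial>\<nu>) \<le> \<epsilon> \<and>
     (\<forall>F. finite F \<longrightarrow> (\<Sum>\<xi>\<in>F. \<Sum>i\<in>UNIV. (1 + norm \<xi>) * cmod (mode (u t) \<xi> i)) \<le> N * (2 * \<epsilon>))" if t: "0 \<le> t" for t
  proof -
    obtain \<nu> f where r: "fm_rep \<nu> f (u t)" "integrable \<nu> (\<lambda>\<xi>. weight (4 * \<gamma>) \<xi> *\<^sub>R f \<xi>)"
      "(\<integral>\<xi>. norm (f \<xi>) \<partial>\<nu>) + (\<integral>\<xi>. weight (4 * \<gamma>) \<xi> * norm (f \<xi>) \<partial>\<nu>) < \<epsilon>"
      by (rule fmpow_norm_lessE[OF fw[OF t] small[OF t]])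
    have "0 \<le> (\<integral>\<xi>. weight (4 * \<gamma>) \<xi> * norm (f \<xi>) \<partial>\<nu>)" by (rule Bochner_Integration.integral_nonneg) simp
    with r(3) have "(\<integral>\<xi>. norm (f \<xi>) \<partial>\<nu>) \<le> \<epsilon>" by linarith
    then show ?thesis using r weighted_mode_sum_le[OF r(1,2) _ r(3)] \<gamma> unfolding N_def by auto
  qed
  have cn: "cmod (c t) \<le> \<epsilon>" if "0 \<le> t" for t
    using rep[OF that] norm_dotV_mode_le[OF _ _ na] unfolding c_def by blast
  have e0: "0 \<le> \<epsilon>" using cn[of 0] norm_ge_zero order_trans by blast
  \<comment> \<open>The a priori bound that starts the halving: the mass of the solution plus the
    largest possible mass of the wave.\<close>
  have bound: "(\<Sum>\<xi>\<in>F. \<Sum>i\<in>UNIV. (1 + norm \<xi>) * cmod (W t \<xi> i)) \<le> N * (2 * \<epsilon>) + (1 + norm \<xi>0) * (N * \<epsilon>)"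
    if t: "0 \<le> t" and F: "finite F" for t F
  proof -
    have "(\<Sum>\<xi>\<in>F. \<Sum>i\<in>UNIV. (1 + norm \<xi>) * cmod (W t \<xi> i)) \<le> (\<Sum>\<xi>\<in>F. \<Sum>i\<in>UNIV.
        (1 + norm \<xi>) * cmod (mode (u t) \<xi> i) + (if \<xi> = \<xi>0 then (1 + norm \<xi>0) * \<epsilon> else 0))"
    proof (intro sum_mono)
      fix \<xi> i
      have "cmod (c t * of_real (a $ i)) \<le> \<epsilon> * 1" unfolding norm_mult using cn[OF t] ai[of i] e0 by (intro mult_mono) auto
      then have "cmod (W t \<xi> i) \<le> cmod (mode (u t) \<xi> i) + (if \<xi> = \<xi>0 then \<epsilon> else 0)"
        unfolding W_def by (intro order_trans[OF norm_triangle_ineq4] add_mono) auto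
      from mult_left_mono[OF this, of "1 + norm \<xi>"]
      show "(1 + norm \<xi>) * cmod (W t \<xi> i) \<le> (1 + norm \<xi>) * cmod (mode (u t) \<xi> i) + (if \<xi> = \<xi>0 then (1 + norm \<xi>0) * \<epsilon> else 0)"
        by (auto simp: algebra_simps split: if_splits)
    qed
    also have "\<dots> = (\<Sum>\<xi>\<in>F. \<Sum>i\<in>UNIV. (1 + norm \<xi>) * cmod (mode (u t) \<xi> i)) + (\<Sum>\<xi>\<in>F. if \<xi> = \<xi>0 then (1 + norm \<xi>0) * (N * \<epsilon>) else 0)"
      by (auto simp: sum.distrib N_def intro!: sum.cong)
    also have "\<dots> \<le> N * (2 * \<epsilon>) + (1 + norm \<xi>0) * (N * \<epsilon>)"
      using rep[OF t] F e0 N by (intro add_mono) (auto simp: sum.delta)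
    finally show ?thesis .
  qed

  \<comment> \<open>All terms other than the diagonal drift, with the pure-wave contributions to the
    cubic term at \<xi>0 and to the quadratic term at 0 subtracted; what remains is controlled by
    \<open>W\<close>.\<close>
  define q where "q t \<xi> k = of_real (2 * beta * V $ k) * (\<Sum>j\<in>UNIV. of_real (V $ j) * W t \<xi> j)
     + (of_real beta * (mode (\<lambda>y. (norm (u t y))\<^sup>2 *\<^sub>R u t y) \<xi> k - (if \<xi> = \<xi>0 then of_real ((cmod (c t))\<^sup>2) * c t * of_real (a $ k) else 0))
     + (of_real lam0 * mode (conv (u t) (u t)) \<xi> k
        - (mode (Nl beta V (u t)) \<xi> k - (if \<xi> = 0 then - of_real (beta * (cmod (c t))\<^sup>2 * V $ k) else 0))))" for t \<xi> k
  \<comment> \<open>Collects the constants of the three nonlinear estimates and of the linear term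
    with \<open>V\<close>; one factor \<open>N\<close> in each comes from summing over the output
    component.\<close>
  define Q where "Q = 2 * beta * (norm V)\<^sup>2 * N + (beta * (N * (N * (3 * \<epsilon>\<^sup>2)))
     + (\<bar>lam0\<bar> * (N * (N * ((1 + norm \<xi>0) * \<epsilon>))) + N * (N * (4 * beta * norm V * \<epsilon>))))"
  have q_le: "(\<Sum>\<xi>\<in>F. \<Sum>k\<in>UNIV. cmod (q t \<xi> k)) \<le> Q * Y"
    if t: "0 < t" and Y: "\<And>F. finite F \<Longrightarrow> (\<Sum>\<xi>\<in>F. \<Sum>i\<in>UNIV. (1 + norm \<xi>) * cmod (W t \<xi> i)) \<le> Y" and F: "finite F" for t Y F
  proof -
    obtain \<nu>0 f0 where r0: "fm_rep \<nu>0 f0 (u t)" "(\<integral>\<xi>. norm (f0 \<xi>) \<partial>\<nu>0) \<le> \<epsilon>" using rep[of t] t by auto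
    \<comment> \<open>The second representation comes from membership in the domain of
      \<open>A0\<close> and provides the moments.\<close>
    obtain \<nu> f where f: "fm_moments 4 \<nu> f" "u t = fourier_meas \<nu> f" by (rule fm_X_4_moments[OF u'(1)[OF t]])
    have f1: "fm_moments 1 \<nu> f" by (rule fm_moments_mono[OF f(1)]) simp
    note hyps = f1 f(2) r0 a1 a0 cn[OF less_imp_le[OF t]] W_def Y
    note R1 = cubic_bound[OF hyps F] and R2 = conv_bound[OF hyps F]
      and R3 = Nl_bound[OF hyps F Va less_imp_le[OF beta]]
    have swap: "(\<Sum>\<xi>\<in>F. \<Sum>k\<in>UNIV. g \<xi> k) \<le> N * B" if "\<And>k. (\<Sum>\<xi>\<in>F. g \<xi> k) \<le> B" for g :: "real^'n \<Rightarrow> 'n \<Rightarrow> real" and B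
    proof -
      have "(\<Sum>k\<in>(UNIV :: 'n set). \<Sum>\<xi>\<in>F. g \<xi> k) \<le> (\<Sum>k\<in>(UNIV :: 'n set). B)" by (intro sum_mono that)
      then show ?thesis by (subst sum.swap) (simp add: N_def)
    qed
    have R0: "(\<Sum>\<xi>\<in>F. \<Sum>k\<in>UNIV. cmod (of_real (2 * beta * V $ k) * (\<Sum>j\<in>UNIV. of_real (V $ j) * W t \<xi> j))) \<le> N * (2 * beta * (norm V)\<^sup>2 * Y)"
    proof (rule swap)
      fix k
      have "(\<Sum>\<xi>\<in>F. cmod (of_real (2 * beta * V $ k) * (\<Sum>j\<in>UNIV. of_real (V $ j) * W t \<xi> j)))
         \<le> (\<Sum>\<xi>\<in>F. 2 * beta * (norm V)\<^sup>2 * (\<Sum>i\<in>UNIV. (1 + norm \<xi>) * cmod (W t \<xi> i)))"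
      proof (rule sum_mono)
        fix \<xi>
        have "cmod (\<Sum>j\<in>UNIV. of_real (V $ j) * W t \<xi> j) \<le> (\<Sum>i\<in>UNIV. norm V * ((1 + norm \<xi>) * cmod (W t \<xi> i)))"
        proof (rule order_trans[OF norm_sum sum_mono])
          fix j
          have "\<bar>V $ j\<bar> * (1 * cmod (W t \<xi> j)) \<le> norm V * ((1 + norm \<xi>) * cmod (W t \<xi> j))"
            by (intro mult_mono component_le_norm_cart) auto
          then show "cmod (of_real (V $ j) * W t \<xi> j) \<le> norm V * ((1 + norm \<xi>) * cmod (W t \<xi> j))" by (simp add: norm_mult)
        qed
        then have "2 * beta * norm V * cmod (\<Sum>j\<in>UNIV. of_real (V $ j) * W t \<xi> j) \<le> 2 * beta * norm V * (norm V * (\<Sum>i\<in>UNIV. (1 + norm \<xi>) * cmod (W t \<xi> i)))"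
          using beta by (intro mult_left_mono) (auto simp: sum_distrib_left)
        moreover have "2 * beta * \<bar>V $ k\<bar> * cmod (\<Sum>j\<in>UNIV. of_real (V $ j) * W t \<xi> j) \<le> 2 * beta * norm V * cmod (\<Sum>j\<in>UNIV. of_real (V $ j) * W t \<xi> j)"
          using beta by (intro mult_left_mono mult_right_mono component_le_norm_cart) auto
        ultimately show "cmod (of_real (2 * beta * V $ k) * (\<Sum>j\<in>UNIV. of_real (V $ j) * W t \<xi> j)) \<le> 2 * beta * (norm V)\<^sup>2 * (\<Sum>i\<in>UNIV. (1 + norm \<xi>) * cmod (W t \<xi> i))"
          using beta by (simp add: norm_mult abs_mult power2_eq_square mult_ac)
      qed
      also have "\<dots> = 2 * beta * (norm V)\<^sup>2 * (\<Sum>\<xi>\<in>F. \<Sum>i\<in>UNIV. (1 + norm \<xi>) * cmod (W t \<xi> i))"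
        by (rule sum_distrib_left[symmetric])
      also have "\<dots> \<le> 2 * beta * (norm V)\<^sup>2 * Y" using beta by (intro mult_left_mono Y F) auto
      finally show "(\<Sum>\<xi>\<in>F. cmod (of_real (2 * beta * V $ k) * (\<Sum>j\<in>UNIV. of_real (V $ j) * W t \<xi> j))) \<le> 2 * beta * (norm V)\<^sup>2 * Y" .
    qed
    have "(\<Sum>\<xi>\<in>F. \<Sum>k\<in>UNIV. cmod (q t \<xi> k)) \<le> (\<Sum>\<xi>\<in>F. \<Sum>k\<in>UNIV.
       cmod (of_real (2 * beta * V $ k) * (\<Sum>j\<in>UNIV. of_real (V $ j) * W t \<xi> j))
     + (beta * cmod (mode (\<lambda>y. (norm (u t y))\<^sup>2 *\<^sub>R u t y) \<xi> k - (if \<xi> = \<xi>0 then of_real ((cmod (c t))\<^sup>2) * c t * of_real (a $ k) else 0))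
     + (\<bar>lam0\<bar> * cmod (mode (conv (u t) (u t)) \<xi> k)
        + cmod (mode (Nl beta V (u t)) \<xi> k - (if \<xi> = 0 then - of_real (beta * (cmod (c t))\<^sup>2 * V $ k) else 0)))))"
      unfolding q_def using beta
      by (intro sum_mono norm_triangle_le add_mono order_refl order_trans[OF norm_triangle_ineq4]) (simp_all add: norm_mult)
    also have "\<dots> = (\<Sum>\<xi>\<in>F. \<Sum>k\<in>UNIV. cmod (of_real (2 * beta * V $ k) * (\<Sum>j\<in>UNIV. of_real (V $ j) * W t \<xi> j)))
     + (beta * (\<Sum>\<xi>\<in>F. \<Sum>k\<in>UNIV. cmod (mode (\<lambda>y. (norm (u t y))\<^sup>2 *\<^sub>R u t y) \<xi> k - (if \<xi> = \<xi>0 then of_real ((cmod (c t))\<^sup>2) * c t * of_real (a $ k) else 0)))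
     + (\<bar>lam0\<bar> * (\<Sum>\<xi>\<in>F. \<Sum>k\<in>UNIV. cmod (mode (conv (u t) (u t)) \<xi> k))
        + (\<Sum>\<xi>\<in>F. \<Sum>k\<in>UNIV. cmod (mode (Nl beta V (u t)) \<xi> k - (if \<xi> = 0 then - of_real (beta * (cmod (c t))\<^sup>2 * V $ k) else 0)))))"
      by (simp only: sum.distrib sum_distrib_left)
    also have "\<dots> \<le> N * (2 * beta * (norm V)\<^sup>2 * Y) + (beta * (N * (N * (3 * \<epsilon>\<^sup>2 * Y)))
     + (\<bar>lam0\<bar> * (N * (N * ((1 + norm \<xi>0) * \<epsilon> * Y))) + N * (N * (4 * beta * norm V * \<epsilon> * Y))))"
      using beta by (intro add_mono mult_left_mono R0 swap R1[folded N_def] R2[folded N_def] R3[folded N_def]) auto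
    also have "\<dots> = Q * Y" by (simp add: Q_def algebra_simps)
    finally show ?thesis .
  qed

  define p where "p t \<xi> i = leray \<xi> (q t \<xi>) i" for t \<xi> i
  have p_le: "(\<Sum>\<xi>\<in>F. \<Sum>k\<in>UNIV. cmod (p t \<xi> k)) \<le> (1 + N) * (Q * Y)"
    if t: "0 < t" and Y: "\<And>F. finite F \<Longrightarrow> (\<Sum>\<xi>\<in>F. \<Sum>i\<in>UNIV. (1 + norm \<xi>) * cmod (W t \<xi> i)) \<le> Y" and F: "finite F" for t Y F
    unfolding p_def using sum_norm_leray_le[where F = F and z = "q t"] mult_left_mono[OF q_le[OF t Y F], of "1 + N"] N
    unfolding N_def by linarith

  have deriv: "((\<lambda>t. mode (u t) \<xi> i) has_vector_derivative drift lam0 G0 G2 V \<xi> * mode (u t) \<xi> i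
      - (p t \<xi> i + (if \<xi> = \<xi>0 then of_real (beta * (cmod (c t))\<^sup>2) * c t * of_real (a $ i) else 0))) (at t)" if t: "0 < t" for t \<xi> i
  proof -
    obtain \<nu> f where f: "fm_moments 4 \<nu> f" "u t = fourier_meas \<nu> f" by (rule fm_X_4_moments[OF u'(1)[OF t]])
    have fw': "weighted_fm 0 (u' t)" by (rule fm_X_fmw[OF u'(2)[OF t]])
    have "((\<lambda>t. mode (u t) \<xi> i) has_vector_derivative mode (u' t) \<xi> i) (at t)"
      by (rule mode_has_vector_derivative[OF weighted_fm_mono0[OF fw] fw' t u'(3)[OF t]])
    moreover have "of_real (2 * beta * V $ k) * (\<Sum>j\<in>UNIV. of_real (V $ j) * mode (u t) \<xi> j)
         + (of_real beta * mode (\<lambda>y. (norm (u t y))\<^sup>2 *\<^sub>R u t y) \<xi> k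
         + (of_real lam0 * mode (conv (u t) (u t)) \<xi> k - mode (Nl beta V (u t)) \<xi> k)) =
       q t \<xi> k + ((if \<xi> = \<xi>0 then of_real (beta * (cmod (c t))\<^sup>2) * c t else 0) * of_real (a $ k)
        + (if \<xi> = 0 then of_real (beta * (cmod (c t))\<^sup>2) else 0) * of_real (V $ k))" for k
    proof -
      have "(\<Sum>j\<in>UNIV. of_real (V $ j) * W t \<xi> j) = (\<Sum>j\<in>UNIV. of_real (V $ j) * mode (u t) \<xi> j)
         - (if \<xi> = \<xi>0 then c t else 0) * (\<Sum>j\<in>UNIV. complex_of_real (V $ j) * of_real (a $ j))"
        unfolding sum_distrib_left sum_subtractf[symmetric] by (rule sum.cong) (auto simp: W_def algebra_simps)
      then have "(\<Sum>j\<in>UNIV. of_real (V $ j) * W t \<xi> j) = (\<Sum>j\<in>UNIV. of_real (V $ j) * mode (u t) \<xi> j)"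
        by (simp add: Va')
      then show ?thesis by (simp add: q_def algebra_simps)
    qed
    \<comment> \<open>The projection keeps the cubic wave, polarised along \<open>a\<close>
      orthogonal to \<xi>0, and annihilates the quadratic one at frequency 0.\<close>
    moreover have "leray \<xi> (\<lambda>k. q t \<xi> k + ((if \<xi> = \<xi>0 then of_real (beta * (cmod (c t))\<^sup>2) * c t else 0) * of_real (a $ k)
        + (if \<xi> = 0 then of_real (beta * (cmod (c t))\<^sup>2) else 0) * of_real (V $ k))) i
       = p t \<xi> i + (if \<xi> = \<xi>0 then of_real (beta * (cmod (c t))\<^sup>2) * c t * of_real (a $ i) else 0)"
    proof -
      have "leray \<xi> (\<lambda>k. (if \<xi> = \<xi>0 then of_real (beta * (cmod (c t))\<^sup>2) * c t else 0) * of_real (a $ k)) i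
         = (if \<xi> = \<xi>0 then of_real (beta * (cmod (c t))\<^sup>2) * c t * of_real (a $ i) else 0)"
        using leray_orthogonal[OF a0 x0, of "of_real (beta * (cmod (c t))\<^sup>2) * c t" i] by (auto simp: leray_def)
      moreover have "leray \<xi> (\<lambda>k. (if \<xi> = 0 then of_real (beta * (cmod (c t))\<^sup>2) else 0) * of_real (V $ k)) i = 0"
        by (auto simp: leray_def)
      ultimately show ?thesis unfolding leray_add p_def by simp
    qed
    ultimately show ?thesis
      unfolding mode_equation[OF f fw' u'(4)[OF t]] by (simp only:)
  qed
  have mcont: "continuous_on {0..} (\<lambda>t. mode (u t) \<xi> i)" for \<xi> i
    using glob by (intro mode_continuous_on[OF fw]) (auto simp: global_solution_def)
  have ccont: "continuous_on {0..} c" unfolding c_def by (intro continuous_intros mcont)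
  \<comment> \<open>Pairing with \<open>a\<close> and \<open>a \<bullet> a = 1\<close> isolates the
    amplitude; the sum with \<open>p\<close> is the feedback of \<open>W\<close>, which vanishes
    once \<open>W\<close> does.\<close>
  have cderiv: "(c has_vector_derivative drift lam0 G0 G2 V \<xi>0 * c t
      - of_real (beta * (cmod (c t))\<^sup>2) * c t - (\<Sum>k\<in>UNIV. of_real (a $ k) * p t \<xi>0 k)) (at t)" if t: "0 < t" for t
  proof -
    have "(c has_vector_derivative (\<Sum>k\<in>UNIV. of_real (a $ k) * (drift lam0 G0 G2 V \<xi>0 * mode (u t) \<xi>0 k
      - (p t \<xi>0 k + of_real (beta * (cmod (c t))\<^sup>2) * c t * of_real (a $ k))))) (at t)"
      unfolding c_def[abs_def]
      by (intro has_vector_derivative_sum has_vector_derivative_mult_right)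
         (use deriv[OF t, of \<xi>0] in \<open>simp add: c_def\<close>)
    moreover have sum_eq: "(\<Sum>k\<in>UNIV. of_real (a $ k) * (drift lam0 G0 G2 V \<xi>0 * mode (u t) \<xi>0 k
      - (p t \<xi>0 k + of_real (beta * (cmod (c t))\<^sup>2) * c t * of_real (a $ k)))) =
      drift lam0 G0 G2 V \<xi>0 * c t - (\<Sum>k\<in>UNIV. of_real (a $ k) * p t \<xi>0 k)
       - of_real (beta * (cmod (c t))\<^sup>2) * c t * (\<Sum>k\<in>UNIV. complex_of_real (a $ k) * of_real (a $ k))"
      unfolding c_def[of t] sum_distrib_left sum_subtractf[symmetric] by (rule sum.cong) (simp_all add: algebra_simps)
    ultimately show ?thesis unfolding sum_eq by (simp add: aa algebra_simps)
  qed

  have m0: "mode (u 0) \<xi> i = (if \<xi> = \<xi>0 then of_real c0 * of_real (a $ i) else 0)" for \<xi> i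
    using bohr_multiplier_wave(3)[of \<xi> \<xi>0 "of_real c0 * of_real (a $ i)"]
    by (simp add: mode_def init cvec_def mult.assoc)
  have "c 0 = of_real c0 * (\<Sum>k\<in>UNIV. complex_of_real (a $ k) * of_real (a $ k))"
    by (simp add: c_def m0 sum_distrib_left mult_ac)
  then have c_0: "c 0 = of_real c0" by (simp add: aa)
  \<comment> \<open>At \<xi>0 the cubic contributions to the mode and to \<open>c\<close> cancel in
    \<open>W\<close>. What is left is \<open>- p\<close> together with the
    \<open>a\<close>-component of \<open>p\<close> that was fed into \<open>c\<close>, so
    \<open>h\<close> is bounded through \<open>p\<close> alone.\<close>
  define h where "h t \<xi> i = (if \<xi> = \<xi>0 then of_real (a $ i) * (\<Sum>k\<in>UNIV. of_real (a $ k) * p t \<xi>0 k) else 0) - p t \<xi> i" for t \<xi> i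
  have W0: "W t \<xi> i = 0" if t: "0 \<le> t" for t \<xi> i
  proof -
    have "(\<lambda>t p. W t (fst p) (snd p)) t (\<xi>, i) = 0"
    proof (rule sectorial_uniqueness[where G = G2 and g = "- G0" and r = "\<lambda>p. norm (fst p)"
       and \<sigma> = "\<lambda>p. drift lam0 G0 G2 V (fst p)" and h = "\<lambda>t p. h t (fst p) (snd p)"
       and K = "N * (2 * \<epsilon>) + (1 + norm \<xi>0) * (N * \<epsilon>)" and L = "(1 + N) * ((1 + N) * Q)"])
      show "Re (drift lam0 G0 G2 V (fst j)) = - G0 * norm (fst j) ^ 2 - G2 * norm (fst j) ^ 4" for j :: "(real^'n) \<times> 'n"
        by (simp add: drift_def)
      show "continuous_on {0..} (\<lambda>s. W s (fst j) (snd j))" for j :: "(real^'n) \<times> 'n"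
        unfolding W_def by (cases "fst j = \<xi>0") (auto intro!: continuous_intros mcont ccont)
      show "((\<lambda>s. W s (fst j) (snd j)) has_vector_derivative drift lam0 G0 G2 V (fst j) * W s (fst j) (snd j) + h s (fst j) (snd j)) (at s)"
        if s: "0 < s" for s and j :: "(real^'n) \<times> 'n"
      proof (cases "fst j = \<xi>0")
        case True
        have "((\<lambda>s. mode (u s) \<xi>0 (snd j) - c s * of_real (a $ snd j)) has_vector_derivative
          (drift lam0 G0 G2 V \<xi>0 * mode (u s) \<xi>0 (snd j) - (p s \<xi>0 (snd j) + of_real (beta * (cmod (c s))\<^sup>2) * c s * of_real (a $ snd j)))
          - (drift lam0 G0 G2 V \<xi>0 * c s - of_real (beta * (cmod (c s))\<^sup>2) * c s - (\<Sum>k\<in>UNIV. of_real (a $ k) * p s \<xi>0 k)) * of_real (a $ snd j)) (at s)"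
          using deriv[OF s, of \<xi>0 "snd j"]
          by (intro has_vector_derivative_diff has_vector_derivative_mult_left cderiv[OF s]) simp
        then show ?thesis unfolding W_def h_def True by (simp add: algebra_simps)
      next
        case False
        then show ?thesis using deriv[OF s, of "fst j" "snd j"] unfolding W_def h_def by simp
      qed
      show "(\<Sum>j\<in>J. (1 + norm (fst j)) * cmod (W s (fst j) (snd j))) \<le> N * (2 * \<epsilon>) + (1 + norm \<xi>0) * (N * \<epsilon>)"
        if "0 \<le> s" "finite J" for s and J :: "((real^'n) \<times> 'n) set"
        using sum_pairs_le[OF that(2), of "\<lambda>\<xi> i. (1 + norm \<xi>) * cmod (W s \<xi> i)"] bound[OF that(1), of "fst ` J"] that by auto
      show "(\<Sum>j\<in>J. cmod (h s (fst j) (snd j))) \<le> (1 + N) * ((1 + N) * Q) * Y"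
        if s: "0 < s" and Y: "\<And>J. finite J \<Longrightarrow> (\<Sum>j\<in>J. (1 + norm (fst j)) * cmod (W s (fst j) (snd j))) \<le> Y" and J: "finite J"
        for s Y and J :: "((real^'n) \<times> 'n) set"
      proof -
        have Y': "(\<Sum>\<xi>\<in>F. \<Sum>i\<in>UNIV. (1 + norm \<xi>) * cmod (W s \<xi> i)) \<le> Y" if "finite F" for F
          using Y[of "F \<times> UNIV"] that by (simp add: sum.cartesian_product case_prod_unfold)
        note P = p_le[OF s Y']
        define S where "S = (\<Sum>k\<in>UNIV. cmod (p s \<xi>0 k))"
        have S0: "0 \<le> S" by (simp add: S_def sum_nonneg)
        have "(\<Sum>j\<in>J. cmod (h s (fst j) (snd j))) \<le> (\<Sum>\<xi>\<in>fst ` J. \<Sum>i\<in>UNIV. cmod (h s \<xi> i))"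
          by (rule sum_pairs_le[OF J]) simp
        also have "\<dots> \<le> (\<Sum>\<xi>\<in>fst ` J. \<Sum>i\<in>(UNIV::'n set). (if \<xi> = \<xi>0 then S else 0) + cmod (p s \<xi> i))"
        proof (intro sum_mono)
          fix \<xi> i
          have "cmod (of_real (a $ i) * (\<Sum>k\<in>UNIV. of_real (a $ k) * p s \<xi>0 k)) \<le> 1 * S"
            unfolding norm_mult S_def
            by (intro mult_mono order_trans[OF norm_sum sum_mono])
               (auto simp: ai norm_mult intro!: sum_nonneg mult_left_le_one_le)
          then show "cmod (h s \<xi> i) \<le> (if \<xi> = \<xi>0 then S else 0) + cmod (p s \<xi> i)"
            unfolding h_def by (intro order_trans[OF norm_triangle_ineq4] add_mono) auto
        qed
        also have "\<dots> = (\<Sum>\<xi>\<in>fst ` J. if \<xi> = \<xi>0 then N * S else 0) + (\<Sum>\<xi>\<in>fst ` J. \<Sum>i\<in>UNIV. cmod (p s \<xi> i))"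
          by (auto simp: sum.distrib N_def intro!: sum.cong)
        \<comment> \<open>The first summand belongs to the single frequency \<xi>0, whose
          \<open>N\<close> components each carry at most the amplitude source \<open>S\<close>; the
          total is the constant \<open>L\<close> chosen above.\<close>
        also have "\<dots> \<le> N * ((1 + N) * (Q * Y)) + (1 + N) * (Q * Y)"
        proof (rule add_mono)
          have "S \<le> (1 + N) * (Q * Y)" using P[of "{\<xi>0}"] by (simp add: S_def)
          then have "N * S \<le> N * ((1 + N) * (Q * Y))" using N by (rule mult_left_mono)
          then show "(\<Sum>\<xi>\<in>fst ` J. if \<xi> = \<xi>0 then N * S else 0) \<le> N * ((1 + N) * (Q * Y))"
            using J S0 N by (auto simp: sum.delta intro: order_trans[OF mult_nonneg_nonneg])
          show "(\<Sum>\<xi>\<in>fst ` J. \<Sum>i\<in>UNIV. cmod (p s \<xi> i)) \<le> (1 + N) * (Q * Y)" by (rule P) (use J in simp_all)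
        qed
        also have "\<dots> = (1 + N) * ((1 + N) * Q) * Y" by (simp add: algebra_simps)
        finally show ?thesis .
      qed
      show "W 0 (fst j) (snd j) = 0" for j :: "(real^'n) \<times> 'n" by (simp add: W_def m0 c_0)
    qed (use G2 t in auto)
    then show ?thesis by simp
  qed
  have p0: "p t \<xi> k = 0" if t: "0 < t" for t \<xi> k
  proof -
    \<comment> \<open>With \<open>W = 0\<close> the bound \<open>Y = 0\<close> is admissible, so all
      forcing disappears.\<close>
    have "(\<Sum>\<xi>\<in>{\<xi>}. \<Sum>k\<in>UNIV. cmod (p t \<xi> k)) \<le> (1 + N) * (Q * 0)"
      by (rule p_le[OF t]) (use W0 t in auto)
    then have "(\<Sum>k\<in>UNIV. cmod (p t \<xi> k)) = 0" by (simp add: antisym sum_nonneg)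
    then show ?thesis by (simp add: sum_nonneg_eq_0_iff)
  qed
  show False
  proof (rule landau_growth[OF mu(2) beta eps _ ccont _ cn])
    show "Re (drift lam0 G0 G2 V \<xi>0) = \<mu>" by (simp add: drift_def mu(1))
    show "(c has_vector_derivative drift lam0 G0 G2 V \<xi>0 * c t - of_real (beta * (cmod (c t))\<^sup>2) * c t) (at t)" if "0 < t" for t
      using cderiv[OF that] by (simp add: p0[OF that])
    show "c 0 \<noteq> 0" using c0 by (simp add: c_0)
  qed
qed

section \<open>Small initial waves and the choice of parameters\<close>

lemma wave_fm_X:
  assumes "\<xi>0 \<noteq> 0" "(\<Sum>i\<in>UNIV. complex_of_real (\<xi>0 $ i) * z $ i) = 0"
  shows "fm_X s (\<lambda>x. cis (- (x \<bullet> \<xi>0)) *s z)"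
    and "fmpow_norm s (\<lambda>x. cis (- (x \<bullet> \<xi>0)) *s z) \<le> (1 + weight s \<xi>0) * norm z"
proof -
  let ?\<nu> = "distr (count_space (UNIV :: unit set)) borel (\<lambda>_. \<xi>0)"
  have i: "integrable ?\<nu> (\<lambda>\<xi>. weight s \<xi> *\<^sub>R z)"
    by (subst integrable_distr_eq) (auto intro!: integrable_count_space)
  have A1: "AE \<xi> in ?\<nu>. \<xi> = 0 \<longrightarrow> z = 0"
    by (subst AE_distr_iff) (use assms in auto)
  have A2: "AE \<xi> in ?\<nu>. (\<Sum>i\<in>UNIV. complex_of_real (\<xi> $ i) * z $ i) = 0"
    by (subst AE_distr_iff) (use assms in auto)
  show "fm_X s (\<lambda>x. cis (- (x \<bullet> \<xi>0)) *s z)"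
    unfolding fm_X_def by (rule exI[of _ ?\<nu>], rule exI[of _ "\<lambda>_. z"]) (intro conjI fm_rep_wave A1 A2 i)
  have "(\<integral>\<xi>. norm z \<partial>?\<nu>) + (\<integral>\<xi>. weight s \<xi> * norm z \<partial>?\<nu>) = norm z + weight s \<xi>0 * norm z"
    by (subst (1 2) integral_distr) (auto simp: lebesgue_integral_count_space_finite UNIV_unit)
  \<comment> \<open>One representation suffices to bound the infimum from above; the Dirac measure
    provides it.\<close>
  moreover have "fmpow_norm s (\<lambda>x. cis (- (x \<bullet> \<xi>0)) *s z) \<le> (\<integral>\<xi>. norm z \<partial>?\<nu>) + (\<integral>\<xi>. weight s \<xi> * norm z \<partial>?\<nu>)"
    unfolding fmpow_norm_def
  proof (rule cInf_lower)
    show "bdd_below {(\<integral>\<xi>. norm (f \<xi>) \<partial>\<nu>) + (\<integral>\<xi>. weight s \<xi> * norm (f \<xi>) \<partial>\<nu>)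
       | \<nu> f. fm_rep \<nu> f (\<lambda>x. cis (- (x \<bullet> \<xi>0)) *s z) \<and> integrable \<nu> (\<lambda>\<xi>. weight s \<xi> *\<^sub>R f \<xi>)}"
      by (rule bdd_belowI[of _ 0]) (auto intro!: add_nonneg_nonneg Bochner_Integration.integral_nonneg)
    show "(\<integral>\<xi>. norm z \<partial>?\<nu>) + (\<integral>\<xi>. weight s \<xi> * norm z \<partial>?\<nu>)
       \<in> {(\<integral>\<xi>. norm (f \<xi>) \<partial>\<nu>) + (\<integral>\<xi>. weight s \<xi> * norm (f \<xi>) \<partial>\<nu>)
       | \<nu> f. fm_rep \<nu> f (\<lambda>x. cis (- (x \<bullet> \<xi>0)) *s z) \<and> integrable \<nu> (\<lambda>\<xi>. weight s \<xi> *\<^sub>R f \<xi>)}"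
      by (rule CollectI, rule exI[of _ ?\<nu>], rule exI[of _ "\<lambda>_. z"]) (intro conjI refl fm_rep_wave i)
  qed
  ultimately show "fmpow_norm s (\<lambda>x. cis (- (x \<bullet> \<xi>0)) *s z) \<le> (1 + weight s \<xi>0) * norm z"
    by (simp add: algebra_simps)
qed

theorem theorem3p13:
  fixes V :: "real^'n" and lam0 beta G0 G2 alpha \<gamma> :: real
  assumes "CARD('n) = 2 \<or> CARD('n) = 3"
    and "G2 > 0" and "beta > 0" and "G0 < 0" and "alpha < 0"
    and "norm V = sqrt (- alpha / beta)"
    and "1/4 \<le> \<gamma>" and "\<gamma> < 1"
  shows "\<exists>\<epsilon>>0. \<forall>\<delta>>0. \<exists>u0. fm_X (4 * \<gamma>) u0 \<and> fmpow_norm (4 * \<gamma>) u0 < \<delta> \<and>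
           \<not> (\<exists>u. u 0 = u0 \<and> global_solution lam0 beta G0 G2 V \<gamma> u
                  \<and> (\<forall>t\<ge>0. fmpow_norm (4 * \<gamma>) (u t) < \<epsilon>))"
proof -
  have V: "norm V > 0" using assms by (simp add: divide_neg_pos)
  have "2 \<le> DIM(real^'n)" using assms(1) by auto
  then obtain b where b: "b \<noteq> 0" "orthogonal V b" by (rule orthogonal_to_vector_exists)
  define a where "a = b /\<^sub>R norm b"
  have a1: "a \<bullet> a = 1" using b by (simp add: a_def dot_square_norm power2_eq_square)
  have Va: "V \<bullet> a = 0" using b by (simp add: a_def orthogonal_def)
  define k where "k = sqrt (- G0 / (2 * G2))"
  have k: "0 < k" "k\<^sup>2 = - G0 / (2 * G2)" using assms by (auto simp: k_def field_simps divide_neg_pos)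
  define \<xi>0 where "\<xi>0 = (k / norm V) *\<^sub>R V"
  have nx: "norm \<xi>0 = k" using V k by (simp add: \<xi>0_def)
  have x0: "\<xi>0 \<noteq> 0" using nx k by auto
  have ax: "a \<bullet> \<xi>0 = 0" using Va by (simp add: \<xi>0_def inner_commute)
  define \<mu> where "\<mu> = - (G0 * (norm \<xi>0)\<^sup>2 + G2 * norm \<xi>0 ^ 4)"
  have "\<mu> = - (G0 * k\<^sup>2 + G2 * (k\<^sup>2)\<^sup>2)" by (simp add: \<mu>_def nx flip: power_mult)
  also have "\<dots> = G0\<^sup>2 / (4 * G2)" unfolding k(2) using assms(2) by (simp add: field_simps power2_eq_square)
  finally have mu: "0 < \<mu>" using assms by simp
  define \<epsilon> where "\<epsilon> = sqrt (\<mu> / (2 * beta))"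
  have e: "0 < \<epsilon>" "beta * \<epsilon>\<^sup>2 \<le> \<mu> / 2" using mu assms by (auto simp: \<epsilon>_def)
  show ?thesis
  proof (intro exI[of _ \<epsilon>] conjI allI impI e(1))
    fix \<delta> :: real assume d: "0 < \<delta>"
    \<comment> \<open>Makes the norm of the initial wave at most
      \<open>\<delta> / 2\<close>.\<close>
    define c0 where "c0 = \<delta> / (2 * (1 + weight (4 * \<gamma>) \<xi>0))"
    have w: "0 < 1 + weight (4 * \<gamma>) \<xi>0" by (simp add: add_pos_nonneg)
    have c0: "0 < c0" using d w by (simp add: c0_def)
    define z where "z = complex_of_real c0 *s cvec a"
    have "norm (cvec a) = norm a" by (simp add: cvec_def norm_vec_def)
    moreover have "norm a = 1" using a1 by (simp add: norm_eq_sqrt_inner)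
    ultimately have nz: "norm z = c0" using c0 by (simp add: z_def norm_vector_smult)
    have "(\<Sum>i\<in>UNIV. complex_of_real (\<xi>0 $ i) * z $ i) = of_real c0 * (\<Sum>i\<in>UNIV. complex_of_real (a $ i) * of_real (\<xi>0 $ i))"
      by (simp add: z_def cvec_def sum_distrib_left mult_ac)
    then have "(\<Sum>i\<in>UNIV. complex_of_real (\<xi>0 $ i) * z $ i) = 0" by (simp add: sum_of_real_mult ax)
    note wave = wave_fm_X[OF x0 this, of "4 * \<gamma>"]
    have "W * (\<delta> / (2 * W)) < \<delta>" if "0 < W" for W using that d by simp
    from this[OF w] have "(1 + weight (4 * \<gamma>) \<xi>0) * norm z < \<delta>" by (simp only: nz c0_def)
    with wave have "fm_X (4 * \<gamma>) (\<lambda>x. cis (- (x \<bullet> \<xi>0)) *s z)" "fmpow_norm (4 * \<gamma>) (\<lambda>x. cis (- (x \<bullet> \<xi>0)) *s z) < \<delta>" by auto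
    moreover have "\<not> (\<exists>u. u 0 = (\<lambda>x. cis (- (x \<bullet> \<xi>0)) *s z) \<and> global_solution lam0 beta G0 G2 V \<gamma> u
                  \<and> (\<forall>t\<ge>0. fmpow_norm (4 * \<gamma>) (u t) < \<epsilon>))"
      using no_small_global_solution[OF assms(2,3) a1 Va ax x0 \<mu>_def mu e(2) assms(7), of c0] c0
      unfolding z_def by auto
    ultimately show "\<exists>u0. fm_X (4 * \<gamma>) u0 \<and> fmpow_norm (4 * \<gamma>) u0 < \<delta> \<and>
           \<not> (\<exists>u. u 0 = u0 \<and> global_solution lam0 beta G0 G2 V \<gamma> u
                  \<and> (\<forall>t\<ge>0. fmpow_norm (4 * \<gamma>) (u t) < \<epsilon>))" by blast
  qed
qed

end
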